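(* Let $1\le p_0<p\le q<q_0\le\infty$ and $n\left(\frac1p-\frac1q\right)\le\alpha<n\left(\frac1{p_0}-\frac1{q_0}\right)$. Suppose $T$ is a sublinear operator and both $T$ and $\mathcal M^{\#}_{T,q_0}$ are locally weak $L^{p_0}\to L^{\frac{p_0n}{n-\alpha p_0}}$ bounded. Let $\omega,\sigma$ be weights, put $u=\omega^{\frac{p_0}{p_0-p}}$, $v=\sigma^{\frac{q_0'}{q_0'-q'}}$, and suppose $(u,v)\in A^{\frac\alpha n-\frac1{p_0}+\frac1{q_0}}_{\frac1{p_0}-\frac1p,\ \frac1q-\frac1{q_0}}$. Let $\mathcal N$ be the best constant such that for all $f,g\in L_c^\infty(\mathbb R^n)$ $$\int_{\mathbb R^n}|Tf||g|\,dx\le\mathcal N\|f\|_{L^p(\omega)}\|g\|_{L^{q'}(\sigma)} .$$ Then $$\mathcal N\lesssim[u,v]_{A^{\frac\alpha n-\frac1{p_0}+\frac1{q_0}}_{\frac1{p_0}-\frac1p,\ \frac1q-\frac1{q_0}}}\cdot\begin{cases}[u]_{A_\infty}^{1-\frac1{(p')^2}}[v]_{A_\infty}^{\frac1{(p')^2}}+[u]_{A_\infty}^{\frac1{p^2}}[v]_{A_\infty}^{1-\frac1{p^2}}&\text{if }p=q,\ \alpha>0,\\[4pt][u]_{A_\infty}^{\frac1q}+[v]_{A_\infty}^{\frac1{p'}}&\text{otherwise.}\end{cases}$$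
   Context: Notation: cubes are half-open with sides parallel to the axes; $3Q$ is the concentric dilate. $\langle f\rangle_{r,Q}=\big(\frac1{|Q|}\int_Qf^r\big)^{1/r}$; $p'$ is the conjugate exponent; $1/q_0=0$, $q_0'=1$ if $q_0=\infty$. $L_c^\infty$ denotes bounded compactly supported functions. Sublinear: $|T(f+g)|\le|Tf|+|Tg|$ and $|T(cf)|=|c||Tf|$. Sharp grand maximal truncation operator: $\mathcal M^{\#}_{T,s}f(x)=\sup_{Q\ni x}\operatorname{osc}_s(T(f\chi_{\mathbb R^n\setminus3Q});Q)$, supremum over all cubes $Q\ni x$, where $\operatorname{osc}_s(h;Q)=\big(\frac1{|Q|^2}\int_{Q\times Q}|h(x')-h(x'')|^s\,dx'dx''\big)^{1/s}$ (essential supremum if $s=\infty$). Locally weak boundedness: for $1\le p_0<\infty$, $0\le\alpha<\frac n{p_0}$, an operator $T$ is locally weak $L^{p_0}\to L^{\frac{p_0n}{n-\alpha p_0}}$ bounded if there is a non-increasing function $\varphi_{T,p_0,\alpha}:(0,1)\to[0,\infty)$ such that $|\{x\in Q:|T(f\chi_Q)(x)|>\varphi_{T,p_0,\alpha}(\lambda)\langle|f|\rangle_{p_0,Q}|Q|^{\frac\alpha n}\}|\le\lambda|Q|$ for all $\lambda\in(0,1)$, all cubes $Q$ and all $f\in L^{p_0}(Q)$. Weights: a weight is a non-negative locally integrable function (positive a.e., so that negative powers make sense); $w(Q)=\int_Qw$; $\|f\|_{L^p(w)}=(\int|f|^pw)^{1/p}$. $[w]_{A_\infty}=\sup_Q\frac1{w(Q)}\int_QM(w\chi_Q)$,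 $M$ the Hardy–Littlewood maximal function (the value $+\infty$ is allowed). For $a,\beta,\gamma\in\mathbb R$, $(u,v)\in A^a_{\beta,\gamma}$ means $[u,v]_{A^a_{\beta,\gamma}}:=\sup_Q|Q|^au(Q)^\beta v(Q)^\gamma<\infty$. Suprema are over all cubes. $A\lesssim B$ means $A\le CB$ with $C$ depending only on $n,p,q,p_0,q_0,\alpha$ and $T$, not on the weights. *)

theory Defs
  imports "HOL-Analysis.Analysis" "HOL-Probability.Essential_Supremum"
begin

text \<open>
  All spatial integrals are with respect to Lebesgue measure on \<open>real ^ 'n\<close> and take values in
  \<^typ>\<open>ennreal\<close>, so that infinite norms, characteristics and constants are represented as such.
  The value type \<open>'b :: {real_normed_field, euclidean_space}\<close> of the functions an operator acts on
  covers both the real and the complex numbers.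
\<close>

text \<open>Real powers on \<open>[0,\<infinity>]\<close>, with \<open>0 ^ r = \<infinity>\<close> and \<open>\<infinity> ^ r = 0\<close> for \<open>r < 0\<close>, and \<open>x ^ 0 = 1\<close>.\<close>

definition epowr :: "ennreal \<Rightarrow> real \<Rightarrow> ennreal" where
  "epowr x r =
     (if r = 0 then 1
      else if x = 0 then (if r > 0 then 0 else \<infinity>)
      else if x = \<infinity> then (if r > 0 then \<infinity> else 0)
      else ennreal (enn2real x powr r))"

definition conj_exp :: "ereal \<Rightarrow> real" where
  "conj_exp s = (if s = \<infinity> then 1 else real_of_ereal s / (real_of_ereal s - 1))"

text \<open>
  \<open>cube c l\<close> has centre \<open>c\<close> and side length \<open>l\<close>, so that the dilate \<open>3Q\<close> of \<open>Q = cube c l\<close> is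
  \<open>cube c (3 * l)\<close>. Only \<open>l > 0\<close> gives a cube; suprema over cubes range over pairs \<open>(c, l)\<close>
  with \<open>l > 0\<close>.
\<close>

definition cube :: "real ^ 'n \<Rightarrow> real \<Rightarrow> (real ^ 'n) set" where
  "cube c l = {x. \<forall>i. c $ i - l / 2 \<le> x $ i \<and> x $ i < c $ i + l / 2}"

definition restrict_fun :: "(real ^ 'n) set \<Rightarrow> (real ^ 'n \<Rightarrow> 'b) \<Rightarrow> real ^ 'n \<Rightarrow> 'b::real_vector" where
  "restrict_fun A f = (\<lambda>x. indicator A x *\<^sub>R f x)"

definition avg :: "real \<Rightarrow> (real ^ 'n) set \<Rightarrow> (real ^ 'n \<Rightarrow> 'b::real_normed_vector) \<Rightarrow> ennreal" where
  "avg r Q f =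
     epowr ((\<integral>\<^sup>+x\<in>Q. ennreal (norm (f x) powr r) \<partial>lebesgue) / emeasure lebesgue Q) (1 / r)"

definition osc :: "ereal \<Rightarrow> (real ^ 'n \<Rightarrow> 'b::real_normed_vector) \<Rightarrow> (real ^ 'n) set \<Rightarrow> ennreal" where
  "osc s h Q =
     (if s = \<infinity>
      then esssup (restrict_space (lebesgue \<Otimes>\<^sub>M lebesgue) (Q \<times> Q))
             (\<lambda>z. ennreal (norm (h (fst z) - h (snd z))))
      else epowr
             ((\<integral>\<^sup>+z\<in>Q \<times> Q. ennreal (norm (h (fst z) - h (snd z)) powr real_of_ereal s)
                 \<partial>(lebesgue \<Otimes>\<^sub>M lebesgue)) / (emeasure lebesgue Q)\<^sup>2)
             (1 / real_of_ereal s))"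

text \<open>
  Compactly supported \<open>L^p\<close> functions. With \<open>p = p0\<close> this is the common domain on which the operator
  \<open>T\<close> is used: it contains \<open>f \<chi>_Q\<close> for \<open>f \<in> L^p(Q)\<close>, all truncations of such functions, and
  \<open>L_c^\<infinity>\<close>.
\<close>

definition Lp_c :: "real \<Rightarrow> (real ^ 'n \<Rightarrow> 'b::real_normed_vector) set" where
  "Lp_c p = {f. f \<in> borel_measurable lebesgue \<and> bounded {x. f x \<noteq> 0} \<and>
                (\<integral>\<^sup>+x. ennreal (norm (f x) powr p) \<partial>lebesgue) < \<infinity>}"

definition Linf_c :: "(real ^ 'n \<Rightarrow> 'b::real_normed_vector) set" where
  "Linf_c = {f. f \<in> borel_measurable lebesgue \<and> bounded {x. f x \<noteq> 0} \<and> bounded (range f)}"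

text \<open>
  Operators act on representatives; no compatibility with equality almost everywhere is required.
  The values of \<open>T\<close> outside \<open>D\<close> are irrelevant.
\<close>

definition sublinear_on ::
  "(real ^ 'n \<Rightarrow> 'b) set \<Rightarrow> ((real ^ 'n \<Rightarrow> 'b) \<Rightarrow> real ^ 'n \<Rightarrow> 'b::{real_normed_field, euclidean_space})
     \<Rightarrow> bool" where
  "sublinear_on D T \<longleftrightarrow>
     (\<forall>f\<in>D. T f \<in> borel_measurable lebesgue) \<and>
     (\<forall>f\<in>D. \<forall>g\<in>D. AE x in lebesgue.
        norm (T (\<lambda>y. f y + g y) x) \<le> norm (T f x) + norm (T g x)) \<and>
     (\<forall>f\<in>D. \<forall>c. AE x in lebesgue. norm (T (\<lambda>y. c * f y) x) = norm c * norm (T f x))"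

definition sharp_grand_maximal ::
  "((real ^ 'n \<Rightarrow> 'b) \<Rightarrow> real ^ 'n \<Rightarrow> 'b::real_normed_vector) \<Rightarrow> ereal
     \<Rightarrow> (real ^ 'n \<Rightarrow> 'b) \<Rightarrow> real ^ 'n \<Rightarrow> ennreal" where
  "sharp_grand_maximal T s f x =
     (SUP (c, l)\<in>{(c, l). l > 0 \<and> x \<in> cube c l}.
        osc s (T (restrict_fun (- cube c (3 * l)) f)) (cube c l))"

text \<open>
  Stated for \<open>[0,\<infinity>]\<close>-valued operators, so that it applies to \<open>f \<mapsto> |T f|\<close> as well as to maximal
  operators. Superlevel sets of the latter are unions of cubes, hence Lebesgue (although in general
  not Borel) measurable.
\<close>

definition locally_weak_bounded ::
  "real \<Rightarrow> real \<Rightarrow> ((real ^ 'n \<Rightarrow> 'b::{real_normed_field, euclidean_space}) \<Rightarrow> real ^ 'n \<Rightarrow> ennreal)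
     \<Rightarrow> bool" where
  "locally_weak_bounded p0 \<alpha> S \<longleftrightarrow>
     (\<exists>\<phi> :: real \<Rightarrow> real.
        antimono_on {0<..<1} \<phi> \<and> (\<forall>t\<in>{0<..<1}. 0 \<le> \<phi> t) \<and>
        (\<forall>t\<in>{0<..<1}. \<forall>c l. l > 0 \<longrightarrow>
          (\<forall>f. set_borel_measurable lebesgue (cube c l) f \<and>
               (\<integral>\<^sup>+x\<in>cube c l. ennreal (norm (f x) powr p0) \<partial>lebesgue) < \<infinity> \<longrightarrow>
             emeasure lebesgue
               {x \<in> cube c l.
                  S (restrict_fun (cube c l) f) x
                    > ennreal (\<phi> t) * avg p0 (cube c l) f
                        * epowr (emeasure lebesgue (cube c l)) (\<alpha> / real CARD('n))}
             \<le> ennreal t * emeasure lebesgue (cube c l))))"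

definition wmeas :: "(real ^ 'n \<Rightarrow> real) \<Rightarrow> (real ^ 'n) set \<Rightarrow> ennreal" where
  "wmeas w A = (\<integral>\<^sup>+x\<in>A. ennreal (w x) \<partial>lebesgue)"

definition weight :: "(real ^ 'n \<Rightarrow> real) \<Rightarrow> bool" where
  "weight w \<longleftrightarrow> w \<in> borel_measurable lebesgue \<and> (\<forall>x. 0 \<le> w x) \<and> (AE x in lebesgue. 0 < w x) \<and>
     (\<forall>c l. wmeas w (cube c l) < \<infinity>)"

definition weighted_norm ::
  "real \<Rightarrow> (real ^ 'n \<Rightarrow> real) \<Rightarrow> (real ^ 'n \<Rightarrow> 'b::real_normed_vector) \<Rightarrow> ennreal" where
  "weighted_norm p w f = epowr (\<integral>\<^sup>+x. ennreal (norm (f x) powr p * w x) \<partial>lebesgue) (1 / p)"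

definition HL_maximal :: "(real ^ 'n \<Rightarrow> 'b::real_normed_vector) \<Rightarrow> real ^ 'n \<Rightarrow> ennreal" where
  "HL_maximal f x = (SUP (c, l)\<in>{(c, l). l > 0 \<and> x \<in> cube c l}. avg 1 (cube c l) f)"

definition A_infinity_const :: "(real ^ 'n \<Rightarrow> real) \<Rightarrow> ennreal" where
  "A_infinity_const w =
     (SUP (c, l)\<in>{(c, l). l > 0}.
        (\<integral>\<^sup>+x\<in>cube c l. HL_maximal (restrict_fun (cube c l) w) x \<partial>lebesgue) / wmeas w (cube c l))"

definition A_const ::
  "real \<Rightarrow> real \<Rightarrow> real \<Rightarrow> (real ^ 'n \<Rightarrow> real) \<Rightarrow> (real ^ 'n \<Rightarrow> real) \<Rightarrow> ennreal" where
  "A_const a \<beta> \<gamma> u v =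
     (SUP (c, l)\<in>{(c, l). l > 0}.
        epowr (emeasure lebesgue (cube c l)) a
          * epowr (wmeas u (cube c l)) \<beta> * epowr (wmeas v (cube c l)) \<gamma>)"

text \<open>\<open>r\<close> is the exponent of the second norm, i.e. \<open>r = q'\<close> in the application.\<close>

definition best_const ::
  "((real ^ 'n \<Rightarrow> 'b) \<Rightarrow> real ^ 'n \<Rightarrow> 'b::{real_normed_field, euclidean_space})
     \<Rightarrow> real \<Rightarrow> real \<Rightarrow> (real ^ 'n \<Rightarrow> real) \<Rightarrow> (real ^ 'n \<Rightarrow> real) \<Rightarrow> ennreal" where
  "best_const T p r \<omega> \<sigma> =
     Inf {N. \<forall>f\<in>Linf_c. \<forall>g\<in>(Linf_c :: (real ^ 'n \<Rightarrow> 'b) set).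
               (\<integral>\<^sup>+x. ennreal (norm (T f x) * norm (g x)) \<partial>lebesgue)
                 \<le> N * weighted_norm p \<omega> f * weighted_norm r \<sigma> g}"

end

theory Submission
  imports Defs
begin

text \<open>
  If \<open>f\<close> and \<open>g\<close> are supported in a cube \<open>Q\<^sub>0\<close>, a stopping-time argument applied to \<open>T\<close>, to its sharp grand
  maximal truncation and to averages of \<open>f\<close> over triples dominates \<open>\<integral> \<bar>T f\<bar> \<bar>g\<bar>\<close> by a sparse form
  \<open>\<Sum> \<bar>3Q\<bar>\<^sup>a (\<integral>\<^bsub>3Q\<^esub> \<bar>f\<bar> ^ p0) ^ (1 / p0) (\<integral>\<^bsub>3Q\<^esub> \<bar>g\<bar> ^ q0') ^ (1 / q0')\<close> with \<open>a = \<alpha> / n - 1 / p0 + 1 / q0\<close>.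
  The triples split into \<open>3\<^sup>n\<close> laminar families, and writing \<open>\<bar>f\<bar> ^ p0 = F u\<close> and \<open>\<bar>g\<bar> ^ q0' = G v\<close> makes each
  form a two-weight form. It is decomposed along the principal sets of \<open>F\<close> and \<open>G\<close>; restricted to the
  cubes on which \<open>\<bar>Q\<bar>\<^sup>a u(Q)\<^sup>\<beta> v(Q)\<^sup>\<gamma>\<close> has a given dyadic size it satisfies a testing condition free of
  \<open>A\<^sub>\<infinity>\<close> constants, so that only the outer sum over principal sets costs a single power of one of
  these constants. For \<open>p = q\<close> and \<open>\<alpha> > 0\<close> Hoelder's inequality and the Carleson embedding theorem suffice.
\<close>


section \<open>Principal sets of laminar families\<close>

text \<open>With neither linearity nor a kernel, \<open>T\<close> on a cube Q and on a stopping cube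
  P inside it can only be compared through h, the image under \<open>T\<close> of f restricted to 3Q
  minus 3P. The sharp truncation controls the oscillation of h on P but not its size; the size is
  read off on a set filling a quarter of P, where the weak bounds of \<open>T\<close> on 3Q and on
  3P both apply. Since the bound on 3P involves f on 3P, the averages of f over triples have to be
  stopped as well. Only finite subfamilies are ever summed: g is replaced by 0 on deep stopping
  cubes, the recursion then ends without a remainder, and no integrability of T f is presupposed.
  With \<beta> = 1/p0 - 1/p and \<gamma> = 1/q - 1/q0 one has a + \<beta> + \<gamma> = \<alpha>/n -
  (1/p - 1/q), which is nonnegative. The testing argument perturbs the form by a small power
  \<epsilon> of the characteristic and needs \<epsilon> (a + \<beta> + \<gamma>) <= 1/p - 1/q. A
  suitable \<epsilon> > 0 exists if p < q, and for p = q exactly if \<alpha> = 0; hence the case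
  distinction in the bound.\<close>

lemma powr_sum_Holder:
  fixes a b :: "'i \<Rightarrow> real"
  assumes "finite I" "\<And>i. i \<in> I \<Longrightarrow> 0 \<le> a i" "\<And>i. i \<in> I \<Longrightarrow> 0 \<le> b i" "0 \<le> s" "s \<le> 1"
  shows "(\<Sum>i\<in>I. a i powr s * b i powr (1 - s)) \<le> (\<Sum>i\<in>I. a i) powr s * (\<Sum>i\<in>I. b i) powr (1 - s)"
\<comment> \<open>Since \<open>0 powr 0 = 0\<close>, every summand vanishes here even for s = 0 or s
  = 1. The exponent s = 0 does occur, namely for an infinite q0.\<close>
proof (cases "(\<Sum>i\<in>I. a i) = 0 \<or> (\<Sum>i\<in>I. b i) = 0")
  case True
  then have "(\<forall>i\<in>I. a i = 0) \<or> (\<forall>i\<in>I. b i = 0)"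
    using assms by (simp add: sum_nonneg_eq_0_iff)
  then have "(\<Sum>i\<in>I. a i powr s * b i powr (1 - s)) = 0" by (auto intro!: sum.neutral)
  then show ?thesis by simp
next
  case False
  define A where "A = (\<Sum>i\<in>I. a i)"
  define B where "B = (\<Sum>i\<in>I. b i)"
  have AB: "A > 0" "B > 0"
    using False sum_nonneg[of I a, OF assms(2)] sum_nonneg[of I b, OF assms(3)]
    unfolding A_def B_def by linarith+
  have "a i powr s * b i powr (1 - s) \<le> A powr s * B powr (1 - s) * (s * (a i / A) + (1 - s) * (b i / B))"
    if "i \<in> I" for i
  proof -
    have ab: "0 \<le> a i" "0 \<le> b i" using assms(2,3) that by auto
    have "(a i / A) powr s * (b i / B) powr (1 - s) \<le> s * (a i / A) + (1 - s) * (b i / B)"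
    proof (cases "a i = 0 \<or> b i = 0")
      case True
      then show ?thesis using ab AB assms(4,5) by auto
    next
      case False
      then show ?thesis using ab AB assms(4,5) by (intro Youngs_inequality_0) auto
    qed
    then have "A powr s * B powr (1 - s) * ((a i / A) powr s * (b i / B) powr (1 - s))
       \<le> A powr s * B powr (1 - s) * (s * (a i / A) + (1 - s) * (b i / B))"
      by (intro mult_left_mono) auto
    then show ?thesis using ab AB by (simp add: powr_divide)
  qed
  then have "(\<Sum>i\<in>I. a i powr s * b i powr (1 - s))
      \<le> (\<Sum>i\<in>I. A powr s * B powr (1 - s) * (s * (a i / A) + (1 - s) * (b i / B)))"
    by (rule sum_mono)
  also have "\<dots> = A powr s * B powr (1 - s) * (s * ((\<Sum>i\<in>I. a i) / A) + (1 - s) * ((\<Sum>i\<in>I. b i) / B))"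
    by (simp only: sum_distrib_left[symmetric] sum.distrib sum_divide_distrib[symmetric])
  also have "\<dots> = A powr s * B powr (1 - s)"
    unfolding A_def[symmetric] B_def[symmetric] using AB by simp
  finally show ?thesis unfolding A_def B_def .
qed

lemma sum_powr_le_powr_sum:
  fixes a :: "'i \<Rightarrow> real"
  assumes "finite I" "\<And>i. i \<in> I \<Longrightarrow> 0 \<le> a i" "1 \<le> r"
  shows "(\<Sum>i\<in>I. a i powr r) \<le> (\<Sum>i\<in>I. a i) powr r"
proof -
  define A where "A = (\<Sum>i\<in>I. a i)"
  have A0: "0 \<le> A" unfolding A_def using assms by (intro sum_nonneg) auto
  have le: "a i \<le> A" if "i \<in> I" for i
    unfolding A_def using assms that by (intro member_le_sum) auto
  have "a i powr r \<le> a i * A powr (r - 1)" if "i \<in> I" for i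
  proof -
    have "a i powr r = a i * a i powr (r - 1)"
      using assms(2)[OF that] by (cases "a i = 0") (auto simp: powr_mult_base)
    also have "\<dots> \<le> a i * A powr (r - 1)"
      using assms le[OF that] that by (intro mult_left_mono powr_mono2) auto
    finally show ?thesis .
  qed
  then have "(\<Sum>i\<in>I. a i powr r) \<le> (\<Sum>i\<in>I. a i * A powr (r - 1))" by (rule sum_mono)
  also have "\<dots> = A * A powr (r - 1)" by (simp add: A_def sum_distrib_right)
  also have "\<dots> = A powr r" using A0 by (cases "A = 0") (auto simp: powr_mult_base)
  finally show ?thesis by (simp add: A_def)
qed

lemma sum_geometric_int_ge:
  fixes e :: real
  assumes "finite I" "\<And>i. i \<in> I \<Longrightarrow> (l::int) \<le> i" "0 < e"
  shows "(\<Sum>i\<in>I. 2 powr (- e * of_int i)) \<le> 2 powr (- e * of_int l) / (1 - 2 powr (- e))"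
proof -
  define r where "r = (2::real) powr (- e)"
  have r: "0 < r" "r < 1" using assms by (auto simp: r_def powr_less_one)
  have pw: "2 powr (- e * of_int (l + int n)) = 2 powr (- e * of_int l) * r ^ n" for n
  proof -
    have "2 powr (- e * of_int (l + int n)) = 2 powr (- e * of_int l) * 2 powr (- e * real n)"
      by (simp add: algebra_simps flip: powr_add)
    then show ?thesis by (simp add: r_def powr_powr flip: powr_realpow)
  qed
  have "(\<Sum>i\<in>I. 2 powr (- e * of_int i)) = (\<Sum>n\<in>(\<lambda>i. nat (i - l)) ` I. 2 powr (- e * of_int (l + int n)))"
    using assms by (subst sum.reindex) (auto intro!: sum.cong inj_onI simp: eq_nat_nat_iff)
  also have "\<dots> = 2 powr (- e * of_int l) * (\<Sum>n\<in>(\<lambda>i. nat (i - l)) ` I. r ^ n)"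
    by (simp only: pw sum_distrib_left)
  also have "(\<Sum>n\<in>(\<lambda>i. nat (i - l)) ` I. r ^ n) \<le> (\<Sum>n. r ^ n)"
    using r assms by (intro sum_le_suminf summable_geometric) auto
  also have "(\<Sum>n. r ^ n) = 1 / (1 - r)" using r by (intro suminf_geometric) auto
  finally show ?thesis by (simp add: r_def mult_left_mono)
qed

lemma sum_geometric_int_le:
  fixes e :: real
  assumes "finite I" "\<And>i. i \<in> I \<Longrightarrow> i \<le> (l::int)" "0 < e"
  shows "(\<Sum>i\<in>I. 2 powr (e * of_int i)) \<le> 2 powr (e * of_int l) / (1 - 2 powr (- e))"
proof -
  have "(\<Sum>i\<in>I. 2 powr (e * of_int i)) = (\<Sum>i\<in>uminus ` I. 2 powr (- e * of_int i))"
    by (subst sum.reindex) (auto intro!: sum.cong inj_onI)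
  also have "\<dots> \<le> 2 powr (- e * of_int (- l)) / (1 - 2 powr (- e))"
    using assms by (intro sum_geometric_int_ge) auto
  finally show ?thesis by simp
qed

section \<open>Laminar families, dyadic levels and principal sets\<close>

definition laminar :: "'a set set \<Rightarrow> bool" where
  "laminar S \<longleftrightarrow> {} \<notin> S \<and> (\<forall>A\<in>S. \<forall>B\<in>S. A \<subseteq> B \<or> B \<subseteq> A \<or> A \<inter> B = {})"

lemma laminar_cases:
  assumes "laminar S" "A \<in> S" "B \<in> S"
  obtains "A \<subseteq> B" | "B \<subseteq> A" | "A \<inter> B = {}"
  using assms unfolding laminar_def by metis

lemma laminar_nonempty: "laminar S \<Longrightarrow> A \<in> S \<Longrightarrow> A \<noteq> {}"
  by (auto simp: laminar_def)

lemma laminar_subset: "laminar S \<Longrightarrow> S' \<subseteq> S \<Longrightarrow> laminar S'"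
  unfolding laminar_def by (meson subsetD)

lemma laminar_comparable:
  assumes "laminar S" "A \<in> S" "B \<in> S" "Q \<in> S" "Q \<subseteq> A" "Q \<subseteq> B"
  shows "A \<subseteq> B \<or> B \<subseteq> A"
proof -
  have "A \<inter> B \<noteq> {}" using laminar_nonempty[OF assms(1,4)] assms(5,6) by auto
  then show ?thesis using laminar_cases[OF assms(1-3)] by metis
qed

definition dyadic_level :: "real \<Rightarrow> int" where
  "dyadic_level x = \<lfloor>log 2 x\<rfloor>"

lemma dyadic_level:
  assumes "0 < x"
  shows dyadic_level_le: "2 powr of_int (dyadic_level x) \<le> x"
    and dyadic_level_gt: "x < 2 * 2 powr of_int (dyadic_level x)"
proof -
  have x: "2 powr log 2 x = x" using assms by simp
  have "2 powr of_int (dyadic_level x) \<le> 2 powr log 2 x"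
    by (rule powr_mono) (auto simp: dyadic_level_def)
  then show "2 powr of_int (dyadic_level x) \<le> x" by (simp only: x)
  have "log 2 x < 1 + of_int (dyadic_level x)" unfolding dyadic_level_def by linarith
  then have "2 powr log 2 x < 2 powr (1 + of_int (dyadic_level x))"
    by (intro powr_less_mono) auto
  then show "x < 2 * 2 powr of_int (dyadic_level x)" unfolding x by (simp add: powr_add)
qed

text \<open>The principal sets of \<open>x\<close>. Rounding \<open>x\<close> to powers of 2 replaces the usual recursive selection.\<close>

definition records :: "'a set set \<Rightarrow> ('a set \<Rightarrow> real) \<Rightarrow> 'a set set" where
  "records S x = {A \<in> S. \<forall>A'\<in>S. A \<subset> A' \<longrightarrow> dyadic_level (x A') < dyadic_level (x A)}"

text \<open>The smallest principal set containing Q, usually written \<pi>(Q). The condition on the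
  levels replaces the usual comparison of averages: it makes the value at Q at most twice the
  rounded value at \<pi>(Q).\<close>

definition is_record_parent :: "'a set set \<Rightarrow> ('a set \<Rightarrow> real) \<Rightarrow> 'a set \<Rightarrow> 'a set \<Rightarrow> bool" where
  "is_record_parent S x Q A \<longleftrightarrow> A \<in> records S x \<and> Q \<subseteq> A \<and> dyadic_level (x Q) \<le> dyadic_level (x A) \<and>
     (\<forall>A'\<in>records S x. Q \<subseteq> A' \<longrightarrow> A \<subseteq> A')"

definition record_parent :: "'a set set \<Rightarrow> ('a set \<Rightarrow> real) \<Rightarrow> 'a set \<Rightarrow> 'a set" where
  "record_parent S x Q = (SOME A. is_record_parent S x Q A)"

text \<open>The members containing Q form a chain. Take the largest level m on this chain and a
  maximal member A of level m: nothing larger reaches the level m, so A is a record, and a record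
  lying strictly between Q and A would need a level above m.\<close>

lemma is_record_parent_record_parent:
  assumes S: "finite S" "laminar S" and Q: "Q \<in> S"
  shows "is_record_parent S x Q (record_parent S x Q)"
proof -
  define anc where "anc = {A \<in> S. Q \<subseteq> A}"
  have anc: "finite anc" "Q \<in> anc" using S Q by (auto simp: anc_def)
  define m where "m = Max ((\<lambda>A. dyadic_level (x A)) ` anc)"
  have le_m: "dyadic_level (x A) \<le> m" if "A \<in> anc" for A
    unfolding m_def using anc that by (intro Max_ge) auto
  have "m \<in> (\<lambda>A. dyadic_level (x A)) ` anc"
    unfolding m_def using anc by (intro Max_in) auto
  then have "{A \<in> anc. dyadic_level (x A) = m} \<noteq> {}" by auto
  then obtain A where A: "A \<in> anc" "dyadic_level (x A) = m"
    and mx: "\<And>A'. A' \<in> anc \<Longrightarrow> dyadic_level (x A') = m \<Longrightarrow> A \<subseteq> A' \<Longrightarrow> A = A'"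
    using finite_has_maximal[of "{A \<in> anc. dyadic_level (x A) = m}"] anc by auto
  have up: "A' \<in> anc" if "A' \<in> S" "A \<subseteq> A'" for A' using that A by (auto simp: anc_def)
  have rec: "A \<in> records S x"
    unfolding records_def
  proof (intro CollectI conjI ballI impI)
    show "A \<in> S" using A by (auto simp: anc_def)
    fix A' assume A': "A' \<in> S" "A \<subset> A'"
    then have "A' \<in> anc" using up[of A'] by simp
    moreover from this have "dyadic_level (x A') \<noteq> m" using mx[of A'] A' by (metis psubsetE)
    ultimately have "dyadic_level (x A') < m" using le_m[of A'] by simp
    then show "dyadic_level (x A') < dyadic_level (x A)" using A(2) by simp
  qed
  have "A \<subseteq> A'" if "A' \<in> records S x" "Q \<subseteq> A'" for A'
  proof -
    have A': "A' \<in> anc" using that by (auto simp: anc_def records_def)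
    then have "A \<subseteq> A' \<or> A' \<subseteq> A"
      using A(1) Q by (intro laminar_comparable[OF S(2) _ _ Q]) (auto simp: anc_def)
    moreover have "\<not> A' \<subset> A"
    proof
      assume "A' \<subset> A"
      then have "dyadic_level (x A) < dyadic_level (x A')" using that(1) A(1) by (simp add: records_def anc_def)
      with le_m[OF A'] A show False by simp
    qed
    ultimately show ?thesis by blast
  qed
  then have "is_record_parent S x Q A"
    using rec A le_m[OF anc(2)] by (auto simp: is_record_parent_def anc_def)
  then show ?thesis unfolding record_parent_def by (rule someI)
qed

lemma record_parent:
  assumes S: "finite S" "laminar S" and Q: "Q \<in> S"
  shows "record_parent S x Q \<in> records S x" "record_parent S x Q \<in> S" "Q \<subseteq> record_parent S x Q"
    "dyadic_level (x Q) \<le> dyadic_level (x (record_parent S x Q))"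
  using is_record_parent_record_parent[OF assms, of x] by (auto simp: is_record_parent_def records_def)

lemma record_parent_least:
  assumes "finite S" "laminar S" "Q \<in> S" "A \<in> records S x" "Q \<subseteq> A"
  shows "record_parent S x Q \<subseteq> A"
  using is_record_parent_record_parent[OF assms(1-3), of x] assms by (auto simp: is_record_parent_def)

text \<open>Minimality of the parent, used in both directions. It makes the parent for one function
  depend only on the parent for the other one whenever the latter is the smaller of the two.\<close>

lemma record_parent_eq:
  assumes "finite S" "laminar S" "Q \<in> S" "B \<in> S" "Q \<subseteq> B" "B \<subseteq> record_parent S x Q"
  shows "record_parent S x B = record_parent S x Q"
proof
  show "record_parent S x B \<subseteq> record_parent S x Q"
    using assms by (intro record_parent_least record_parent) auto
  show "record_parent S x Q \<subseteq> record_parent S x B"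
    using assms record_parent[of S B x] by (intro record_parent_least) auto
qed

lemma record_parent_bound:
  assumes "finite S" "laminar S" "Q \<in> S" "0 < x Q"
  shows "x Q \<le> 2 * 2 powr of_int (dyadic_level (x (record_parent S x Q)))"
proof -
  have "x Q \<le> 2 * 2 powr of_int (dyadic_level (x Q))" using dyadic_level_gt[of "x Q"] assms by simp
  also have "\<dots> \<le> 2 * 2 powr of_int (dyadic_level (x (record_parent S x Q)))"
    using record_parent(4)[OF assms(1-3), of x] by (intro mult_left_mono powr_mono) auto
  finally show ?thesis .
qed

lemma finite_records: "finite S \<Longrightarrow> finite (records S x)"
  by (auto simp: records_def)

text \<open>Levels increase strictly when passing from a record to a smaller one. Thus records of
  one level are disjoint, and the values of the records through a given point grow at least
  geometrically.\<close>

lemma records_inj_level: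
  assumes "laminar S" "A \<in> records S x" "B \<in> records S x" "A \<inter> B \<noteq> {}"
    "dyadic_level (x A) = dyadic_level (x B)"
  shows "A = B"
proof -
  have S: "A \<in> S" "B \<in> S" using assms(2,3) by (auto simp: records_def)
  then have "A \<subseteq> B \<or> B \<subseteq> A" using laminar_cases[OF assms(1), of A B] assms(4) by metis
  moreover have "\<not> A \<subset> B" "\<not> B \<subset> A" using assms(2,3,5) S by (auto simp: records_def)
  ultimately show ?thesis by blast
qed

lemma sum_group_record_parent:
  fixes h :: "'a set \<Rightarrow> real"
  assumes "finite S" "laminar S"
  shows "(\<Sum>Q\<in>S. h Q) = (\<Sum>A\<in>records S x. \<Sum>Q\<in>{Q\<in>S. record_parent S x Q = A}. h Q)"
  using assms by (intro sum.group[symmetric] finite_records) (auto intro: record_parent)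

text \<open>The Carleson packing condition, tested on members of the family only. For Lebesgue
  measure the constant will be dimensional; for a weight it will also contain the A_infinity
  constant.\<close>

definition carleson_on :: "'a set set \<Rightarrow> real \<Rightarrow> ('a set \<Rightarrow> real) \<Rightarrow> bool" where
  "carleson_on S \<Lambda> U \<longleftrightarrow> (\<forall>R\<in>S. (\<Sum>Q\<in>{Q\<in>S. Q \<subseteq> R}. U Q) \<le> \<Lambda> * U R)"

text \<open>All that the discrete estimates use of U being the restriction of a measure.\<close>

definition superadditive_on :: "'a set set \<Rightarrow> ('a set \<Rightarrow> real) \<Rightarrow> bool" where
  "superadditive_on S U \<longleftrightarrow>
     (\<forall>B\<in>S. \<forall>D\<subseteq>S. (\<forall>Q\<in>D. Q \<subseteq> B) \<longrightarrow> pairwise disjnt D \<longrightarrow> (\<Sum>Q\<in>D. U Q) \<le> U B)"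

lemma carleson_on_subset:
  assumes "carleson_on S \<Lambda> U" "finite S" "S' \<subseteq> S" "\<And>Q. Q \<in> S \<Longrightarrow> 0 \<le> U Q"
  shows "carleson_on S' \<Lambda> U"
  unfolding carleson_on_def
proof
  fix R assume "R \<in> S'"
  then have "R \<in> S" using assms(3) by auto
  have "(\<Sum>Q\<in>{Q\<in>S'. Q \<subseteq> R}. U Q) \<le> (\<Sum>Q\<in>{Q\<in>S. Q \<subseteq> R}. U Q)"
    using assms(2-4) by (intro sum_mono2) auto
  also have "\<dots> \<le> \<Lambda> * U R" using assms(1) \<open>R \<in> S\<close> by (simp add: carleson_on_def)
  finally show "(\<Sum>Q\<in>{Q\<in>S'. Q \<subseteq> R}. U Q) \<le> \<Lambda> * U R" .
qed

lemma superadditive_onD: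
  assumes "superadditive_on S U" "B \<in> S" "D \<subseteq> S" "\<And>Q. Q \<in> D \<Longrightarrow> Q \<subseteq> B" "pairwise disjnt D"
  shows "(\<Sum>Q\<in>D. U Q) \<le> U B"
  using assms(1)[unfolded superadditive_on_def, rule_format, OF assms(2,3) _ assms(5)] assms(4) by simp

lemma superadditive_on_subset:
  assumes "superadditive_on S U" "S' \<subseteq> S"
  shows "superadditive_on S' U"
  unfolding superadditive_on_def
proof (intro ballI allI impI)
  fix B D assume "B \<in> S'" "D \<subseteq> S'" "\<forall>Q\<in>D. Q \<subseteq> B" "pairwise disjnt D"
  then show "(\<Sum>Q\<in>D. U Q) \<le> U B"
    using assms(2) by (intro superadditive_onD[OF assms(1)]) auto
qed

lemma superadditive_on_mono:
  assumes "superadditive_on S U" "A \<in> S" "B \<in> S" "A \<subseteq> B"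
  shows "U A \<le> U B"
  using superadditive_onD[OF assms(1,3), of "{A}"] assms(2,4) by simp

text \<open>On the principal sets \<open>A\<close> of the averages \<open>U / \<mu>\<close> of a given dyadic size \<open>2 ^ i\<close>, which are
  disjoint, the total \<open>\<mu>\<close>-mass is at most \<open>2 ^ - i * U B\<close>; this beats the growth of
  \<open>(U / \<mu>) ^ (1 - e)\<close>.\<close>

lemma carleson_sum_concave_le:
  fixes mu U :: "'a set \<Rightarrow> real"
  assumes S: "finite S" "laminar S"
    and pos: "\<And>Q. Q \<in> S \<Longrightarrow> 0 < mu Q" "\<And>Q. Q \<in> S \<Longrightarrow> 0 < U Q"
    and car: "carleson_on S \<Lambda> mu" and sup: "superadditive_on S U"
    and e: "0 < e" "e < 1" and B: "B \<in> S"
  shows "(\<Sum>Q\<in>{Q\<in>S. Q \<subseteq> B}. mu Q powr e * U Q powr (1 - e))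
     \<le> 2 * \<Lambda> / (1 - 2 powr (- e)) * (mu B powr e * U B powr (1 - e))"
proof -
  define S' where "S' = {Q\<in>S. Q \<subseteq> B}"
  define x where "x = (\<lambda>Q. U Q / mu Q)"
  define lv where "lv = (\<lambda>Q. dyadic_level (x Q))"
  define \<pi> where "\<pi> = record_parent S' x"
  define R where "R = records S' x"
  define h where "h = (\<lambda>i::int. (2 * 2 powr of_int i) powr (1 - e) :: real)"
  have S': "finite S'" "laminar S'" "S' \<subseteq> S" "B \<in> S'"
    using S B laminar_subset[OF S(2)] by (auto simp: S'_def)
  have xpos: "0 < x Q" if "Q \<in> S" for Q using pos that by (simp add: x_def)
  have RS: "R \<subseteq> S'" "finite R" using S' by (auto simp: R_def records_def)
  have car': "(\<Sum>Q\<in>{Q\<in>S'. Q \<subseteq> A}. mu Q) \<le> \<Lambda> * mu A" if "A \<in> S'" for A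
    using carleson_on_subset[OF car S(1) S'(3)] pos(1) that by (force simp: carleson_on_def)
  have \<Lambda>0: "0 \<le> \<Lambda>"
  proof -
    have "0 \<le> (\<Sum>Q\<in>{Q\<in>S'. Q \<subseteq> B}. mu Q)" using S'(3) pos(1) by (intro sum_nonneg) (auto intro: less_imp_le)
    also have "\<dots> \<le> \<Lambda> * mu B" by (rule car'[OF S'(4)])
    finally show ?thesis using pos(1)[OF B] by (simp add: zero_le_mult_iff)
  qed
  have h0: "0 \<le> h i" for i by (simp add: h_def)
  have "(\<Sum>Q\<in>S'. mu Q powr e * U Q powr (1 - e)) \<le> (\<Sum>Q\<in>S'. mu Q * h (lv (\<pi> Q)))"
  proof (rule sum_mono)
    fix Q assume Q: "Q \<in> S'"
    then have Q': "Q \<in> S" using S'(3) by auto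
    have "mu Q powr e * U Q powr (1 - e) = mu Q * x Q powr (1 - e)"
      using pos[OF Q'] by (simp add: x_def powr_divide powr_diff field_simps)
    also have "\<dots> \<le> mu Q * h (lv (\<pi> Q))"
      unfolding h_def lv_def \<pi>_def
      using record_parent_bound[of S' Q x, OF S'(1,2) Q xpos[OF Q']] pos(1)[OF Q'] xpos[OF Q'] e
      by (intro mult_left_mono powr_mono2) auto
    finally show "mu Q powr e * U Q powr (1 - e) \<le> mu Q * h (lv (\<pi> Q))" .
  qed
  also have "\<dots> = (\<Sum>A\<in>R. \<Sum>Q\<in>{Q\<in>S'. \<pi> Q = A}. mu Q * h (lv (\<pi> Q)))"
    unfolding R_def \<pi>_def by (rule sum_group_record_parent[OF S'(1,2)])
  also have "\<dots> \<le> (\<Sum>A\<in>R. \<Lambda> * mu A * h (lv A))"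
  proof (rule sum_mono)
    fix A assume A: "A \<in> R"
    have "(\<Sum>Q\<in>{Q\<in>S'. \<pi> Q = A}. mu Q * h (lv (\<pi> Q))) = (\<Sum>Q\<in>{Q\<in>S'. \<pi> Q = A}. mu Q) * h (lv A)"
      by (simp add: sum_distrib_right)
    also have "(\<Sum>Q\<in>{Q\<in>S'. \<pi> Q = A}. mu Q) \<le> (\<Sum>Q\<in>{Q\<in>S'. Q \<subseteq> A}. mu Q)"
    proof (rule sum_mono2)
      show "{Q\<in>S'. \<pi> Q = A} \<subseteq> {Q\<in>S'. Q \<subseteq> A}"
        using record_parent(3)[OF S'(1,2)] by (auto simp: \<pi>_def)
    qed (use S' pos(1) in \<open>auto intro: less_imp_le\<close>)
    also have "\<dots> \<le> \<Lambda> * mu A" using A RS by (intro car') auto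
    finally show "(\<Sum>Q\<in>{Q\<in>S'. \<pi> Q = A}. mu Q * h (lv (\<pi> Q))) \<le> \<Lambda> * mu A * h (lv A)"
      using h0[of "lv A"] by (simp add: mult_right_mono)
  qed
  also have "\<dots> = (\<Sum>i\<in>lv ` R. \<Sum>A\<in>{A\<in>R. lv A = i}. \<Lambda> * mu A * h (lv A))"
    using RS by (intro sum.group[symmetric]) auto
  also have "\<dots> \<le> (\<Sum>i\<in>lv ` R. \<Lambda> * U B * 2 powr (1 - e) * 2 powr (- e * of_int i))"
  proof (rule sum_mono)
    fix i
    define p2 where "p2 = (2::real) powr of_int i"
    have p2: "0 < p2" by (simp add: p2_def)
    have "mu A \<le> U A / p2" if A: "A \<in> R" "lv A = i" for A
    proof -
      have AS: "A \<in> S" using A RS S' by auto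
      have "p2 \<le> U A / mu A"
        using dyadic_level_le[OF xpos[OF AS]] A(2) by (simp add: p2_def lv_def x_def)
      then show ?thesis using pos(1)[OF AS] p2 by (simp add: field_simps)
    qed
    then have "(\<Sum>A\<in>{A\<in>R. lv A = i}. mu A) \<le> (\<Sum>A\<in>{A\<in>R. lv A = i}. U A / p2)"
      by (intro sum_mono) auto
    also have "\<dots> = (\<Sum>A\<in>{A\<in>R. lv A = i}. U A) / p2" by (simp add: sum_divide_distrib)
    also have "(\<Sum>A\<in>{A\<in>R. lv A = i}. U A) \<le> U B"
    proof -
      have "pairwise disjnt {A\<in>R. lv A = i}"
        using records_inj_level[OF S'(2), of _ x] by (auto simp: pairwise_def disjnt_def lv_def R_def)
      then show ?thesis
        using RS by (intro superadditive_onD[OF sup B]) (auto simp: S'_def)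
    qed
    finally have le: "(\<Sum>A\<in>{A\<in>R. lv A = i}. mu A) \<le> U B / p2"
      using p2 by (simp add: divide_right_mono)
    have "(\<Sum>A\<in>{A\<in>R. lv A = i}. \<Lambda> * mu A * h (lv A)) = \<Lambda> * h i * (\<Sum>A\<in>{A\<in>R. lv A = i}. mu A)"
      by (simp add: sum_distrib_left mult_ac)
    also have "\<dots> \<le> \<Lambda> * h i * (U B / p2)"
      using \<Lambda>0 h0 le by (intro mult_left_mono) auto
    also have "\<dots> = \<Lambda> * U B * (h i / p2)" by simp
    also have "h i / p2 = 2 powr (1 - e) * 2 powr (- e * of_int i)"
    proof -
      have "h i = 2 powr ((1 - e) * (1 + of_int i))"
        by (simp add: h_def powr_mult powr_powr distrib_left powr_add mult.commute)
      then show ?thesis unfolding p2_def by (simp add: algebra_simps flip: powr_add powr_diff)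
    qed
    finally show "(\<Sum>A\<in>{A\<in>R. lv A = i}. \<Lambda> * mu A * h (lv A)) \<le> \<Lambda> * U B * 2 powr (1 - e) * 2 powr (- e * of_int i)"
      by (simp add: mult_ac)
  qed
  also have "\<dots> = \<Lambda> * U B * 2 powr (1 - e) * (\<Sum>i\<in>lv ` R. 2 powr (- e * of_int i))"
    by (simp only: sum_distrib_left)
  \<comment> \<open>\<open>B\<close> contains every member of \<open>S'\<close>, so a record other
    than \<open>B\<close> has a level above that of \<open>B\<close>, and the geometric series
    starts at \<open>lv B\<close>.\<close>
  also have "\<dots> \<le> \<Lambda> * U B * 2 powr (1 - e) * (2 powr (- e * of_int (lv B)) / (1 - 2 powr (- e)))"
  proof (intro mult_left_mono sum_geometric_int_ge)
    fix i assume "i \<in> lv ` R"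
    then obtain A where A: "A \<in> R" "i = lv A" by auto
    then have "A \<subseteq> B" using RS by (auto simp: S'_def)
    then show "lv B \<le> i"
    proof (cases "A = B")
      case False
      then have "A \<subset> B" using \<open>A \<subseteq> B\<close> by auto
      then show ?thesis using A S'(4) by (auto simp: R_def records_def lv_def intro: less_imp_le)
    qed (use A in simp)
  qed (use RS \<Lambda>0 pos(2)[OF B] e in auto)
  also have "\<dots> \<le> \<Lambda> * U B * 2 powr (1 - e) * ((x B / 2) powr (- e) / (1 - 2 powr (- e)))"
  proof -
    have "2 powr (- e * of_int (lv B)) = (2 powr of_int (lv B)) powr (- e)"
      by (simp add: powr_powr mult.commute)
    also have "\<dots> \<le> (x B / 2) powr (- e)"
      using dyadic_level_gt[OF xpos[OF B]] xpos[OF B] e by (intro powr_mono2') (auto simp: lv_def)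
    finally show ?thesis
      using \<Lambda>0 pos(2)[OF B] e
      by (intro mult_left_mono divide_right_mono) (auto simp: powr_le_one_le powr_less_one less_imp_le)
  qed
  also have "\<dots> = 2 * \<Lambda> / (1 - 2 powr (- e)) * (mu B powr e * U B powr (1 - e))"
  proof -
    have "(2::real) powr (1 - e) * 2 powr e = 2" by (simp flip: powr_add)
    then have 1: "2 powr (1 - e) * (x B / 2) powr (- e) = 2 * (mu B powr e / U B powr e)"
      using pos[OF B] by (simp add: x_def powr_divide powr_mult powr_minus field_simps)
    have 2: "U B * (mu B powr e / U B powr e) = mu B powr e * U B powr (1 - e)"
      using pos[OF B] by (simp add: powr_diff)
    have "\<Lambda> * U B * 2 powr (1 - e) * ((x B / 2) powr (- e) / (1 - 2 powr (- e)))
      = \<Lambda> / (1 - 2 powr (- e)) * (U B * (2 powr (1 - e) * (x B / 2) powr (- e)))" by simp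
    also have "\<dots> = \<Lambda> / (1 - 2 powr (- e)) * (2 * (U B * (mu B powr e / U B powr e)))"
      unfolding 1 by (simp only: mult_ac)
    also have "\<dots> = 2 * \<Lambda> / (1 - 2 powr (- e)) * (mu B powr e * U B powr (1 - e))"
      unfolding 2 by simp
    finally show ?thesis .
  qed
  finally show ?thesis by (simp add: S'_def)
qed

text \<open>Divide by the values at B: the ratios of U and V are at most 1 by monotonicity, so the
  product of their powers is at most the larger ratio to the power s + t, hence to the smaller power
  1 - e. This leaves one concave sum for U and one for V, which accounts for the 4 in place of
  2.\<close>

lemma carleson_sum_three_powers_le:
  fixes mu U V :: "'a set \<Rightarrow> real"
  assumes S: "finite S" "laminar S"
    and pos: "\<And>Q. Q \<in> S \<Longrightarrow> 0 < mu Q" "\<And>Q. Q \<in> S \<Longrightarrow> 0 < U Q" "\<And>Q. Q \<in> S \<Longrightarrow> 0 < V Q"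
    and car: "carleson_on S \<Lambda> mu" and sup: "superadditive_on S U" "superadditive_on S V"
    and e: "0 < e" "e < 1" and st: "0 \<le> s" "0 \<le> t" "1 - e \<le> s + t" and B: "B \<in> S"
  shows "(\<Sum>Q\<in>{Q\<in>S. Q \<subseteq> B}. mu Q powr e * U Q powr s * V Q powr t)
     \<le> 4 * \<Lambda> / (1 - 2 powr (- e)) * (mu B powr e * U B powr s * V B powr t)"
proof -
  define C where "C = U B powr s * V B powr t"
  define D where "D = 2 * \<Lambda> / (1 - 2 powr (- e))"
  have C0: "0 \<le> C" by (simp add: C_def)
  have UB: "0 < U B" "0 < V B" using pos B by auto
  have "mu Q powr e * U Q powr s * V Q powr t \<le> C * (mu Q powr e * U Q powr (1 - e)) / U B powr (1 - e)
      + C * (mu Q powr e * V Q powr (1 - e)) / V B powr (1 - e)" if "Q \<in> S" "Q \<subseteq> B" for Q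
  proof -
    define \<xi> where "\<xi> = U Q / U B"
    define \<eta> where "\<eta> = V Q / V B"
    have \<xi>: "0 < \<xi>" "\<xi> \<le> 1" and \<eta>: "0 < \<eta>" "\<eta> \<le> 1"
      using superadditive_on_mono[OF sup(1) that(1) B that(2)] superadditive_on_mono[OF sup(2) that(1) B that(2)]
        pos[OF that(1)] UB by (auto simp: \<xi>_def \<eta>_def)
    have *: "a powr s' * b powr t' \<le> b powr (1 - e)"
      if "0 < a" "a \<le> b" "b \<le> 1" "0 \<le> s'" "0 \<le> t'" "1 - e \<le> s' + t'" for a b s' t' :: real
    proof -
      have "a powr s' * b powr t' \<le> b powr s' * b powr t'"
        using that by (intro mult_right_mono powr_mono2) auto
      also have "\<dots> = b powr (s' + t')" by (simp add: powr_add)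
      also have "\<dots> \<le> b powr (1 - e)" using that by (intro powr_mono') auto
      finally show ?thesis .
    qed
    have "\<xi> powr s * \<eta> powr t \<le> \<xi> powr (1 - e) + \<eta> powr (1 - e)"
    proof (cases "\<xi> \<le> \<eta>")
      case True
      then have "\<xi> powr s * \<eta> powr t \<le> \<eta> powr (1 - e)" using *[of \<xi> \<eta> s t] \<xi> \<eta> st by simp
      then show ?thesis by (simp add: add_increasing)
    next
      case False
      then have "\<eta> powr t * \<xi> powr s \<le> \<xi> powr (1 - e)" using *[of \<eta> \<xi> t s] \<xi> \<eta> st by simp
      then show ?thesis by (simp add: add_increasing2 mult.commute)
    qed
    then have "C * mu Q powr e * (\<xi> powr s * \<eta> powr t) \<le> C * mu Q powr e * (\<xi> powr (1 - e) + \<eta> powr (1 - e))"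
      using C0 by (intro mult_left_mono) auto
    moreover have "C * (\<xi> powr s * \<eta> powr t) = U Q powr s * V Q powr t"
      using UB pos[OF that(1)] by (simp add: C_def \<xi>_def \<eta>_def powr_divide)
    then have "C * mu Q powr e * (\<xi> powr s * \<eta> powr t) = mu Q powr e * U Q powr s * V Q powr t"
      by (simp add: mult_ac)
    moreover have "C * mu Q powr e * (\<xi> powr (1 - e) + \<eta> powr (1 - e)) =
       C * (mu Q powr e * U Q powr (1 - e)) / U B powr (1 - e) + C * (mu Q powr e * V Q powr (1 - e)) / V B powr (1 - e)"
      using UB pos[OF that(1)] by (simp add: \<xi>_def \<eta>_def powr_divide distrib_left)
    ultimately show ?thesis by simp
  qed
  then have "(\<Sum>Q\<in>{Q\<in>S. Q \<subseteq> B}. mu Q powr e * U Q powr s * V Q powr t)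
    \<le> (\<Sum>Q\<in>{Q\<in>S. Q \<subseteq> B}. C * (mu Q powr e * U Q powr (1 - e)) / U B powr (1 - e)
      + C * (mu Q powr e * V Q powr (1 - e)) / V B powr (1 - e))"
    by (intro sum_mono) auto
  also have "\<dots> = C * (\<Sum>Q\<in>{Q\<in>S. Q \<subseteq> B}. mu Q powr e * U Q powr (1 - e)) / U B powr (1 - e)
      + C * (\<Sum>Q\<in>{Q\<in>S. Q \<subseteq> B}. mu Q powr e * V Q powr (1 - e)) / V B powr (1 - e)"
    by (simp only: sum.distrib sum_distrib_left sum_divide_distrib)
  also have "\<dots> \<le> C * (D * (mu B powr e * U B powr (1 - e))) / U B powr (1 - e)
      + C * (D * (mu B powr e * V B powr (1 - e))) / V B powr (1 - e)"
    unfolding D_def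
    by (intro add_mono divide_right_mono mult_left_mono carleson_sum_concave_le[OF S pos(1,2) car sup(1) e B]
      carleson_sum_concave_le[OF S pos(1,3) car sup(2) e B] C0) auto
  also have "\<dots> = 2 * D * (mu B powr e * C)" using UB by simp
  finally show ?thesis by (simp add: C_def D_def mult_ac)
qed

text \<open>The left-hand side of the Carleson embedding over principal sets, with averages rounded
  down to powers of 2. It stands for the p-th power of a weighted norm.\<close>

definition record_sum :: "'a set set \<Rightarrow> ('a set \<Rightarrow> real) \<Rightarrow> real \<Rightarrow> ('a set \<Rightarrow> real) \<Rightarrow> real" where
  "record_sum S x p U = (\<Sum>A\<in>records S x. (2 powr of_int (dyadic_level (x A))) powr p * U A)"

lemma record_sum_nonneg:
  assumes "\<And>Q. Q \<in> S \<Longrightarrow> 0 \<le> U Q"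
  shows "0 \<le> record_sum S x p U"
  unfolding record_sum_def using assms by (intro sum_nonneg) (auto simp: records_def)

lemma carleson_on_nonneg:
  assumes "carleson_on S \<Lambda> U" "finite S" "B \<in> S" "\<And>Q. Q \<in> S \<Longrightarrow> 0 < U Q"
  shows "0 \<le> \<Lambda>"
proof -
  have "0 \<le> (\<Sum>Q\<in>{Q\<in>S. Q \<subseteq> B}. U Q)" using assms(4) by (intro sum_nonneg) (auto intro: less_imp_le)
  also have "\<dots> \<le> \<Lambda> * U B" using assms(1,3) by (simp add: carleson_on_def)
  finally show ?thesis using assms(4)[OF assms(3)] by (simp add: zero_le_mult_iff)
qed

text \<open>Among the B with the same parent A, monotonicity of U turns the power q/p into a linear
  sum at the price of U(A) to the power q/p - 1, and the Carleson condition sums it. The remaining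
  sum over the records is of the form l^1 into l^(q/p), which is where p <= q enters.\<close>

lemma sum_record_parent_powr_le:
  fixes U x :: "'a set \<Rightarrow> real"
  assumes S: "finite S" "laminar S" and U: "\<And>Q. Q \<in> S \<Longrightarrow> 0 < U Q"
    and car: "carleson_on S \<Lambda> U" and sup: "superadditive_on S U" and pq: "1 < p" "p \<le> q"
  shows "(\<Sum>B\<in>S. (2 powr of_int (dyadic_level (x (record_parent S x B)))) powr q * U B powr (q / p))
     \<le> \<Lambda> * record_sum S x p U powr (q / p)"
proof (cases "S = {}")
  case True
  then show ?thesis by (simp add: record_sum_def records_def)
next
  case False
  then have \<Lambda>0: "0 \<le> \<Lambda>" using carleson_on_nonneg[OF car S(1) _ U] by auto
  define X where "X = (\<lambda>A. 2 powr real_of_int (dyadic_level (x A)))"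
  define R where "R = records S x"
  have R: "finite R" "R \<subseteq> S" using S by (auto simp: R_def records_def)
  have "(\<Sum>B\<in>S. X (record_parent S x B) powr q * U B powr (q / p))
      = (\<Sum>A\<in>R. \<Sum>B\<in>{B\<in>S. record_parent S x B = A}. X (record_parent S x B) powr q * U B powr (q / p))"
    unfolding R_def by (rule sum_group_record_parent[OF S])
  also have "\<dots> \<le> (\<Sum>A\<in>R. \<Lambda> * (X A powr p * U A) powr (q / p))"
  proof (rule sum_mono)
    fix A assume "A \<in> R"
    then have A: "A \<in> S" using R by auto
    have "(\<Sum>B\<in>{B\<in>S. record_parent S x B = A}. X (record_parent S x B) powr q * U B powr (q / p))
        \<le> (\<Sum>B\<in>{B\<in>S. record_parent S x B = A}. X A powr q * U A powr (q / p - 1) * U B)"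
    proof (rule sum_mono)
      fix B assume B: "B \<in> {B\<in>S. record_parent S x B = A}"
      then have BS: "B \<in> S" and BA: "B \<subseteq> A" using record_parent(3)[OF S] by auto
      have "U B powr (q / p) = U B powr (q / p - 1) * U B" using U[OF BS] by (simp add: powr_diff)
      also have "\<dots> \<le> U A powr (q / p - 1) * U B"
        using superadditive_on_mono[OF sup BS A BA] U[OF BS] pq
        by (intro mult_right_mono powr_mono2) auto
      finally have "X A powr q * U B powr (q / p) \<le> X A powr q * (U A powr (q / p - 1) * U B)"
        by (intro mult_left_mono) auto
      then show "X (record_parent S x B) powr q * U B powr (q / p) \<le> X A powr q * U A powr (q / p - 1) * U B"
        using B by (simp add: mult.assoc)
    qed
    also have "\<dots> = X A powr q * U A powr (q / p - 1) * (\<Sum>B\<in>{B\<in>S. record_parent S x B = A}. U B)"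
      by (simp only: sum_distrib_left)
    also have "\<dots> \<le> X A powr q * U A powr (q / p - 1) * (\<Lambda> * U A)"
    proof (intro mult_left_mono)
      have "(\<Sum>B\<in>{B\<in>S. record_parent S x B = A}. U B) \<le> (\<Sum>B\<in>{B\<in>S. B \<subseteq> A}. U B)"
        using record_parent(3)[OF S] S(1) U by (intro sum_mono2) (auto intro: less_imp_le)
      also have "\<dots> \<le> \<Lambda> * U A" using car A by (simp add: carleson_on_def)
      finally show "(\<Sum>B\<in>{B\<in>S. record_parent S x B = A}. U B) \<le> \<Lambda> * U A" .
    qed auto
    also have "\<dots> = \<Lambda> * (X A powr p * U A) powr (q / p)"
      using U[OF A] pq by (simp add: powr_mult powr_powr powr_diff)
    finally show "(\<Sum>B\<in>{B\<in>S. record_parent S x B = A}. X (record_parent S x B) powr q * U B powr (q / p))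
      \<le> \<Lambda> * (X A powr p * U A) powr (q / p)" .
  qed
  also have "\<dots> = \<Lambda> * (\<Sum>A\<in>R. (X A powr p * U A) powr (q / p))" by (simp only: sum_distrib_left)
  also have "\<dots> \<le> \<Lambda> * (\<Sum>A\<in>R. X A powr p * U A) powr (q / p)"
    using R U pq \<Lambda>0 by (intro mult_left_mono sum_powr_le_powr_sum) (auto simp: less_imp_le subset_iff)
  finally show ?thesis by (simp only: X_def R_def record_sum_def)
qed

section \<open>The two-weight bound for finite laminar families\<close>

text \<open>The cubes are grouped by their parent B for \<open>y\<close>. Nestedness forces their
  parent for \<open>x\<close> to be that of B, so x and y become constants on the group and the
  testing condition sums \<tau>. Hoelder's inequality with exponents q and q' separates the factors.
  The y-factor is a sum over records and costs nothing; the x-factor is enlarged to a sum over all B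
  in S, and this is the only use of \<Lambda>.\<close>

lemma bilinear_nested_le:
  fixes U V x y \<tau> :: "'a set \<Rightarrow> real"
  assumes S: "finite S" "laminar S"
    and U: "\<And>Q. Q \<in> S \<Longrightarrow> 0 < U Q" and V: "\<And>Q. Q \<in> S \<Longrightarrow> 0 < V Q"
    and x: "\<And>Q. Q \<in> S \<Longrightarrow> 0 < x Q" and y: "\<And>Q. Q \<in> S \<Longrightarrow> 0 < y Q"
    and \<tau>: "\<And>Q. Q \<in> S \<Longrightarrow> 0 \<le> \<tau> Q"
    and car: "carleson_on S \<Lambda> U" and sup: "superadditive_on S U" and pq: "1 < p" "p \<le> q"
    and test: "\<And>B. B \<in> S \<Longrightarrow> (\<Sum>Q\<in>{Q\<in>S. Q \<subseteq> B}. \<tau> Q) \<le> T * (U B powr (1 / p) * V B powr (1 - 1 / q))"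
    and T: "0 \<le> T"
  shows "(\<Sum>Q\<in>{Q\<in>S. record_parent S y Q \<subseteq> record_parent S x Q}. \<tau> Q * x Q * y Q)
     \<le> 4 * T * \<Lambda> powr (1 / q) * record_sum S x p U powr (1 / p)
         * record_sum S y (q / (q - 1)) V powr (1 - 1 / q)"
proof (cases "S = {}")
  case True
  then show ?thesis using T by (simp add: record_sum_def records_def)
next
  case False
  then have \<Lambda>0: "0 \<le> \<Lambda>" using carleson_on_nonneg[OF car S(1) _ U] by auto
  define X where "X = (\<lambda>A. 2 powr real_of_int (dyadic_level (x A)))"
  define Y where "Y = (\<lambda>A. 2 powr real_of_int (dyadic_level (y A)))"
  define \<pi> where "\<pi> = record_parent S x"
  define \<rho> where "\<rho> = record_parent S y"
  define S1 where "S1 = {Q\<in>S. \<rho> Q \<subseteq> \<pi> Q}"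
  define R where "R = records S y"
  have S1: "finite S1" "S1 \<subseteq> S" using S by (auto simp: S1_def)
  have R: "finite R" "R \<subseteq> S" using S by (auto simp: R_def records_def)
  have XY: "0 < X A" "0 < Y A" for A by (auto simp: X_def Y_def)
  define a where "a = (\<lambda>B. X (\<pi> B) powr q * U B powr (q / p))"
  define b where "b = (\<lambda>B. Y B powr (q / (q - 1)) * V B)"
  have q: "0 < 1 / q" "1 / q < 1" "q > 1" using pq by auto
  have "(\<Sum>Q\<in>S1. \<tau> Q * x Q * y Q) \<le> (\<Sum>Q\<in>S1. 4 * (X (\<pi> (\<rho> Q)) * Y (\<rho> Q)) * \<tau> Q)"
  proof (rule sum_mono)
    fix Q assume "Q \<in> S1"
    then have Q: "Q \<in> S" and sub: "\<rho> Q \<subseteq> \<pi> Q" by (auto simp: S1_def)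
    have "\<pi> (\<rho> Q) = \<pi> Q"
      unfolding \<pi>_def
    proof (rule record_parent_eq[OF S Q])
      show "\<rho> Q \<in> S" "Q \<subseteq> \<rho> Q" unfolding \<rho>_def by (rule record_parent[OF S Q])+
      show "\<rho> Q \<subseteq> record_parent S x Q" using sub by (simp add: \<pi>_def)
    qed
    then have "x Q \<le> 2 * X (\<pi> (\<rho> Q))"
      using record_parent_bound[of S Q x, OF S Q x[OF Q]] by (simp add: X_def \<pi>_def)
    moreover have "y Q \<le> 2 * Y (\<rho> Q)"
      using record_parent_bound[of S Q y, OF S Q y[OF Q]] by (simp add: Y_def \<rho>_def)
    ultimately have "x Q * y Q \<le> (2 * X (\<pi> (\<rho> Q))) * (2 * Y (\<rho> Q))"
      using x[OF Q] y[OF Q] by (intro mult_mono) auto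
    then have "\<tau> Q * (x Q * y Q) \<le> \<tau> Q * ((2 * X (\<pi> (\<rho> Q))) * (2 * Y (\<rho> Q)))"
      by (intro mult_left_mono \<tau>[OF Q])
    then show "\<tau> Q * x Q * y Q \<le> 4 * (X (\<pi> (\<rho> Q)) * Y (\<rho> Q)) * \<tau> Q" by (simp add: mult_ac)
  qed
  also have "\<dots> = (\<Sum>B\<in>R. \<Sum>Q\<in>{Q\<in>S1. \<rho> Q = B}. 4 * (X (\<pi> (\<rho> Q)) * Y (\<rho> Q)) * \<tau> Q)"
    using R(1) S1 record_parent(1)[OF S] by (intro sum.group[symmetric]) (auto simp: R_def \<rho>_def)
  also have "\<dots> \<le> (\<Sum>B\<in>R. 4 * T * (a B powr (1 / q) * b B powr (1 - 1 / q)))"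
  proof (rule sum_mono)
    fix B assume "B \<in> R"
    then have B: "B \<in> S" using R by auto
    have "(\<Sum>Q\<in>{Q\<in>S1. \<rho> Q = B}. 4 * (X (\<pi> (\<rho> Q)) * Y (\<rho> Q)) * \<tau> Q)
        = 4 * (X (\<pi> B) * Y B) * (\<Sum>Q\<in>{Q\<in>S1. \<rho> Q = B}. \<tau> Q)"
      by (simp add: sum_distrib_left)
    also have "\<dots> \<le> 4 * (X (\<pi> B) * Y B) * (T * (U B powr (1 / p) * V B powr (1 - 1 / q)))"
    proof (intro mult_left_mono)
      have "(\<Sum>Q\<in>{Q\<in>S1. \<rho> Q = B}. \<tau> Q) \<le> (\<Sum>Q\<in>{Q\<in>S. Q \<subseteq> B}. \<tau> Q)"
        using S1 S record_parent(3)[OF S] \<tau> by (intro sum_mono2) (auto simp: \<rho>_def)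
      also have "\<dots> \<le> T * (U B powr (1 / p) * V B powr (1 - 1 / q))" by (rule test[OF B])
      finally show "(\<Sum>Q\<in>{Q\<in>S1. \<rho> Q = B}. \<tau> Q) \<le> T * (U B powr (1 / p) * V B powr (1 - 1 / q))" .
    qed (use XY in \<open>auto simp: less_imp_le\<close>)
    also have "\<dots> = 4 * T * ((X (\<pi> B) * U B powr (1 / p)) * (Y B * V B powr (1 - 1 / q)))" by simp
    also have "X (\<pi> B) * U B powr (1 / p) = a B powr (1 / q)"
      using pq XY(1)[of "\<pi> B"] U[OF B] by (simp add: a_def powr_mult powr_powr)
    also have "Y B * V B powr (1 - 1 / q) = b B powr (1 - 1 / q)"
    proof -
      have "q / (q - 1) * (1 - 1 / q) = 1" using q by (simp add: field_simps)
      then have "(Y B powr (q / (q - 1))) powr (1 - 1 / q) = Y B"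
        using XY(2)[of B] unfolding powr_powr by (simp only: powr_one_gt_zero_iff)
      then show ?thesis using XY[of B] V[OF B] by (simp add: b_def powr_mult)
    qed
    finally show "(\<Sum>Q\<in>{Q\<in>S1. \<rho> Q = B}. 4 * (X (\<pi> (\<rho> Q)) * Y (\<rho> Q)) * \<tau> Q)
      \<le> 4 * T * (a B powr (1 / q) * b B powr (1 - 1 / q))" .
  qed
  also have "\<dots> = 4 * T * (\<Sum>B\<in>R. a B powr (1 / q) * b B powr (1 - 1 / q))" by (simp only: sum_distrib_left)
  also have "\<dots> \<le> 4 * T * ((\<Sum>B\<in>R. a B) powr (1 / q) * (\<Sum>B\<in>R. b B) powr (1 - 1 / q))"
  proof (intro mult_left_mono powr_sum_Holder)
    show "0 \<le> a i" for i by (simp add: a_def)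
    show "0 \<le> b i" if "i \<in> R" for i
      using V[of i] R(2) that by (auto simp: b_def less_imp_le)
  qed (use q R T in auto)
  also have "(\<Sum>B\<in>R. b B) = record_sum S y (q / (q - 1)) V" by (simp only: record_sum_def b_def R_def Y_def)
  also have "(\<Sum>B\<in>R. a B) powr (1 / q) \<le> (\<Lambda> * record_sum S x p U powr (q / p)) powr (1 / q)"
  proof (intro powr_mono2)
    have "(\<Sum>B\<in>R. a B) \<le> (\<Sum>B\<in>S. a B)" using R S by (intro sum_mono2) (auto simp: a_def)
    also have "\<dots> \<le> \<Lambda> * record_sum S x p U powr (q / p)"
      unfolding a_def X_def \<pi>_def by (rule sum_record_parent_powr_le[OF S U car sup pq])
    finally show "(\<Sum>B\<in>R. a B) \<le> \<Lambda> * record_sum S x p U powr (q / p)" .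
    show "0 \<le> (\<Sum>B\<in>R. a B)" by (auto simp: a_def intro!: sum_nonneg)
  qed (use q in auto)
  also have "(\<Lambda> * record_sum S x p U powr (q / p)) powr (1 / q) = \<Lambda> powr (1 / q) * record_sum S x p U powr (1 / p)"
    using \<Lambda>0 pq by (simp add: powr_mult powr_powr)
  finally show ?thesis using T by (simp add: S1_def \<pi>_def \<rho>_def mult_left_mono mult_right_mono mult_ac)
qed

text \<open>The two parents of a cube are comparable, so one of the two nested cases applies. The
  second is the first with x and y exchanged and with the dual exponents \<open>p2\<close> = q' and
  \<open>q2\<close> = p'; p <= q gives q' <= p'.\<close>

lemma bilinear_le:
  fixes U V x y \<tau> :: "'a set \<Rightarrow> real"
  assumes S: "finite S" "laminar S"
    and U: "\<And>Q. Q \<in> S \<Longrightarrow> 0 < U Q" and V: "\<And>Q. Q \<in> S \<Longrightarrow> 0 < V Q"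
    and x: "\<And>Q. Q \<in> S \<Longrightarrow> 0 < x Q" and y: "\<And>Q. Q \<in> S \<Longrightarrow> 0 < y Q"
    and \<tau>: "\<And>Q. Q \<in> S \<Longrightarrow> 0 \<le> \<tau> Q"
    and car: "carleson_on S \<Lambda>u U" "carleson_on S \<Lambda>v V"
    and sup: "superadditive_on S U" "superadditive_on S V" and pq: "1 < p" "p \<le> q"
    and test: "\<And>B. B \<in> S \<Longrightarrow> (\<Sum>Q\<in>{Q\<in>S. Q \<subseteq> B}. \<tau> Q) \<le> T * (U B powr (1 / p) * V B powr (1 - 1 / q))"
    and T: "0 \<le> T"
  shows "(\<Sum>Q\<in>S. \<tau> Q * x Q * y Q)
     \<le> 4 * T * (\<Lambda>u powr (1 / q) + \<Lambda>v powr (1 - 1 / p)) * (record_sum S x p U powr (1 / p)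
         * record_sum S y (q / (q - 1)) V powr (1 - 1 / q))"
proof -
  define \<pi> where "\<pi> = record_parent S x"
  define \<rho> where "\<rho> = record_parent S y"
  define p2 where "p2 = q / (q - 1)"
  define q2 where "q2 = p / (p - 1)"
  have p2: "1 < p2" "1 / p2 = 1 - 1 / q" using pq by (auto simp: p2_def field_simps)
  have q2: "1 / q2 = 1 - 1 / p" "1 - 1 / q2 = 1 / p" "q2 / (q2 - 1) = p"
    using pq by (auto simp: q2_def divide_simps)
  have p2q2: "p2 \<le> q2" using pq by (simp add: p2_def q2_def field_simps)
  define h where "h = (\<lambda>Q. \<tau> Q * x Q * y Q)"
  have h0: "0 \<le> h Q" if "Q \<in> S" for Q using that \<tau> x y by (simp add: h_def less_imp_le)
  have "S = {Q\<in>S. \<rho> Q \<subseteq> \<pi> Q} \<union> {Q\<in>S. \<pi> Q \<subseteq> \<rho> Q}"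
  proof -
    have "\<rho> Q \<subseteq> \<pi> Q \<or> \<pi> Q \<subseteq> \<rho> Q" if "Q \<in> S" for Q
      unfolding \<rho>_def \<pi>_def
      by (rule laminar_comparable[OF S(2) _ _ that]; rule record_parent[OF S that])
    then show ?thesis by auto
  qed
  then have "(\<Sum>Q\<in>S. h Q) = sum h ({Q\<in>S. \<rho> Q \<subseteq> \<pi> Q} \<union> {Q\<in>S. \<pi> Q \<subseteq> \<rho> Q})" by simp
  also have "\<dots> \<le> sum h {Q\<in>S. \<rho> Q \<subseteq> \<pi> Q} + sum h {Q\<in>S. \<pi> Q \<subseteq> \<rho> Q}"
  proof -
    have "0 \<le> sum h ({Q\<in>S. \<rho> Q \<subseteq> \<pi> Q} \<inter> {Q\<in>S. \<pi> Q \<subseteq> \<rho> Q})" by (intro sum_nonneg) (auto intro: h0)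
    moreover have "sum h ({Q\<in>S. \<rho> Q \<subseteq> \<pi> Q} \<union> {Q\<in>S. \<pi> Q \<subseteq> \<rho> Q}) + sum h ({Q\<in>S. \<rho> Q \<subseteq> \<pi> Q} \<inter> {Q\<in>S. \<pi> Q \<subseteq> \<rho> Q})
       = sum h {Q\<in>S. \<rho> Q \<subseteq> \<pi> Q} + sum h {Q\<in>S. \<pi> Q \<subseteq> \<rho> Q}"
      using S(1) by (intro sum.union_inter) auto
    ultimately show ?thesis by linarith
  qed
  also have "sum h {Q\<in>S. \<rho> Q \<subseteq> \<pi> Q} \<le> 4 * T * \<Lambda>u powr (1 / q) * record_sum S x p U powr (1 / p)
         * record_sum S y p2 V powr (1 - 1 / q)"
    unfolding h_def \<pi>_def \<rho>_def p2_def
    by (rule bilinear_nested_le[OF S U V x y \<tau> car(1) sup(1) pq test T])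
  also have "sum h {Q\<in>S. \<pi> Q \<subseteq> \<rho> Q} \<le> 4 * T * \<Lambda>v powr (1 - 1 / p) * record_sum S y p2 V powr (1 - 1 / q)
         * record_sum S x p U powr (1 / p)"
  proof -
    have t: "(\<Sum>Q\<in>{Q\<in>S. Q \<subseteq> B}. \<tau> Q) \<le> T * (V B powr (1 / p2) * U B powr (1 - 1 / q2))" if "B \<in> S" for B
      using test[OF that] unfolding p2 q2(2) by (simp add: mult_ac)
    have "(\<Sum>Q\<in>{Q\<in>S. record_parent S x Q \<subseteq> record_parent S y Q}. \<tau> Q * y Q * x Q)
     \<le> 4 * T * \<Lambda>v powr (1 / q2) * record_sum S y p2 V powr (1 / p2)
         * record_sum S x (q2 / (q2 - 1)) U powr (1 - 1 / q2)"
      by (rule bilinear_nested_le[OF S V U y x \<tau> car(2) sup(2) p2(1) p2q2 t T])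
    moreover have "\<tau> Q * y Q * x Q = h Q" for Q by (simp add: h_def mult_ac)
    ultimately show ?thesis unfolding q2 p2(2) \<pi>_def \<rho>_def by simp
  qed
  finally show ?thesis by (simp add: h_def p2_def algebra_simps)
qed

text \<open>Hoelder's inequality is applied over all cubes at once rather than over the records of
  one function. Both factors then range over all of S, and the Carleson constants of both weights
  are lost.\<close>

lemma bilinear_naive_le:
  fixes U V x y :: "'a set \<Rightarrow> real"
  assumes S: "finite S" "laminar S"
    and U: "\<And>Q. Q \<in> S \<Longrightarrow> 0 < U Q" and V: "\<And>Q. Q \<in> S \<Longrightarrow> 0 < V Q"
    and x: "\<And>Q. Q \<in> S \<Longrightarrow> 0 < x Q" and y: "\<And>Q. Q \<in> S \<Longrightarrow> 0 < y Q"
    and car: "carleson_on S \<Lambda>u U" "carleson_on S \<Lambda>v V"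
    and sup: "superadditive_on S U" "superadditive_on S V" and p: "1 < p"
  shows "(\<Sum>Q\<in>S. U Q powr (1 / p) * V Q powr (1 - 1 / p) * x Q * y Q)
     \<le> 4 * (\<Lambda>u powr (1 / p) * \<Lambda>v powr (1 - 1 / p)) * (record_sum S x p U powr (1 / p)
         * record_sum S y (p / (p - 1)) V powr (1 - 1 / p))"
proof (cases "S = {}")
  case True
  then show ?thesis by (simp add: record_sum_def records_def)
next
  case False
  have \<Lambda>0: "0 \<le> \<Lambda>u" "0 \<le> \<Lambda>v"
    using False carleson_on_nonneg[OF car(1) S(1) _ U] carleson_on_nonneg[OF car(2) S(1) _ V] by auto
  define X where "X = (\<lambda>Q. 2 powr real_of_int (dyadic_level (x (record_parent S x Q))))"
  define Y where "Y = (\<lambda>Q. 2 powr real_of_int (dyadic_level (y (record_parent S y Q))))"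
  define a where "a = (\<lambda>Q. X Q powr p * U Q)"
  define p2 where "p2 = p / (p - 1)"
  define b where "b = (\<lambda>Q. Y Q powr p2 * V Q)"
  have p2: "1 < p2" "p2 * (1 - 1 / p) = 1" using p by (auto simp: p2_def field_simps)
  have XY: "0 < X A" "0 < Y A" for A by (auto simp: X_def Y_def)
  have rs0: "0 \<le> record_sum S x p U" "0 \<le> record_sum S y p2 V"
    by (intro record_sum_nonneg less_imp_le U V; assumption)+
  have "(\<Sum>Q\<in>S. U Q powr (1 / p) * V Q powr (1 - 1 / p) * x Q * y Q)
      \<le> (\<Sum>Q\<in>S. 4 * (a Q powr (1 / p) * b Q powr (1 - 1 / p)))"
  proof (rule sum_mono)
    fix Q assume Q: "Q \<in> S"
    have "x Q * y Q \<le> (2 * X Q) * (2 * Y Q)"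
      using record_parent_bound[of S Q x, OF S Q x[OF Q]] record_parent_bound[of S Q y, OF S Q y[OF Q]] x[OF Q] y[OF Q]
      by (intro mult_mono) (auto simp: X_def Y_def)
    then have "U Q powr (1 / p) * V Q powr (1 - 1 / p) * (x Q * y Q)
      \<le> U Q powr (1 / p) * V Q powr (1 - 1 / p) * ((2 * X Q) * (2 * Y Q))"
      by (intro mult_left_mono) auto
    also have "\<dots> = 4 * (a Q powr (1 / p) * b Q powr (1 - 1 / p))"
      using p p2 XY[of Q] U[OF Q] V[OF Q] by (simp add: a_def b_def powr_mult powr_powr)
    finally show "U Q powr (1 / p) * V Q powr (1 - 1 / p) * x Q * y Q
      \<le> 4 * (a Q powr (1 / p) * b Q powr (1 - 1 / p))" by (simp add: mult_ac)
  qed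
  also have "\<dots> = 4 * (\<Sum>Q\<in>S. a Q powr (1 / p) * b Q powr (1 - 1 / p))" by (simp only: sum_distrib_left)
  also have "\<dots> \<le> 4 * ((\<Sum>Q\<in>S. a Q) powr (1 / p) * (\<Sum>Q\<in>S. b Q) powr (1 - 1 / p))"
    using S p U V by (intro mult_left_mono powr_sum_Holder) (auto simp: a_def b_def less_imp_le)
  also have "\<dots> \<le> 4 * ((\<Lambda>u * record_sum S x p U) powr (1 / p) * (\<Lambda>v * record_sum S y p2 V) powr (1 - 1 / p))"
  proof (intro mult_left_mono mult_mono powr_mono2)
    show "(\<Sum>Q\<in>S. a Q) \<le> \<Lambda>u * record_sum S x p U"
    proof -
      have "(\<Sum>Q\<in>S. a Q) = (\<Sum>B\<in>S. X B powr p * U B powr (p / p))"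
        using p U by (intro sum.cong) (auto simp: a_def abs_of_pos)
      also have "\<dots> \<le> \<Lambda>u * record_sum S x p U powr (p / p)"
        unfolding X_def by (rule sum_record_parent_powr_le[OF S U car(1) sup(1)]) (use p in auto)
      finally show ?thesis using p rs0 by simp
    qed
    show "(\<Sum>Q\<in>S. b Q) \<le> \<Lambda>v * record_sum S y p2 V"
    proof -
      have "(\<Sum>Q\<in>S. b Q) = (\<Sum>B\<in>S. Y B powr p2 * V B powr (p2 / p2))"
        using p2 V by (intro sum.cong) (auto simp: b_def abs_of_pos)
      also have "\<dots> \<le> \<Lambda>v * record_sum S y p2 V powr (p2 / p2)"
        unfolding Y_def by (rule sum_record_parent_powr_le[OF S V car(2) sup(2)]) (use p2 in auto)
      finally show ?thesis using p2 rs0 by simp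
    qed
    show "0 \<le> (\<Sum>Q\<in>S. a Q)" "0 \<le> (\<Sum>Q\<in>S. b Q)"
      using U V by (auto simp: a_def b_def less_imp_le intro!: sum_nonneg)
  qed (use p in auto)
  also have "\<dots> = 4 * (\<Lambda>u powr (1 / p) * \<Lambda>v powr (1 - 1 / p)) * (record_sum S x p U powr (1 / p)
         * record_sum S y p2 V powr (1 - 1 / p))"
    using \<Lambda>0 rs0 by (simp add: powr_mult)
  finally show ?thesis by (simp only: p2_def)
qed

text \<open>Sets of comparable \<open>K\<^sub>Q = \<mu>\<^sup>a U\<^sup>\<beta> V\<^sup>\<gamma>\<close>: replacing \<open>K\<^sub>Q\<close> by \<open>K\<^sub>Q ^ (1 + \<epsilon>)\<close> makes the
  exponent of \<open>\<mu>\<close> positive, so that the local sums converge, and costs nothing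
  since \<open>K\<^sub>B ^ - \<epsilon>\<close> is comparable to \<open>K\<^sub>Q ^ - \<epsilon>\<close>.\<close>

lemma comparable_class_test:
  fixes mu U V :: "'a set \<Rightarrow> real"
  assumes S: "finite S" "laminar S"
    and pos: "\<And>Q. Q \<in> S \<Longrightarrow> 0 < mu Q" "\<And>Q. Q \<in> S \<Longrightarrow> 0 < U Q" "\<And>Q. Q \<in> S \<Longrightarrow> 0 < V Q"
    and car: "carleson_on S \<Lambda> mu" and sup: "superadditive_on S U" "superadditive_on S V"
    and \<epsilon>: "0 < \<epsilon>" "0 < - a * \<epsilon>" "- a * \<epsilon> < 1" "\<epsilon> * \<beta> \<le> s" "\<epsilon> * \<gamma> \<le> t"
      "1 \<le> s + t - \<epsilon> * (a + \<beta> + \<gamma>)"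
    and \<kappa>: "0 < \<kappa>" "\<And>Q. Q \<in> S \<Longrightarrow> \<kappa> \<le> mu Q powr a * U Q powr \<beta> * V Q powr \<gamma>"
      "\<And>Q. Q \<in> S \<Longrightarrow> mu Q powr a * U Q powr \<beta> * V Q powr \<gamma> \<le> 2 * \<kappa>"
    and \<Lambda>: "0 \<le> \<Lambda>" and B: "B \<in> S"
  shows "(\<Sum>Q\<in>{Q\<in>S. Q \<subseteq> B}. mu Q powr a * U Q powr (s + \<beta>) * V Q powr (t + \<gamma>))
    \<le> 2 powr (1 + \<epsilon>) * (4 * \<Lambda> / (1 - 2 powr (a * \<epsilon>))) * \<kappa> * (U B powr s * V B powr t)"
proof -
  define k where "k = (\<lambda>Q. mu Q powr a * U Q powr \<beta> * V Q powr \<gamma>)"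
  \<comment> \<open>The summand divided by \<open>k Q powr (1 + \<epsilon>)\<close>. It also equals
    U^s V^t divided by \<open>k Q powr \<epsilon>\<close>, which is how the value at
    \<open>B\<close> is undone at the end.\<close>
  define h where "h = (\<lambda>Q. mu Q powr (- a * \<epsilon>) * U Q powr (s - \<epsilon> * \<beta>) * V Q powr (t - \<epsilon> * \<gamma>))"
  define D where "D = 4 * \<Lambda> / (1 - 2 powr (a * \<epsilon>))"
  have D0: "0 \<le> D"
  proof -
    have "2 powr (a * \<epsilon>) < (1::real)" using \<epsilon> by (intro powr_less_one) auto
    then show ?thesis using \<Lambda> by (simp add: D_def)
  qed
  have hk: "h Q * k Q powr \<epsilon> = U Q powr s * V Q powr t"
    and hk': "mu Q powr a * U Q powr (s + \<beta>) * V Q powr (t + \<gamma>) = h Q * k Q powr (1 + \<epsilon>)" if "Q \<in> S" for Q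
  proof -
    have k\<epsilon>: "k Q powr r = mu Q powr (r * a) * U Q powr (r * \<beta>) * V Q powr (r * \<gamma>)" for r
      by (simp add: k_def powr_mult powr_powr mult.commute)
    have "h Q * k Q powr r = mu Q powr (- a * \<epsilon> + r * a) * U Q powr (s - \<epsilon> * \<beta> + r * \<beta>) * V Q powr (t - \<epsilon> * \<gamma> + r * \<gamma>)" for r
      unfolding h_def k\<epsilon> by (simp only: powr_add mult_ac)
    from this[of \<epsilon>] this[of "1 + \<epsilon>"] pos[OF that] show "h Q * k Q powr \<epsilon> = U Q powr s * V Q powr t"
      "mu Q powr a * U Q powr (s + \<beta>) * V Q powr (t + \<gamma>) = h Q * k Q powr (1 + \<epsilon>)"
      by (simp_all add: algebra_simps)
  qed
  have h0: "0 \<le> h Q" for Q by (simp add: h_def)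
  have "(\<Sum>Q\<in>{Q\<in>S. Q \<subseteq> B}. mu Q powr a * U Q powr (s + \<beta>) * V Q powr (t + \<gamma>))
      \<le> (\<Sum>Q\<in>{Q\<in>S. Q \<subseteq> B}. (2 * \<kappa>) powr (1 + \<epsilon>) * h Q)"
  proof (rule sum_mono)
    fix Q assume "Q \<in> {Q\<in>S. Q \<subseteq> B}"
    then have Q: "Q \<in> S" by auto
    have "h Q * k Q powr (1 + \<epsilon>) \<le> h Q * (2 * \<kappa>) powr (1 + \<epsilon>)"
      using \<kappa>(1) \<kappa>(2,3)[OF Q] \<epsilon>(1) h0 by (intro mult_left_mono powr_mono2) (auto simp: k_def)
    then show "mu Q powr a * U Q powr (s + \<beta>) * V Q powr (t + \<gamma>) \<le> (2 * \<kappa>) powr (1 + \<epsilon>) * h Q"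
      using hk'[OF Q] by (simp add: mult.commute)
  qed
  also have "\<dots> = (2 * \<kappa>) powr (1 + \<epsilon>) * (\<Sum>Q\<in>{Q\<in>S. Q \<subseteq> B}. h Q)" by (simp only: sum_distrib_left)
  also have "\<dots> \<le> (2 * \<kappa>) powr (1 + \<epsilon>) * (D * h B)"
  proof (intro mult_left_mono)
    \<comment> \<open>The last condition on \<epsilon> is the exponent condition of
      \<open>carleson_sum_three_powers_le\<close> with e = -a \<epsilon>.\<close>
    have "1 - - a * \<epsilon> \<le> (s - \<epsilon> * \<beta>) + (t - \<epsilon> * \<gamma>)" using \<epsilon>(6) by (simp add: algebra_simps)
    from carleson_sum_three_powers_le[OF S pos car sup \<epsilon>(2,3) _ _ this B]
    show "(\<Sum>Q\<in>{Q\<in>S. Q \<subseteq> B}. h Q) \<le> D * h B" using \<epsilon>(4,5) by (simp add: h_def D_def)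
  qed auto
  also have "\<dots> \<le> (2 * \<kappa>) powr (1 + \<epsilon>) * (D * (\<kappa> powr (- \<epsilon>) * (U B powr s * V B powr t)))"
  proof -
    have "h B * \<kappa> powr \<epsilon> \<le> h B * k B powr \<epsilon>"
      using \<kappa>(1) \<kappa>(2)[OF B] \<epsilon>(1) h0 by (intro mult_left_mono powr_mono2) (auto simp: k_def)
    then have "h B \<le> \<kappa> powr (- \<epsilon>) * (U B powr s * V B powr t)"
      using hk[OF B] \<kappa>(1) by (simp add: powr_minus field_simps)
    then show ?thesis using D0 by (intro mult_left_mono) auto
  qed
  also have "\<dots> = 2 powr (1 + \<epsilon>) * D * (\<kappa> powr (1 + \<epsilon>) * \<kappa> powr (- \<epsilon>)) * (U B powr s * V B powr t)"
    using \<kappa>(1) by (simp add: powr_mult)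
  also have "\<kappa> powr (1 + \<epsilon>) * \<kappa> powr (- \<epsilon>) = \<kappa>" using \<kappa>(1) by (simp flip: powr_add)
  finally show ?thesis by (simp add: D_def)
qed

text \<open>The cubes are split by the dyadic size 2^i of the local characteristic. Each class
  satisfies a testing condition with constant proportional to 2^i, and the classes sum geometrically
  up to the size of K. A subfamily has its own principal sets, different from those of S, so X and Y
  have to bound the record sums of all subfamilies.\<close>

lemma two_weight_form_le:
  fixes mu U V x y :: "'a set \<Rightarrow> real"
  assumes S: "finite S" "laminar S"
    and pos: "\<And>Q. Q \<in> S \<Longrightarrow> 0 < mu Q" "\<And>Q. Q \<in> S \<Longrightarrow> 0 < U Q" "\<And>Q. Q \<in> S \<Longrightarrow> 0 < V Q"
    and xy: "\<And>Q. Q \<in> S \<Longrightarrow> 0 < x Q" "\<And>Q. Q \<in> S \<Longrightarrow> 0 < y Q"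
    and car: "carleson_on S \<Lambda> mu" "carleson_on S \<Lambda>u U" "carleson_on S \<Lambda>v V"
    and sup: "superadditive_on S U" "superadditive_on S V"
    and pq: "1 < p" "p \<le> q"
    and \<epsilon>: "0 < \<epsilon>" "0 < - a * \<epsilon>" "- a * \<epsilon> < 1" "\<epsilon> * \<beta> \<le> 1 / p" "\<epsilon> * \<gamma> \<le> 1 - 1 / q"
      "1 \<le> 1 / p + (1 - 1 / q) - \<epsilon> * (a + \<beta> + \<gamma>)"
    and \<Lambda>: "0 \<le> \<Lambda>" and K0: "0 \<le> K"
    and K: "\<And>Q. Q \<in> S \<Longrightarrow> mu Q powr a * U Q powr \<beta> * V Q powr \<gamma> \<le> K"
    and X: "\<And>S'. S' \<subseteq> S \<Longrightarrow> record_sum S' x p U \<le> X"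
    and Y: "\<And>S'. S' \<subseteq> S \<Longrightarrow> record_sum S' y (q / (q - 1)) V \<le> Y"
  shows "(\<Sum>Q\<in>S. mu Q powr a * U Q powr (1 / p + \<beta>) * V Q powr (1 - 1 / q + \<gamma>) * x Q * y Q)
    \<le> 8 * (2 powr (1 + \<epsilon>) * (4 * \<Lambda> / (1 - 2 powr (a * \<epsilon>)))) * K * (\<Lambda>u powr (1 / q) + \<Lambda>v powr (1 - 1 / p))
        * (X powr (1 / p) * Y powr (1 - 1 / q))"
proof -
  define D where "D = 2 powr (1 + \<epsilon>) * (4 * \<Lambda> / (1 - 2 powr (a * \<epsilon>)))"
  define \<tau> where "\<tau> = (\<lambda>Q. mu Q powr a * U Q powr (1 / p + \<beta>) * V Q powr (1 - 1 / q + \<gamma>))"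
  define k where "k = (\<lambda>Q. mu Q powr a * U Q powr \<beta> * V Q powr \<gamma>)"
  define lv where "lv = (\<lambda>Q. dyadic_level (k Q))"
  define M where "M = (\<Lambda>u powr (1 / q) + \<Lambda>v powr (1 - 1 / p)) * (X powr (1 / p) * Y powr (1 - 1 / q))"
  have D0: "0 \<le> D"
  proof -
    have "2 powr (a * \<epsilon>) < (1::real)" using \<epsilon> by (intro powr_less_one) auto
    then show ?thesis using \<Lambda> by (simp add: D_def)
  qed
  have M0: "0 \<le> M" by (simp add: M_def)
  have k0: "0 < k Q" if "Q \<in> S" for Q using pos[OF that] by (simp add: k_def)
  have "(\<Sum>Q\<in>S. \<tau> Q * x Q * y Q) = (\<Sum>i\<in>lv ` S. \<Sum>Q\<in>{Q\<in>S. lv Q = i}. \<tau> Q * x Q * y Q)"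
    using S by (intro sum.group[symmetric]) auto
  also have "\<dots> \<le> (\<Sum>i\<in>lv ` S. 4 * D * M * 2 powr (1 * real_of_int i))"
  proof (rule sum_mono)
    fix i
    define S' where "S' = {Q\<in>S. lv Q = i}"
    have S': "finite S'" "laminar S'" "S' \<subseteq> S"
      using S(1) laminar_subset[OF S(2), of S'] by (auto simp: S'_def)
    have in_S: "Q \<in> S" if "Q \<in> S'" for Q using that S' by auto
    have \<kappa>: "2 powr real_of_int i \<le> k Q" "k Q \<le> 2 * 2 powr real_of_int i" if "Q \<in> S'" for Q
      using dyadic_level[OF k0[OF in_S[OF that]]] that by (auto simp: S'_def lv_def)
    have car': "carleson_on S' \<Lambda> mu" "carleson_on S' \<Lambda>u U" "carleson_on S' \<Lambda>v V"
      by (rule carleson_on_subset[OF _ S(1) S'(3)], rule car, rule less_imp_le, rule pos, assumption)+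
    have sup': "superadditive_on S' U" "superadditive_on S' V"
      by (rule superadditive_on_subset[OF _ S'(3)], rule sup)+
    have "(\<Sum>Q\<in>S'. \<tau> Q * x Q * y Q)
      \<le> 4 * (D * 2 powr real_of_int i) * (\<Lambda>u powr (1 / q) + \<Lambda>v powr (1 - 1 / p)) *
          (record_sum S' x p U powr (1 / p) * record_sum S' y (q / (q - 1)) V powr (1 - 1 / q))"
    proof (rule bilinear_le[OF S'(1,2) pos(2,3)[OF in_S] xy[OF in_S] _ car'(2,3) sup' pq])
      fix B assume B: "B \<in> S'"
      show "(\<Sum>Q\<in>{Q\<in>S'. Q \<subseteq> B}. \<tau> Q) \<le> D * 2 powr real_of_int i * (U B powr (1 / p) * V B powr (1 - 1 / q))"
        unfolding \<tau>_def D_def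
        by (rule comparable_class_test[OF S'(1,2) pos[OF in_S] car'(1) sup' \<epsilon> _ _ _ \<Lambda> B])
          (use \<kappa> in \<open>auto simp: k_def\<close>)
    qed (use D0 in \<open>auto simp: \<tau>_def\<close>)
    also have "\<dots> \<le> 4 * (D * 2 powr real_of_int i) * (\<Lambda>u powr (1 / q) + \<Lambda>v powr (1 - 1 / p)) *
          (X powr (1 / p) * Y powr (1 - 1 / q))"
    proof (intro mult_left_mono mult_mono powr_mono2)
      show "0 \<le> record_sum S' x p U" "0 \<le> record_sum S' y (q / (q - 1)) V"
        by (intro record_sum_nonneg less_imp_le pos in_S; assumption)+
    qed (use pq D0 X[OF S'(3)] Y[OF S'(3)] in auto)
    also have "\<dots> = 4 * D * M * 2 powr (1 * real_of_int i)" by (simp add: M_def)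
    finally show "(\<Sum>Q\<in>{Q\<in>S. lv Q = i}. \<tau> Q * x Q * y Q) \<le> 4 * D * M * 2 powr (1 * real_of_int i)"
      by (simp add: S'_def)
  qed
  also have "\<dots> = 4 * D * M * (\<Sum>i\<in>lv ` S. 2 powr (1 * real_of_int i))" by (simp only: sum_distrib_left)
  also have "\<dots> \<le> 4 * D * M * (2 * K)"
  proof (cases "S = {}")
    case False
    then obtain Q where "Q \<in> S" by auto
    then have "0 < K" using k0[of Q] K[of Q] by (simp add: k_def)
    have "(\<Sum>i\<in>lv ` S. 2 powr (1 * real_of_int i)) \<le> 2 powr (1 * real_of_int (dyadic_level K)) / (1 - 2 powr (- 1))"
    proof (rule sum_geometric_int_le)
      fix i assume "i \<in> lv ` S"
      then obtain Q where Q: "Q \<in> S" "i = lv Q" by auto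
      then have "log 2 (k Q) \<le> log 2 K" using k0[of Q] K[of Q] by (simp add: k_def)
      then show "i \<le> dyadic_level K" by (simp add: Q lv_def dyadic_level_def floor_mono)
    qed (use S in auto)
    also have "\<dots> \<le> 2 * K" using dyadic_level_le[OF \<open>0 < K\<close>] by (simp add: powr_minus)
    finally show ?thesis using D0 M0 by (intro mult_left_mono) auto
  qed (use D0 M0 K0 in auto)
  also have "\<dots> = 8 * D * K * M" by simp
  finally show ?thesis by (simp add: \<tau>_def D_def M_def mult_ac)
qed

text \<open>All conditions but the last hold for small \<epsilon> since a < 0. The last one has the
  slack 1/p - 1/q, positive for p < q; without slack it forces \<epsilon> (a + \<beta> + \<gamma>)
  <= 0.\<close>

lemma two_weight_exponent_exists:
  fixes a \<beta> \<gamma> p q :: real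
  assumes "1 < p" "p \<le> q" "a < 0" "p < q \<or> a + \<beta> + \<gamma> = 0"
  obtains \<epsilon> where "0 < \<epsilon>" "0 < - a * \<epsilon>" "- a * \<epsilon> < 1" "\<epsilon> * \<beta> \<le> 1 / p" "\<epsilon> * \<gamma> \<le> 1 - 1 / q"
      "1 \<le> 1 / p + (1 - 1 / q) - \<epsilon> * (a + \<beta> + \<gamma>)"
proof -
  define M where "M = 1 + \<bar>a\<bar> + \<bar>\<beta>\<bar> + \<bar>\<gamma>\<bar>"
  define \<delta> where "\<delta> = (if p < q then 1 / p - 1 / q else 1)"
  define m where "m = min 1 (min (1 / p) (min (1 - 1 / q) \<delta>))"
  have \<delta>: "0 < \<delta>" using assms by (auto simp: \<delta>_def frac_less2)
  have q: "0 < 1 - 1 / q" using assms by auto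
  have m: "0 < m" "m \<le> 1" "m \<le> 1 / p" "m \<le> 1 - 1 / q" "m \<le> \<delta>"
    using \<delta> q assms by (auto simp: m_def)
  have M: "1 \<le> M" "\<bar>a\<bar> < M" "\<bar>\<beta>\<bar> \<le> M" "\<bar>\<gamma>\<bar> \<le> M" "\<bar>a + \<beta> + \<gamma>\<bar> \<le> M" by (auto simp: M_def)
  have le: "m / M * t \<le> m" if "\<bar>t\<bar> \<le> M" for t
  proof -
    have "m / M * t \<le> m / M * M" using that m M by (intro mult_left_mono) auto
    then show ?thesis using M by simp
  qed
  show thesis
  proof (rule that[of "m / M"])
    show mM: "0 < m / M" using m M by simp
    then show "0 < - a * (m / M)" using assms(3) by (intro mult_pos_pos) auto
    have "- a * (m / M) < M * (m / M)" using m M by (intro mult_strict_right_mono) auto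
    then show "- a * (m / M) < 1" using m M by simp
    show "m / M * \<beta> \<le> 1 / p" "m / M * \<gamma> \<le> 1 - 1 / q"
      using le[OF M(3)] le[OF M(4)] m by linarith+
    show "1 \<le> 1 / p + (1 - 1 / q) - m / M * (a + \<beta> + \<gamma>)"
    proof (cases "p < q")
      case True
      then show ?thesis using le[OF M(5)] m(5) by (simp add: \<delta>_def)
    next
      case False
      then have "p = q" using assms by simp
      then show ?thesis using False assms by simp
    qed
  qed
qed

text \<open>The Carleson embedding for principal sets. Writing \<open>X\<close> for the largest value at a point, the
  geometric growth of the values gives \<open>\<Sum> X\<^sub>A ^ (p - p0) \<le> c X ^ (p - p0)\<close>; then either
  \<open>F \<le> \<eta> u X ^ p0\<close>, and the contribution is absorbed, or \<open>X\<close> is controlled by \<open>F / u\<close>.\<close>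

lemma record_sum_embedding:
  fixes F u W :: "'a \<Rightarrow> real"
  assumes p: "0 < p0" "p0 < p"
    and S: "finite S" "laminar S" "S \<subseteq> sets M"
    and meas: "F \<in> borel_measurable M" "u \<in> borel_measurable M" "W \<in> borel_measurable M"
    and F0: "\<And>z. 0 \<le> F z" and u0: "AE z in M. 0 < u z"
    and W: "AE z in M. W z = (F z / u z) powr (p / p0) * u z"
    and U: "\<And>A. A \<in> S \<Longrightarrow> (\<integral>\<^sup>+z\<in>A. ennreal (u z) \<partial>M) = ennreal (U A)" "\<And>A. A \<in> S \<Longrightarrow> 0 < U A"
    and Fi: "\<And>A. A \<in> S \<Longrightarrow> (\<integral>\<^sup>+z\<in>A. ennreal (F z) \<partial>M) = ennreal (Fi A)" "\<And>A. A \<in> S \<Longrightarrow> 0 < Fi A"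
    and x: "\<And>A. A \<in> S \<Longrightarrow> x A = (Fi A / U A) powr (1 / p0)"
    and c_def: "c = 1 / (1 - 2 powr (- (p - p0)))"
  shows "ennreal (record_sum S x p U) \<le> ennreal (2 * c * (2 * c) powr (p / p0 - 1)) * (\<integral>\<^sup>+z. ennreal (W z) \<partial>M)"
proof -
  define lv where "lv = (\<lambda>A. dyadic_level (x A))"
  define X where "X = (\<lambda>A. 2 powr real_of_int (lv A))"
  define R where "R = records S x"
  define r where "r = p / p0"
  define C' where "C' = c * (2 * c) powr (r - 1)"
  define I where "I = (\<integral>\<^sup>+z. ennreal (W z) \<partial>M)"
  define rs where "rs = record_sum S x p U"
  have R: "finite R" "R \<subseteq> S" using S by (auto simp: R_def records_def)
  have RS: "A \<in> S" if "A \<in> R" for A using that R by auto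
  have c: "1 \<le> c"
  proof -
    have "2 powr (- (p - p0)) < (1::real)" using p by (intro powr_less_one) auto
    then show ?thesis by (simp add: c_def field_simps)
  qed
  have r: "1 < r" "r - 1 = (p - p0) / p0" using p by (auto simp: r_def field_simps)
  have X0: "0 < X A" for A by (simp add: X_def)
  have XU: "X A powr p0 * U A \<le> Fi A" if "A \<in> S" for A
  proof -
    have q0: "0 < Fi A / U A" "\<bar>Fi A / U A\<bar> = Fi A / U A" using U(2)[OF that] Fi(2)[OF that] by (simp_all only: abs_of_pos divide_pos_pos)
    then have "0 < x A" unfolding x[OF that] using U(2)[OF that] Fi(2)[OF that] by simp
    then have "X A \<le> x A" unfolding X_def lv_def by (rule dyadic_level_le)
    then have "X A powr p0 \<le> x A powr p0" using X0[of A] p by (intro powr_mono2) auto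
    also have "x A powr p0 = Fi A / U A" using q0 p by (simp add: x[OF that] powr_powr del: zero_less_divide_iff)
    finally show ?thesis using U(2)[OF that] by (simp add: field_simps)
  qed
  have rs0: "0 \<le> rs" unfolding rs_def by (rule record_sum_nonneg) (simp add: U(2) less_imp_le)
  define s where "s = (\<lambda>z. \<Sum>A\<in>R. X A powr (p - p0) * indicator A z)"
  define s2 where "s2 = (\<lambda>z. \<Sum>A\<in>R. X A powr p * indicator A z)"
  have s0: "0 \<le> s z" "0 \<le> s2 z" for z by (auto simp: s_def s2_def intro!: sum_nonneg)
  have key: "F z * s z \<le> u z / 2 * s2 z + C' * W z" if uz: "0 < u z" and Wz: "W z = (F z / u z) powr r * u z" for z
  proof (cases "{A\<in>R. z \<in> A} = {}")
    case True
    then have "s z = 0" unfolding s_def by (intro sum.neutral) auto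
    moreover have "0 \<le> C' * W z" using c uz by (simp add: C'_def Wz)
    ultimately show ?thesis using s0(2)[of z] uz by simp
  next
    case False
    define m where "m = Max (lv ` {A\<in>R. z \<in> A})"
    define Xm where "Xm = 2 powr real_of_int m"
    have Xm0: "0 < Xm" by (simp add: Xm_def)
    have "m \<in> lv ` {A\<in>R. z \<in> A}" unfolding m_def using False R by (intro Max_in) auto
    then obtain A0 where A0: "A0 \<in> R" "z \<in> A0" "m = lv A0" by auto
    have "Xm powr p = X A0 powr p * indicator A0 z" using A0 by (simp add: X_def Xm_def)
    also have "\<dots> \<le> s2 z" unfolding s2_def using R A0 by (intro member_le_sum) auto
    finally have s2: "Xm powr p \<le> s2 z" .
    have inj: "inj_on lv {A\<in>R. z \<in> A}"
      using records_inj_level[OF S(2), of _ x] by (auto simp: inj_on_def lv_def R_def)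
    have "s z = (\<Sum>A\<in>{A\<in>R. z \<in> A}. X A powr (p - p0))"
      unfolding s_def using R by (intro sum.mono_neutral_cong_right) auto
    also have "\<dots> = (\<Sum>i\<in>lv ` {A\<in>R. z \<in> A}. 2 powr ((p - p0) * real_of_int i))"
      using inj by (simp add: sum.reindex X_def powr_powr mult.commute)
    also have "\<dots> \<le> 2 powr ((p - p0) * real_of_int m) / (1 - 2 powr (- (p - p0)))"
      using R p by (intro sum_geometric_int_le) (auto simp: m_def)
    also have "\<dots> = c * Xm powr (p - p0)" by (simp add: c_def Xm_def powr_powr mult.commute)
    finally have s1: "s z \<le> c * Xm powr (p - p0)" .
    show ?thesis
    \<comment> \<open>The threshold \<eta> is 1/(2c): multiplied by the factor c of the geometric
      sum it gives exactly the half that is absorbed later.\<close>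
    proof (cases "F z \<le> u z / (2 * c) * Xm powr p0")
      case True
      have "F z * s z \<le> (u z / (2 * c) * Xm powr p0) * (c * Xm powr (p - p0))"
        using s1 True F0[of z] s0(1)[of z] uz c by (intro mult_mono) auto
      also have "\<dots> = u z / 2 * Xm powr p" using c p Xm0 by (simp add: field_simps flip: powr_add)
      also have "\<dots> \<le> u z / 2 * s2 z" using s2 uz by (intro mult_left_mono) auto
      also have "\<dots> \<le> u z / 2 * s2 z + C' * W z" using c uz by (simp add: C'_def Wz)
      finally show ?thesis .
    next
      case False
      define b where "b = F z / u z"
      have b: "Xm powr p0 \<le> 2 * c * b" using False uz c by (simp add: b_def field_simps)
      have b0: "0 < b" using b Xm0 c by (smt (verit) mult_nonneg_nonpos powr_gt_zero)
      have "Xm powr (p - p0) = (Xm powr p0) powr (r - 1)" using p by (simp add: powr_powr r(2))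
      also have "\<dots> \<le> (2 * c * b) powr (r - 1)" using b r(1) by (intro powr_mono2) auto
      also have "\<dots> = (2 * c) powr (r - 1) * b powr (r - 1)" using b0 c by (simp add: powr_mult)
      finally have "s z \<le> c * ((2 * c) powr (r - 1) * b powr (r - 1))"
        using s1 c by (meson mult_left_mono order_trans zero_le_one)
      then have "F z * s z \<le> F z * (c * ((2 * c) powr (r - 1) * b powr (r - 1)))"
        using F0[of z] by (intro mult_left_mono) auto
      also have "\<dots> = C' * (b powr (r - 1) * b) * u z" using uz by (simp add: C'_def b_def)
      also have "b powr (r - 1) * b = b powr r" using b0 by (simp add: powr_diff)
      also have "C' * b powr r * u z = C' * W z" by (simp add: Wz b_def)
      finally show ?thesis using s0(2)[of z] uz by (simp add: add_increasing)
    qed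
  qed
  have [measurable]: "A \<in> sets M" if "A \<in> R" for A using that RS S(3) by auto
  note [measurable] = meas
  have "rs = (\<Sum>A\<in>R. X A powr (p - p0) * (X A powr p0 * U A))"
    unfolding rs_def record_sum_def R_def X_def lv_def by (simp add: powr_diff)
  also have "\<dots> \<le> (\<Sum>A\<in>R. X A powr (p - p0) * Fi A)"
    using XU[OF RS] by (intro sum_mono mult_left_mono) auto
  finally have "ennreal rs \<le> ennreal (\<Sum>A\<in>R. X A powr (p - p0) * Fi A)" by (rule ennreal_leI)
  also have "\<dots> = (\<Sum>A\<in>R. ennreal (X A powr (p - p0)) * ennreal (Fi A))"
    using Fi(2)[OF RS] by (simp add: less_imp_le ennreal_mult flip: sum_ennreal)
  also have "\<dots> = (\<Sum>A\<in>R. (\<integral>\<^sup>+z. ennreal (X A powr (p - p0)) * (ennreal (F z) * indicator A z) \<partial>M))"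
    by (intro sum.cong refl, subst nn_integral_cmult) (auto simp: Fi(1)[OF RS])
  also have "\<dots> = (\<integral>\<^sup>+z. (\<Sum>A\<in>R. ennreal (X A powr (p - p0)) * (ennreal (F z) * indicator A z)) \<partial>M)"
    by (intro nn_integral_sum[symmetric]) auto
  also have "\<dots> = (\<integral>\<^sup>+z. ennreal (F z * s z) \<partial>M)"
  proof (rule nn_integral_cong)
    fix z
    have "(\<Sum>A\<in>R. ennreal (X A powr (p - p0)) * (ennreal (F z) * indicator A z))
        = (\<Sum>A\<in>R. ennreal (X A powr (p - p0) * (F z * indicator A z)))"
      using F0[of z] by (intro sum.cong refl) (auto simp: ennreal_mult indicator_def)
    also have "\<dots> = ennreal (\<Sum>A\<in>R. X A powr (p - p0) * (F z * indicator A z))"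
      using F0[of z] by (intro sum_ennreal) auto
    also have "(\<Sum>A\<in>R. X A powr (p - p0) * (F z * indicator A z)) = F z * s z"
      by (simp add: s_def sum_distrib_left mult_ac)
    finally show "(\<Sum>A\<in>R. ennreal (X A powr (p - p0)) * (ennreal (F z) * indicator A z)) = ennreal (F z * s z)" .
  qed
  also have "\<dots> \<le> (\<integral>\<^sup>+z. (\<Sum>A\<in>R. ennreal (X A powr p / 2) * (ennreal (u z) * indicator A z)) + ennreal C' * ennreal (W z) \<partial>M)"
  proof (rule nn_integral_mono_AE)
    show "AE z in M. ennreal (F z * s z) \<le> (\<Sum>A\<in>R. ennreal (X A powr p / 2) * (ennreal (u z) * indicator A z)) + ennreal C' * ennreal (W z)"
      using u0 W
    proof eventually_elim
      case (elim z)
      have "(\<Sum>A\<in>R. ennreal (X A powr p / 2) * (ennreal (u z) * indicator A z))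
        = (\<Sum>A\<in>R. ennreal (X A powr p / 2 * (u z * indicator A z)))"
        using elim by (intro sum.cong refl) (simp add: ennreal_mult'[symmetric] indicator_def)
      also have "\<dots> = ennreal (\<Sum>A\<in>R. X A powr p / 2 * (u z * indicator A z))"
        using elim by (intro sum_ennreal) auto
      also have "(\<Sum>A\<in>R. X A powr p / 2 * (u z * indicator A z)) = u z / 2 * s2 z"
        by (simp add: s2_def sum_distrib_left mult_ac)
      finally have 1: "(\<Sum>A\<in>R. ennreal (X A powr p / 2) * (ennreal (u z) * indicator A z)) = ennreal (u z / 2 * s2 z)" .
      have W0: "0 \<le> W z" "0 \<le> C'" using elim c by (auto simp: C'_def)
      have "ennreal (F z * s z) \<le> ennreal (u z / 2 * s2 z + C' * W z)"
        using key[of z] elim by (intro ennreal_leI) (auto simp: r_def)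
      also have "\<dots> = ennreal (u z / 2 * s2 z) + ennreal C' * ennreal (W z)"
        using W0 s0(2)[of z] elim by (simp add: ennreal_plus ennreal_mult)
      finally show ?case unfolding 1 .
    qed
  qed
  also have "\<dots> = (\<Sum>A\<in>R. ennreal (X A powr p / 2) * ennreal (U A)) + ennreal C' * I"
    by (subst nn_integral_add) (auto simp: nn_integral_sum nn_integral_cmult U(1)[OF RS] I_def)
  also have "(\<Sum>A\<in>R. ennreal (X A powr p / 2) * ennreal (U A)) = (\<Sum>A\<in>R. ennreal (X A powr p / 2 * U A))"
    using U(2)[OF RS] by (intro sum.cong refl) (simp add: ennreal_mult[symmetric] less_imp_le)
  also have "\<dots> = ennreal (\<Sum>A\<in>R. X A powr p / 2 * U A)"
    using U(2)[OF RS] by (intro sum_ennreal) (auto simp: less_imp_le)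
  also have "(\<Sum>A\<in>R. X A powr p / 2 * U A) = rs / 2"
    by (simp add: rs_def record_sum_def R_def X_def lv_def sum_divide_distrib)
  finally have fin: "ennreal rs \<le> ennreal (rs / 2) + ennreal C' * I" .
  have C'0: "0 < C'" using c by (simp add: C'_def)
  \<comment> \<open>Half of \<open>rs\<close> may be absorbed because a record sum of a finite
    family is a real number.\<close>
  have "ennreal rs \<le> ennreal (2 * C') * I"
  proof (cases I)
    case (real i)
    have "ennreal rs \<le> ennreal (rs / 2 + C' * i)"
      using fin real rs0 C'0 by (simp add: ennreal_mult ennreal_plus)
    then have "rs \<le> rs / 2 + C' * i" using real rs0 C'0 by (subst (asm) ennreal_le_iff) auto
    then have "ennreal rs \<le> ennreal (2 * C' * i)" by (intro ennreal_leI) simp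
    then show ?thesis using real C'0 by (simp add: ennreal_mult)
  next
    case top
    then show ?thesis using C'0 by (simp add: ennreal_mult_top)
  qed
  then show ?thesis by (simp add: rs_def C'_def I_def r_def mult_ac)
qed

section \<open>Dyadic grids\<close>

lemma cube_eq_INT: "cube c l = (\<Inter>i. {x. c $ i - l / 2 \<le> x $ i} \<inter> {x. x $ i < c $ i + l / 2})"
  by (auto simp: cube_def)

lemma cube_borel: "cube c l \<in> sets borel"
  unfolding cube_eq_INT
  by (intro sets.countable_INT'' sets.Int borel_closed borel_open)
    (auto intro!: closed_Collect_le open_Collect_less continuous_intros)

lemma cube_sets_lebesgue [measurable]: "cube c l \<in> sets lebesgue"
  using cube_borel[of c l] by simp

lemma cube_between:
  fixes c :: "real ^ 'n"
  shows "box (c - (\<chi> i. l / 2)) (c + (\<chi> i. l / 2)) \<subseteq> cube c l" "cube c l \<subseteq> cbox (c - (\<chi> i. l / 2)) (c + (\<chi> i. l / 2))"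
  by (auto simp: cube_def mem_box_cart less_imp_le)

lemma emeasure_cube:
  fixes c :: "real ^ 'n"
  assumes "0 \<le> l"
  shows "emeasure lebesgue (cube c l) = ennreal (l ^ CARD('n))"
proof (rule antisym)
  let ?d = "(\<chi> i. l / 2) :: real ^ 'n"
  have prod: "(\<Prod>b\<in>Basis. (c + ?d - (c - ?d)) \<bullet> b) = l ^ CARD('n)"
  proof -
    have "(\<Prod>b\<in>(Basis :: (real ^ 'n) set). (c + ?d - (c - ?d)) \<bullet> b) = (\<Prod>b\<in>(Basis :: (real ^ 'n) set). l)"
      by (intro prod.cong) (auto simp: Basis_vec_def inner_axis)
    then show ?thesis by simp
  qed
  have le: "(c - ?d) \<bullet> b \<le> (c + ?d) \<bullet> b" if "b \<in> Basis" for b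
    using that assms by (auto simp: Basis_vec_def inner_axis)
  have "emeasure lebesgue (cube c l) \<le> emeasure lebesgue (cbox (c - ?d) (c + ?d))"
    by (intro emeasure_mono cube_between) auto
  also have "\<dots> = ennreal (l ^ CARD('n))" unfolding prod[symmetric] using emeasure_lborel_cbox[OF le] by simp
  finally show "emeasure lebesgue (cube c l) \<le> ennreal (l ^ CARD('n))" .
  have "ennreal (l ^ CARD('n)) = emeasure lebesgue (box (c - ?d) (c + ?d))"
    unfolding prod[symmetric] using emeasure_lborel_box[OF le] by simp
  also have "\<dots> \<le> emeasure lebesgue (cube c l)"
    by (intro emeasure_mono cube_between) auto
  finally show "ennreal (l ^ CARD('n)) \<le> emeasure lebesgue (cube c l)" .
qed

text \<open>Levels are natural numbers, so among the sets containing a given one there is one of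
  least level. Laminarity makes it maximal under inclusion, and injectivity of c turns equality of
  sets into equality of indices. Applied to dyadic cubes and to triples of one residue
  class.\<close>

lemma maximal_indices:
  fixes c :: "nat \<times> 'b \<Rightarrow> 'a set"
  assumes lam: "\<And>q q'. q \<in> \<Q> \<Longrightarrow> q' \<in> \<Q> \<Longrightarrow> fst q \<le> fst q' \<Longrightarrow> c q \<inter> c q' \<noteq> {} \<Longrightarrow> c q' \<subseteq> c q"
    and ne: "\<And>q. q \<in> \<Q> \<Longrightarrow> c q \<noteq> {}" and inj: "inj_on c \<Q>"
  defines "\<M> \<equiv> {q \<in> \<Q>. \<forall>q'\<in>\<Q>. c q \<subseteq> c q' \<longrightarrow> q' = q}"
  shows "q \<in> \<Q> \<Longrightarrow> \<exists>M\<in>\<M>. c q \<subseteq> c M" and "disjoint_family_on c \<M>"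
proof -
  assume q: "q \<in> \<Q>"
  define A where "A = {q' \<in> \<Q>. c q \<subseteq> c q'}"
  have "q \<in> A" using q by (simp add: A_def)
  then obtain M where M: "M \<in> A" "\<And>y. y \<in> A \<Longrightarrow> fst M \<le> fst y"
    using ex_has_least_nat[of "\<lambda>x. x \<in> A" q fst] by blast
  have "q' = M" if q': "q' \<in> \<Q>" "c M \<subseteq> c q'" for q'
  proof -
    have "q' \<in> A" using M(1) q' by (auto simp: A_def)
    then have "fst M \<le> fst q'" by (rule M(2))
    moreover have "c M \<inter> c q' \<noteq> {}" "M \<in> \<Q>" using ne[of M] M(1) q' by (auto simp: A_def)
    ultimately have "c q' \<subseteq> c M" using lam[of M q'] q' by auto
    then show "q' = M" using q' \<open>M \<in> \<Q>\<close> inj by (auto simp: inj_on_def)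
  qed
  then have "M \<in> \<M>" using M(1) unfolding A_def \<M>_def by blast
  then show "\<exists>M\<in>\<M>. c q \<subseteq> c M" using M(1) unfolding A_def by blast
next
  show "disjoint_family_on c \<M>"
    unfolding disjoint_family_on_def
  proof (intro ballI impI, rule ccontr)
    fix q q' assume q: "q \<in> \<M>" "q' \<in> \<M>" "q \<noteq> q'" "c q \<inter> c q' \<noteq> {}"
    then have "c q' \<subseteq> c q \<or> c q \<subseteq> c q'"
      using lam[of q q'] lam[of q' q] by (cases "fst q \<le> fst q'") (auto simp: \<M>_def)
    then show False using q by (auto simp: \<M>_def)
  qed
qed

lemma int_le_div_iff:
  fixes a t P :: int
  assumes "0 < P"
  shows "a \<le> t div P \<longleftrightarrow> a * P \<le> t"
proof
  assume "a \<le> t div P"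
  then have "a * P \<le> t div P * P" using assms by (intro mult_right_mono) auto
  also have "\<dots> \<le> t" using pos_mod_sign[OF assms, of t] div_mult_mod_eq[of t P] by linarith
  finally show "a * P \<le> t" .
next
  assume "a * P \<le> t"
  then have "(a * P) div P \<le> t div P" using assms by (intro zdiv_mono1) auto
  then show "a \<le> t div P" using assms by simp
qed

text \<open>\<open>x0\<close> is the lower corner of the cube of level 0 with index 0. Only the
  sides L / 2^k with natural k occur. Cubes are addressed by level and integer index, so that
  countability and level arguments are immediate.\<close>

locale dyadic_grid =
  fixes x0 :: "real ^ 'n" and L :: real
  assumes L: "0 < L"
begin

definition side :: "nat \<Rightarrow> real" where
  "side k = L / 2 ^ k"

definition centre :: "nat \<times> (int ^ 'n) \<Rightarrow> real ^ 'n" where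
  "centre q = (\<chi> i. x0 $ i + side (fst q) * (real_of_int (snd q $ i) + 1 / 2))"

definition dyad :: "nat \<times> (int ^ 'n) \<Rightarrow> (real ^ 'n) set" where
  "dyad q = cube (centre q) (side (fst q))"

definition trip :: "nat \<times> (int ^ 'n) \<Rightarrow> (real ^ 'n) set" where
  "trip q = cube (centre q) (3 * side (fst q))"

definition idx :: "nat \<Rightarrow> real ^ 'n \<Rightarrow> int ^ 'n" where
  "idx k x = (\<chi> i. \<lfloor>(x $ i - x0 $ i) / side k\<rfloor>)"

lemma side_pos: "0 < side k"
  using L by (simp add: side_def)

lemma side_Suc: "side k = 2 * side (Suc k)"
  by (simp add: side_def)

lemma side_add: "side k = 2 ^ j * side (k + j)"
  by (simp add: side_def power_add)

lemma mem_dyad: "x \<in> dyad q \<longleftrightarrow> idx (fst q) x = snd q"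
proof -
  have "centre q $ i - side (fst q) / 2 \<le> x $ i \<and> x $ i < centre q $ i + side (fst q) / 2
     \<longleftrightarrow> \<lfloor>(x $ i - x0 $ i) / side (fst q)\<rfloor> = snd q $ i" for i
    using side_pos[of "fst q"] by (simp add: centre_def floor_eq_iff field_simps) (safe; linarith)
  then show ?thesis by (simp add: dyad_def cube_def vec_eq_iff idx_def)
qed

lemma mem_trip: "x \<in> trip q \<longleftrightarrow> (\<forall>i. snd q $ i - 1 \<le> idx (fst q) x $ i \<and> idx (fst q) x $ i \<le> snd q $ i + 1)"
proof -
  have "centre q $ i - 3 * side (fst q) / 2 \<le> x $ i \<and> x $ i < centre q $ i + 3 * side (fst q) / 2
     \<longleftrightarrow> snd q $ i - 1 \<le> \<lfloor>(x $ i - x0 $ i) / side (fst q)\<rfloor> \<and> \<lfloor>(x $ i - x0 $ i) / side (fst q)\<rfloor> \<le> snd q $ i + 1" for i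
    using side_pos[of "fst q"] by (simp add: centre_def le_floor_iff floor_le_iff field_simps) (safe; linarith)
  then show ?thesis by (simp add: trip_def cube_def idx_def)
qed

lemma dyad_subset_trip: "dyad q \<subseteq> trip q"
  by (auto simp: mem_dyad mem_trip)

lemma idx_add: "idx k x $ i = idx (k + j) x $ i div 2 ^ j"
proof -
  have "idx (k + j) x $ i div 2 ^ j = \<lfloor>(x $ i - x0 $ i) / side (k + j) / real_of_int (2 ^ j)\<rfloor>"
    unfolding idx_def vec_lambda_beta by (subst floor_divide_real_eq_div) auto
  also have "(x $ i - x0 $ i) / side (k + j) / real_of_int (2 ^ j) = (x $ i - x0 $ i) / side k"
    using side_add[of k j] by simp
  finally show ?thesis by (simp add: idx_def)
qed

definition coord :: "real ^ 'n \<Rightarrow> nat \<Rightarrow> nat \<times> (int ^ 'n)" where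
  "coord x k = (k, idx k x)"

lemma mem_dyad_coord: "x \<in> dyad (coord x k)"
  by (simp add: mem_dyad coord_def)

lemma mem_dyad_iff_coord: "x \<in> dyad q \<longleftrightarrow> q = coord x (fst q)"
  by (auto simp: mem_dyad coord_def prod_eq_iff)

lemma idx_point: "\<exists>x. idx k x = m"
proof -
  have "idx k (\<chi> i. x0 $ i + side k * real_of_int (m $ i)) = m"
    using side_pos[of k] by (simp add: idx_def vec_eq_iff)
  then show ?thesis by blast
qed

lemma dyad_nonempty: "dyad q \<noteq> {}"
  using idx_point[of "fst q" "snd q"] by (auto simp: mem_dyad)

lemma trip_nonempty: "trip q \<noteq> {}"
  using dyad_nonempty[of q] dyad_subset_trip[of q] by auto

lemma inj_trip_level: "fst q = fst q' \<Longrightarrow> trip q = trip q' \<Longrightarrow> q = q'"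
proof -
  assume k: "fst q = fst q'" and eq: "trip q = trip q'"
  have "snd q' $ i \<le> snd q $ i" if k: "fst q = fst q'" and eq: "trip q = trip q'" for q q' i
  proof -
    obtain x where x: "idx (fst q) x = (\<chi> i. snd q $ i - 1)" using idx_point by blast
    then have "x \<in> trip q" by (simp add: mem_trip)
    then have "x \<in> trip q'" by (simp add: eq)
    then have "snd q' $ i - 1 \<le> idx (fst q') x $ i" by (simp add: mem_trip)
    then show ?thesis using x k by simp
  qed
  from this[OF k eq] this[OF k[symmetric] eq[symmetric]] k show "q = q'"
    by (auto simp: prod_eq_iff vec_eq_iff intro: antisym)
qed

lemma emeasure_dyad: "emeasure lebesgue (dyad q) = ennreal (side (fst q) ^ CARD('n))"
  unfolding dyad_def by (rule emeasure_cube) (simp add: side_pos less_imp_le)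

lemma emeasure_trip: "emeasure lebesgue (trip q) = ennreal ((3 * side (fst q)) ^ CARD('n))"
  unfolding trip_def by (rule emeasure_cube) (simp add: side_pos less_imp_le)

lemma sets_dyad_trip [measurable]: "dyad q \<in> sets lebesgue" "trip q \<in> sets lebesgue"
  by (simp_all add: dyad_def trip_def)

lemma side_inj: "side k = side k' \<Longrightarrow> k = k'"
  using L by (simp add: side_def)

lemma inj_trip: "inj trip"
proof (rule injI)
  fix q q' assume eq: "trip q = trip q'"
  then have "ennreal ((3 * side (fst q)) ^ CARD('n)) = ennreal ((3 * side (fst q')) ^ CARD('n))"
    using emeasure_trip by metis
  then have "(3 * side (fst q)) ^ CARD('n) = (3 * side (fst q')) ^ CARD('n)"
    using side_pos by (simp add: less_imp_le)
  then have "side (fst q) = side (fst q')"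
    using side_pos[of "fst q"] side_pos[of "fst q'"] by (subst (asm) power_eq_iff_eq_base) auto
  then show "q = q'" using eq by (intro inj_trip_level side_inj)
qed

text \<open>The coarse index is the integer quotient of the fine one by 2^j. Changing the fine index
  by at most 1 changes the quotient by at most 1, which is why the triples are nested too.\<close>

lemma dyad_nested:
  assumes "fst q \<le> fst q'" "dyad q \<inter> dyad q' \<noteq> {}"
  shows "dyad q' \<subseteq> dyad q" "trip q' \<subseteq> trip q"
proof -
  define j where "j = fst q' - fst q"
  have k: "fst q' = fst q + j" using assms by (simp add: j_def)
  have div: "idx (fst q) x $ i = idx (fst q') x $ i div 2 ^ j" for x i
    unfolding k by (rule idx_add)
  obtain x where "x \<in> dyad q" "x \<in> dyad q'" using assms by auto
  then have m: "snd q $ i = snd q' $ i div 2 ^ j" for i using div[of x i] by (simp add: mem_dyad)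
  show "dyad q' \<subseteq> dyad q"
    by (auto simp: mem_dyad div m vec_eq_iff)
  show "trip q' \<subseteq> trip q"
  proof
    fix y assume y: "y \<in> trip q'"
    show "y \<in> trip q"
      unfolding mem_trip
    proof
      fix i
      define e where "e = idx (fst q') y $ i"
      define m' where "m' = snd q' $ i"
      have e: "m' - 1 \<le> e" "e \<le> m' + 1" using y by (auto simp: mem_trip e_def m'_def)
      have p: "(1::int) \<le> 2 ^ j" by simp
      have "m' div 2 ^ j - 1 = (m' + (- 1) * 2 ^ j) div 2 ^ j"
        using p by (subst div_mult_self1) auto
      also have "\<dots> = (m' - 2 ^ j) div 2 ^ j" by simp
      also have "\<dots> \<le> e div 2 ^ j" using e p by (intro zdiv_mono1; linarith)
      finally have 1: "m' div 2 ^ j - 1 \<le> e div 2 ^ j" .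
      have "e div 2 ^ j \<le> (m' + 2 ^ j) div 2 ^ j" using e p by (intro zdiv_mono1; linarith)
      also have "\<dots> = m' div 2 ^ j + 1" using p by simp
      finally show "snd q $ i - 1 \<le> idx (fst q) y $ i \<and> idx (fst q) y $ i \<le> snd q $ i + 1"
        using 1 unfolding div m e_def m'_def by (rule conjI[rotated])
    qed
  qed
qed

text \<open>The triples of the cubes of a dyadic grid split into \<open>3\<^sup>n\<close> laminar families
  (A. Lerner and F. Nazarov): halving the side maps the residue of the corner modulo 3 to its double.\<close>

definition residue :: "nat \<times> (int ^ 'n) \<Rightarrow> int ^ 'n" where
  "residue q = (\<chi> i. ((snd q $ i - 1) * 2 ^ fst q) mod 3)"

lemma residue_range: "residue q \<in> {v. \<forall>i. v $ i \<in> {0..2}}"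
proof -
  have "residue q $ i \<ge> 0 \<and> residue q $ i < 3" for i by (simp add: residue_def)
  then have "0 \<le> residue q $ i \<and> residue q $ i \<le> 2" for i by (smt (verit))
  then show ?thesis by simp
qed

lemma finite_residues: "finite {v :: int ^ 'n. \<forall>i. v $ i \<in> {0..2}}"
proof (rule finite_subset)
  show "{v :: int ^ 'n. \<forall>i. v $ i \<in> {0..2}} \<subseteq> vec_lambda ` (UNIV \<rightarrow>\<^sub>E {0..2})"
  proof
    fix v :: "int ^ 'n" assume "v \<in> {v. \<forall>i. v $ i \<in> {0..2}}"
    then show "v \<in> vec_lambda ` (UNIV \<rightarrow>\<^sub>E {0..2})"
      by (intro image_eqI[of _ _ "\<lambda>i. v $ i"]) auto
  qed
  show "finite (vec_lambda ` ((UNIV :: 'n set) \<rightarrow>\<^sub>E {0..2::int}))"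
    by (intro finite_imageI finite_PiE) auto
qed

text \<open>In units of the finer side, each coordinate of the triples is a run of 3 * 2^j integers
  starting at A and a run of 3 integers starting at B. Equal residues give 3 | A - B, since 2 is
  invertible and 4 is 1 modulo 3. The long run is cut from A into blocks of 3, the short run is
  aligned with these blocks, and so it lies inside as soon as they meet.\<close>

lemma trip_nested:
  assumes "fst q \<le> fst q'" "trip q \<inter> trip q' \<noteq> {}" "residue q = residue q'"
  shows "trip q' \<subseteq> trip q"
proof
  define j where "j = fst q' - fst q"
  have k: "fst q' = fst q + j" using assms by (simp add: j_def)
  have div: "idx (fst q) x $ i = idx (fst q') x $ i div 2 ^ j" for x i
    unfolding k by (rule idx_add)
  obtain x where x: "x \<in> trip q" "x \<in> trip q'" using assms by auto
  fix y assume y: "y \<in> trip q'"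
  show "y \<in> trip q"
    unfolding mem_trip
  proof
    fix i
    define m where "m = snd q $ i"
    define B where "B = snd q' $ i - 1"
    define A where "A = 2 ^ j * (m - 1)"
    define e where "e = idx (fst q') x $ i"
    define e' where "e' = idx (fst q') y $ i"
    have p: "(0::int) < 2 ^ j" by simp
    have iff: "m - 1 \<le> t div 2 ^ j \<and> t div 2 ^ j \<le> m + 1 \<longleftrightarrow> A \<le> t \<and> t < A + 3 * 2 ^ j" for t :: int
    proof -
      have "m - 1 \<le> t div 2 ^ j \<longleftrightarrow> A \<le> t"
        using int_le_div_iff[OF p, of "m - 1" t] by (simp add: A_def mult.commute)
      moreover have "m + 2 \<le> t div 2 ^ j \<longleftrightarrow> A + 3 * 2 ^ j \<le> t"
        using int_le_div_iff[OF p, of "m + 2" t] by (simp add: A_def algebra_simps)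
      moreover have "t div 2 ^ j \<le> m + 1 \<longleftrightarrow> \<not> m + 2 \<le> t div 2 ^ j" by linarith
      ultimately show ?thesis by (simp only: not_le)
    qed
    have e: "A \<le> e" "e < A + 3 * 2 ^ j" "B \<le> e" "e \<le> B + 2"
      using x[unfolded mem_trip, THEN spec, of i] iff[of e] by (auto simp: div e_def m_def B_def)
    have e': "B \<le> e'" "e' \<le> B + 2" using y[unfolded mem_trip, THEN spec, of i] by (auto simp: e'_def B_def)
    have "3 dvd A - B"
    proof -
      have "((m - 1) * 2 ^ fst q) mod 3 = (B * 2 ^ (fst q + j)) mod 3"
        using assms(3) by (simp add: residue_def vec_eq_iff m_def B_def k)
      then have "3 dvd (m - 1) * 2 ^ fst q - B * 2 ^ (fst q + j)" by (simp add: mod_eq_dvd_iff)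
      also have "(m - 1) * 2 ^ fst q - B * 2 ^ (fst q + j) = 2 ^ fst q * ((m - 1) - B * 2 ^ j)"
        by (simp add: power_add algebra_simps)
      finally have "3 dvd (m - 1) - B * 2 ^ j"
        by (subst (asm) coprime_dvd_mult_right_iff) auto
      then have "3 dvd 2 ^ j * ((m - 1) - B * 2 ^ j)" by (rule dvd_mult)
      also have "2 ^ j * ((m - 1) - B * 2 ^ j) = A - B * 4 ^ j"
      proof -
        have "(4::int) ^ j = 2 ^ j * 2 ^ j" by (simp flip: power_mult_distrib)
        then show ?thesis unfolding A_def by (simp only: right_diff_distrib mult_ac)
      qed
      finally have "3 dvd A - B * 4 ^ j" .
      moreover have "3 dvd B * (4 ^ j - 1)"
      proof (rule dvd_mult)
        have "(4 ^ j :: int) mod 3 = (4 mod 3) ^ j mod 3" by (simp only: power_mod)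
        then have "(4 ^ j :: int) mod 3 = 1 mod 3" by simp
        then show "(3::int) dvd 4 ^ j - 1" by (simp only: mod_eq_dvd_iff)
      qed
      ultimately have "3 dvd (A - B * 4 ^ j) + B * (4 ^ j - 1)" by (rule dvd_add)
      then show ?thesis by (simp add: algebra_simps)
    qed
    then obtain d where d: "A - B = 3 * d" by (elim dvdE)
    have "A \<le> e' \<and> e' < A + 3 * 2 ^ j"
    proof -
      have "3 * d \<le> 2" using d e by linarith
      then have "A \<le> B" using d by presburger
      moreover have "0 < 3 * d + 3 * 2 ^ j" using d e by linarith
      then have "d + 2 ^ j \<ge> 1" by linarith
      ultimately show ?thesis using d e' by linarith
    qed
    then show "snd q $ i - 1 \<le> idx (fst q) y $ i \<and> idx (fst q) y $ i \<le> snd q $ i + 1"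
      using iff[of e'] by (simp add: div e'_def m_def)
  qed
qed

lemma small_dyad_in_open:
  assumes "open U" "x \<in> U"
  obtains k where "k0 \<le> k" "dyad (coord x k) \<subseteq> U"
proof -
  obtain e where e: "0 < e" "ball x e \<subseteq> U" using assms openE by blast
  have "(\<lambda>k. real CARD('n) * (L / 2 ^ k)) \<longlonglongrightarrow> real CARD('n) * 0"
    by (intro tendsto_mult tendsto_const LIMSEQ_divide_realpow_zero) auto
  then have "\<forall>\<^sub>F k in sequentially. real CARD('n) * (L / 2 ^ k) < e"
    using e(1) by (intro order_tendstoD(2)[of _ 0]) auto
  then obtain N where N: "\<And>k. N \<le> k \<Longrightarrow> real CARD('n) * side k < e"
    unfolding eventually_sequentially side_def by blast
  define k where "k = max N k0"
  have "dyad (coord x k) \<subseteq> ball x e"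
  proof
    fix y assume y: "y \<in> dyad (coord x k)"
    have "\<bar>(y - x) $ i\<bar> \<le> side k" for i
    proof -
      have "y \<in> cube (centre (coord x k)) (side k)" "x \<in> cube (centre (coord x k)) (side k)"
        using y mem_dyad_coord[of x k] by (simp_all add: dyad_def coord_def)
      then show ?thesis unfolding cube_def by (simp add: abs_le_iff) (smt (verit, best) field_sum_of_halves)
    qed
    then have "(\<Sum>i\<in>UNIV. \<bar>(y - x) $ i\<bar>) \<le> real CARD('n) * side k"
      using sum_bounded_above[of UNIV "\<lambda>i. \<bar>(y - x) $ i\<bar>" "side k"] by simp
    then have "norm (y - x) \<le> real CARD('n) * side k" using norm_le_l1_cart[of "y - x"] by linarith
    also have "\<dots> < e" by (rule N) (simp add: k_def)
    finally show "y \<in> ball x e" by (simp add: dist_norm norm_minus_commute)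
  qed
  then show thesis using that[of k] e(2) by (auto simp: k_def)
qed

definition parent :: "nat \<times> (int ^ 'n) \<Rightarrow> nat \<times> (int ^ 'n)" where
  "parent q = (fst q - 1, \<chi> i. snd q $ i div 2)"

lemma dyad_parent:
  assumes "0 < fst q"
  shows "fst (parent q) = fst q - 1" "dyad q \<subseteq> dyad (parent q)"
    "emeasure lebesgue (dyad (parent q)) = 2 ^ CARD('n) * emeasure lebesgue (dyad q)"
proof -
  show 1: "fst (parent q) = fst q - 1" by (simp add: parent_def)
  obtain k where k: "fst q = Suc k" using assms by (cases "fst q") auto
  show "dyad q \<subseteq> dyad (parent q)"
  proof
    fix x assume "x \<in> dyad q"
    then show "x \<in> dyad (parent q)"
      using idx_add[of k x _ 1] k by (simp add: mem_dyad parent_def vec_eq_iff)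
  qed
  show "emeasure lebesgue (dyad (parent q)) = 2 ^ CARD('n) * emeasure lebesgue (dyad q)"
    using side_pos[of "Suc k"] unfolding emeasure_dyad
    by (simp add: parent_def k side_Suc[of k] power_mult_distrib ennreal_mult less_imp_le ennreal_power flip: ennreal_numeral)
qed

end

section \<open>Measurability of unions of cubes\<close>

lemma sigma_finite_lebesgue: "sigma_finite_measure (lebesgue :: 'a::euclidean_space measure)"
proof
  obtain A :: "'a set set" where A: "countable A" "A \<subseteq> sets lborel" "\<Union>A = space lborel" "\<forall>a\<in>A. emeasure lborel a \<noteq> \<infinity>"
    using lborel.sigma_finite_countable by blast
  then show "\<exists>A::'a set set. countable A \<and> A \<subseteq> sets lebesgue \<and> \<Union>A = space lebesgue \<and> (\<forall>a\<in>A. emeasure lebesgue a \<noteq> \<infinity>)"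
    by (intro exI[of _ A]) auto
qed

text \<open>The translates of C by t (1,...,1), for infinitely many distinct t between 0 and
  \<delta>, are pairwise disjoint by \<open>anti\<close>, have the same measure and lie in one
  bounded box.\<close>

lemma negligible_compact_disjoint_translates:
  fixes C :: "(real ^ 'n) set"
  assumes C: "compact C" and \<delta>: "0 < \<delta>"
    and anti: "\<And>x y. x \<in> C \<Longrightarrow> y \<in> C \<Longrightarrow> \<not> (\<forall>i. x $ i < y $ i \<and> y $ i < x $ i + \<delta>)"
  shows "negligible C"
proof -
  define t where "t = (\<lambda>k::nat. \<delta> / real (k + 2))"
  define v where "v = (\<lambda>k. (\<chi> i. t k) :: real ^ 'n)"
  have t: "0 < t k" "t k < \<delta>" for k
    using \<delta> by (auto simp: t_def divide_less_eq intro!: divide_pos_pos)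
  have less: "t k' < t k" if "k < k'" for k k' using that \<delta> by (auto simp: t_def intro!: divide_strict_left_mono)
  define m where "m = measure lebesgue C"
  have disj: "disjoint_family (\<lambda>k. (+) (v k) ` C)"
  proof -
    have "(+) (v k) ` C \<inter> (+) (v k') ` C = {}" if kk: "k < k'" for k k'
    proof (rule ccontr)
      assume "(+) (v k) ` C \<inter> (+) (v k') ` C \<noteq> {}"
      then obtain x y where xy: "x \<in> C" "y \<in> C" "v k + x = v k' + y" by auto
      have "y $ i = x $ i + (t k - t k')" for i
        using arg_cong[OF xy(3), of "\<lambda>z. z $ i"] by (simp add: v_def)
      then have "\<forall>i. x $ i < y $ i \<and> y $ i < x $ i + \<delta>"
        using less[OF kk] t(1)[of k'] t(2)[of k] by simp
      then show False using anti xy by blast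
    qed
    then show ?thesis unfolding disjoint_family_on_def by (metis Int_commute linorder_neqE_nat)
  qed
  have comp: "compact ((+) (v k) ` C)" for k using C by (rule compact_translation)
  then have meas: "(+) (v k) ` C \<in> lmeasurable" for k by (rule lmeasurable_compact)
  obtain b where b: "C \<subseteq> cbox (- b) b" using compact_imp_bounded[OF C] bounded_subset_cbox_symmetric by blast
  define D where "D = cbox (- b) (b + (\<chi> i. \<delta>))"
  have sub: "(+) (v k) ` C \<subseteq> D" for k
  proof
    fix x assume "x \<in> (+) (v k) ` C"
    then obtain y where y: "y \<in> C" "x = v k + y" by auto
    have "- (b $ i) \<le> y $ i \<and> y $ i \<le> b $ i" for i
      using b y(1) by (auto simp: mem_box_cart subset_iff)
    then show "x \<in> D" using t[of k] by (simp add: D_def mem_box_cart y(2) v_def) (smt (verit))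
  qed
  have "real N * m \<le> measure lebesgue D" for N
  proof -
    have "real N * m = (\<Sum>k<N. measure lebesgue ((+) (v k) ` C))" by (simp add: measure_translation m_def)
    also have "\<dots> = measure lebesgue (\<Union>k<N. (+) (v k) ` C)"
      using meas disj by (intro measure_UNION'[symmetric]) (auto simp: disjoint_family_on_def pairwise_def disjnt_def)
    also have "\<dots> \<le> measure lebesgue D"
      using sub meas by (intro measure_mono_fmeasurable) (auto simp: D_def fmeasurableD)
    finally show ?thesis .
  qed
  then have "m \<le> 0" by (metis linorder_not_le mult.commute reals_Archimedean3)
  then have "m = 0" using measure_nonneg[of lebesgue C] by (simp add: m_def)
  then show ?thesis
    using lmeasurable_compact[OF C] by (simp add: m_def negligible_iff_measure)
qed

text \<open>The excluded relation is open in (x, y), so it is excluded on the closure as well. The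
  closure is a countable union of compact sets, which removes any question about the measurability
  of A.\<close>

lemma negligible_strict_antichain:
  fixes A :: "(real ^ 'n) set"
  assumes \<delta>: "0 < \<delta>"
    and anti: "\<And>x y. x \<in> A \<Longrightarrow> y \<in> A \<Longrightarrow> \<not> (\<forall>i. x $ i < y $ i \<and> y $ i < x $ i + \<delta>)"
  shows "negligible A"
proof -
  have cl: "\<not> (\<forall>i. x $ i < y $ i \<and> y $ i < x $ i + \<delta>)" if xy: "x \<in> closure A" "y \<in> closure A" for x y
  proof
    assume lt: "\<forall>i. x $ i < y $ i \<and> y $ i < x $ i + \<delta>"
    obtain f g where f: "\<forall>n. f n \<in> A" "f \<longlonglongrightarrow> x" and g: "\<forall>n. g n \<in> A" "g \<longlonglongrightarrow> y"
      using xy unfolding closure_sequential by blast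
    have lim: "(\<lambda>n. g n $ i - f n $ i) \<longlonglongrightarrow> y $ i - x $ i" for i
      using f g by (intro tendsto_intros)
    have "\<forall>\<^sub>F n in sequentially. f n $ i < g n $ i \<and> g n $ i < f n $ i + \<delta>" for i
    proof -
      have "0 < y $ i - x $ i" "y $ i - x $ i < \<delta>" using lt[rule_format, of i] by auto
      from order_tendstoD(1)[OF lim[of i] this(1)] order_tendstoD(2)[OF lim[of i] this(2)]
      show ?thesis by eventually_elim auto
    qed
    then have "\<forall>\<^sub>F n in sequentially. \<forall>i. f n $ i < g n $ i \<and> g n $ i < f n $ i + \<delta>"
      by (rule eventually_all_finite)
    then obtain n where "\<forall>i. f n $ i < g n $ i \<and> g n $ i < f n $ i + \<delta>"
      using eventually_happens' sequentially_bot by blast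
    then show False using anti f g by blast
  qed
  have "negligible (closure A \<inter> cball 0 (real k))" for k
    by (rule negligible_compact_disjoint_translates[OF _ \<delta>]) (auto simp: cl compact_Int_closed closed_Int_compact)
  then have "negligible (\<Union>k. closure A \<inter> cball 0 (real k))"
    by (intro negligible_countable_Union) auto
  moreover have "A \<subseteq> (\<Union>k. closure A \<inter> cball 0 (real k))"
  proof
    fix x assume "x \<in> A"
    moreover obtain k where "norm x \<le> real k" using real_arch_simple by blast
    ultimately show "x \<in> (\<Union>k. closure A \<inter> cball 0 (real k))" using closure_subset by auto
  qed
  ultimately show ?thesis using negligible_subset by blast
qed

text \<open>A point of the union that is not interior to one of the cubes lies on a lower face, and an open
  box \<open>x + (0, \<delta>)\<^sup>n\<close> is contained in the union of the interiors.\<close>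

lemma sets_lebesgue_Union_cubes:
  fixes \<C> :: "((real ^ 'n) \<times> real) set"
  shows "(\<Union>(c, l)\<in>\<C>. cube c l) \<in> sets lebesgue"
proof -
  define int where "int = (\<lambda>(c :: real ^ 'n, l). {x. \<forall>i. c $ i - l / 2 < x $ i \<and> x $ i < c $ i + l / 2})"
  define U where "U = (\<Union>(c, l)\<in>\<C>. cube c l)"
  define I where "I = (\<Union>q\<in>\<C>. int q)"
  \<comment> \<open>The points keep the distance 1 / Suc k from every upper face of some cube
    containing them; this distance is the \<delta> of the antichain lemma.\<close>
  define N where "N = (\<lambda>k::nat. {x. \<exists>(c, l)\<in>\<C>. \<forall>i. c $ i - l / 2 \<le> x $ i \<and> x $ i + 1 / Suc k < c $ i + l / 2} - I)"
  have "open (int q)" for q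
  proof -
    obtain c l where q: "q = (c, l)" by (cases q)
    have "int q = box (c - (\<chi> i. l / 2)) (c + (\<chi> i. l / 2))"
      by (auto simp: int_def q mem_box_cart)
    then show ?thesis by (simp only: open_box)
  qed
  then have I: "open I" by (auto simp: I_def)
  have "negligible (N k)" for k
  proof (rule negligible_strict_antichain)
    show "0 < 1 / real (Suc k)" by simp
    fix x y assume x: "x \<in> N k" and y: "y \<in> N k"
    obtain c l where cl: "(c, l) \<in> \<C>" "\<forall>i. c $ i - l / 2 \<le> x $ i \<and> x $ i + 1 / Suc k < c $ i + l / 2"
      using x by (auto simp: N_def)
    show "\<not> (\<forall>i. x $ i < y $ i \<and> y $ i < x $ i + 1 / real (Suc k))"
    proof
      assume lt: "\<forall>i. x $ i < y $ i \<and> y $ i < x $ i + 1 / real (Suc k)"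
      have "c $ i - l / 2 < y $ i \<and> y $ i < c $ i + l / 2" for i
        using cl(2)[rule_format, of i] lt[rule_format, of i] by linarith
      then have "y \<in> int (c, l)" by (simp add: int_def)
      then have "y \<in> I" using cl(1) by (auto simp: I_def)
      then show False using y by (simp add: N_def)
    qed
  qed
  then have neg: "negligible (\<Union>k. N k)" by (intro negligible_countable_Union) auto
  have "U - I \<subseteq> (\<Union>k. N k)"
  proof
    fix x assume x: "x \<in> U - I"
    then obtain c l where cl: "(c, l) \<in> \<C>" "x \<in> cube c l" by (auto simp: U_def)
    have "\<exists>k::nat. x $ i + 1 / Suc k < c $ i + l / 2" for i
    proof -
      have "0 < c $ i + l / 2 - x $ i" using cl(2) by (simp add: cube_def)
      then obtain k where "inverse (real (Suc k)) < c $ i + l / 2 - x $ i" using reals_Archimedean by blast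
      then show ?thesis by (auto simp: inverse_eq_divide intro!: exI[of _ k])
    qed
    then obtain K :: "'n \<Rightarrow> nat" where K: "\<And>i. x $ i + 1 / Suc (K i) < c $ i + l / 2" by metis
    define k where "k = Max (range K)"
    have "x $ i + 1 / Suc k < c $ i + l / 2" for i
    proof -
      have "K i \<le> k" unfolding k_def by (intro Max_ge) auto
      then have "1 / real (Suc k) \<le> 1 / real (Suc (K i))" by (intro divide_left_mono) auto
      then show ?thesis using K[of i] by linarith
    qed
    then have "x \<in> N k" using x cl unfolding N_def cube_def by blast
    then show "x \<in> (\<Union>k. N k)" by blast
  qed
  then have "negligible (U - I)" using neg negligible_subset by blast
  then have "U - I \<in> sets lebesgue" by (rule negligible_imp_sets)
  moreover have "I \<in> sets lebesgue" using I by auto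
  moreover have "I \<subseteq> U" by (auto simp: I_def U_def int_def cube_def less_imp_le)
  then have "U = I \<union> (U - I)" by auto
  ultimately show ?thesis unfolding U_def by (metis sets.Un)
qed

section \<open>Oscillations and Hoelder's inequality\<close>

lemma epowr_ennreal: "0 < r \<Longrightarrow> 0 \<le> x \<Longrightarrow> epowr (ennreal x) r = ennreal (x powr r)"
  by (auto simp: epowr_def)

lemma epowr_top: "0 < r \<Longrightarrow> epowr \<infinity> r = \<infinity>"
  by (simp add: epowr_def)

lemma epowr_le_ennrealD:
  assumes "epowr x r \<le> ennreal t" "0 < r"
  shows "x \<le> ennreal (t powr (1 / r))"
proof (cases x)
  case (real y)
  then have "ennreal (y powr r) \<le> ennreal t" using assms by (simp add: epowr_ennreal)
  show ?thesis
  proof (cases "y = 0")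
    case False
    then have "0 < y powr r" using real by simp
    then have "y powr r \<le> t" using \<open>ennreal (y powr r) \<le> ennreal t\<close>
      by (metis ennreal_leI ennreal_le_iff ennreal_neg ennreal_eq_0_iff le_cases not_less le_zero_eq)
    then have "(y powr r) powr (1 / r) \<le> t powr (1 / r)" using assms(2) by (intro powr_mono2) auto
    then show ?thesis using real assms(2) by (simp add: powr_powr)
  qed (use real in simp)
next
  case top
  then show ?thesis using assms epowr_top[of r] by (simp add: top_unique infinity_ennreal_def)
qed

text \<open>For \<open>\<theta> = 0\<close> and \<open>\<theta> = 1\<close> this uses \<open>0 powr 0 = 0\<close>.\<close>

lemma nn_integral_Holder:
  fixes a b :: "'a \<Rightarrow> real"
  assumes \<theta>: "0 \<le> \<theta>" "\<theta> \<le> 1"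
    and meas [measurable]: "a \<in> borel_measurable M" "b \<in> borel_measurable M"
    and nonneg: "\<And>x. 0 \<le> a x" "\<And>x. 0 \<le> b x"
    and A: "(\<integral>\<^sup>+x. ennreal (a x) \<partial>M) \<le> ennreal A" "0 \<le> A"
    and B: "(\<integral>\<^sup>+x. ennreal (b x) \<partial>M) \<le> ennreal B" "0 \<le> B"
  shows "(\<integral>\<^sup>+x. ennreal (a x powr \<theta> * b x powr (1 - \<theta>)) \<partial>M) \<le> ennreal (A powr \<theta> * B powr (1 - \<theta>))"
proof (cases "A = 0 \<or> B = 0")
  case True
  then have "(\<integral>\<^sup>+x. ennreal (a x) \<partial>M) = 0 \<or> (\<integral>\<^sup>+x. ennreal (b x) \<partial>M) = 0" using A B by auto
  then have "(AE x in M. a x = 0) \<or> (AE x in M. b x = 0)"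
  proof (elim disjE)
    assume "(\<integral>\<^sup>+x. ennreal (a x) \<partial>M) = 0"
    then have "AE x in M. ennreal (a x) = 0" by (subst (asm) nn_integral_0_iff_AE) auto
    then show ?thesis using nonneg by (auto elim!: eventually_mono intro: antisym)
  next
    assume "(\<integral>\<^sup>+x. ennreal (b x) \<partial>M) = 0"
    then have "AE x in M. ennreal (b x) = 0" by (subst (asm) nn_integral_0_iff_AE) auto
    then show ?thesis using nonneg by (auto elim!: eventually_mono intro: antisym)
  qed
  then have "AE x in M. ennreal (a x powr \<theta> * b x powr (1 - \<theta>)) = 0" by (auto elim!: eventually_mono)
  then have "(\<integral>\<^sup>+x. ennreal (a x powr \<theta> * b x powr (1 - \<theta>)) \<partial>M) = (\<integral>\<^sup>+x. 0 \<partial>M)"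
    by (rule nn_integral_cong_AE)
  then show ?thesis by simp
next
  case False
  then have AB: "0 < A" "0 < B" using A B by auto
  define C where "C = A powr \<theta> * B powr (1 - \<theta>)"
  have C: "0 < C" using AB by (simp add: C_def)
  have "a x powr \<theta> * b x powr (1 - \<theta>) \<le> C * \<theta> / A * a x + C * (1 - \<theta>) / B * b x" for x
  proof -
    have "(a x / A) powr \<theta> * (b x / B) powr (1 - \<theta>) \<le> \<theta> * (a x / A) + (1 - \<theta>) * (b x / B)"
    proof (cases "a x = 0 \<or> b x = 0")
      case True
      then show ?thesis using nonneg[of x] AB \<theta> by auto
    next
      case False
      then have "0 < a x" "0 < b x" using nonneg[of x] by auto
      then show ?thesis using AB \<theta> by (intro Youngs_inequality_0) auto
    qed
    then have "C * ((a x / A) powr \<theta> * (b x / B) powr (1 - \<theta>)) \<le> C * (\<theta> * (a x / A) + (1 - \<theta>) * (b x / B))"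
      using C by (intro mult_left_mono) auto
    moreover have "C * ((a x / A) powr \<theta> * (b x / B) powr (1 - \<theta>)) = a x powr \<theta> * b x powr (1 - \<theta>)"
      using AB nonneg[of x] by (simp add: C_def powr_divide)
    ultimately show ?thesis by (simp add: distrib_left)
  qed
  then have "(\<integral>\<^sup>+x. ennreal (a x powr \<theta> * b x powr (1 - \<theta>)) \<partial>M)
     \<le> (\<integral>\<^sup>+x. ennreal (C * \<theta> / A) * ennreal (a x) + ennreal (C * (1 - \<theta>) / B) * ennreal (b x) \<partial>M)"
    using nonneg \<theta> C AB
    by (intro nn_integral_mono) (simp add: ennreal_mult[symmetric] ennreal_plus[symmetric] ennreal_leI del: ennreal_plus)
  also have "\<dots> = ennreal (C * \<theta> / A) * (\<integral>\<^sup>+x. ennreal (a x) \<partial>M) + ennreal (C * (1 - \<theta>) / B) * (\<integral>\<^sup>+x. ennreal (b x) \<partial>M)"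
    by (simp add: nn_integral_add nn_integral_cmult)
  also have "\<dots> \<le> ennreal (C * \<theta> / A) * ennreal A + ennreal (C * (1 - \<theta>) / B) * ennreal B"
    by (intro add_mono mult_left_mono A B) auto
  also have "\<dots> = ennreal (C * \<theta> / A * A + C * (1 - \<theta>) / B * B)"
    using C AB \<theta> by (simp add: ennreal_mult[symmetric] ennreal_plus[symmetric] del: ennreal_plus)
  also have "C * \<theta> / A * A + C * (1 - \<theta>) / B * B = C" using AB by (simp add: right_diff_distrib)
  finally show ?thesis by (simp add: C_def)
qed

lemma set_nn_integral_Holder:
  fixes G :: "'a \<Rightarrow> real"
  assumes "0 < \<theta>" "\<theta> \<le> 1" and [measurable]: "G \<in> borel_measurable M" "Q \<in> sets M"
    and "\<And>x. 0 \<le> G x" "emeasure M Q = ennreal m" "0 \<le> m"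
    and "(\<integral>\<^sup>+x\<in>Q. ennreal (G x powr (1 / \<theta>)) \<partial>M) \<le> ennreal J" "0 \<le> J"
  shows "(\<integral>\<^sup>+x\<in>Q. ennreal (G x) \<partial>M) \<le> ennreal (m powr (1 - \<theta>) * J powr \<theta>)"
proof -
  have "(\<integral>\<^sup>+x\<in>Q. ennreal (G x) \<partial>M)
      = (\<integral>\<^sup>+x. ennreal ((G x powr (1 / \<theta>) * indicator Q x) powr \<theta> * indicator Q x powr (1 - \<theta>)) \<partial>M)"
    using assms(1,5) by (intro nn_integral_cong) (auto simp: indicator_def powr_powr)
  also have "\<dots> \<le> ennreal (J powr \<theta> * m powr (1 - \<theta>))"
  proof (rule nn_integral_Holder)
    show "(\<integral>\<^sup>+x. ennreal (G x powr (1 / \<theta>) * indicator Q x) \<partial>M) \<le> ennreal J"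
      using assms(8) by (simp add: nn_integral_set_ennreal)
    show "(\<integral>\<^sup>+x. ennreal (indicator Q x) \<partial>M) \<le> ennreal m"
      using assms(6) by (simp add: ennreal_indicator)
  qed (use assms in auto)
  finally show ?thesis by (simp add: mult.commute)
qed

lemma real_of_ereal_inverse_nonneg: "0 < s \<Longrightarrow> 0 \<le> real_of_ereal (1 / s)"
  by (cases s) (auto simp: one_ereal_def)

lemma nn_integral_lebesgue_times_fst:
  fixes g :: "'a::euclidean_space \<Rightarrow> real" and Q D :: "'a set"
  assumes [measurable]: "Q \<in> sets lebesgue" "D \<in> sets lebesgue" and d: "emeasure lebesgue D = ennreal d"
    and [measurable]: "g \<in> borel_measurable lebesgue"
  shows "(\<integral>\<^sup>+z\<in>Q \<times> D. ennreal (g (fst z)) \<partial>(lebesgue \<Otimes>\<^sub>M lebesgue)) = ennreal d * (\<integral>\<^sup>+x\<in>Q. ennreal (g x) \<partial>lebesgue)"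
proof -
  interpret lebesgue: sigma_finite_measure "lebesgue :: 'a measure" by (rule sigma_finite_lebesgue)
  have "(\<integral>\<^sup>+z\<in>Q \<times> D. ennreal (g (fst z)) \<partial>(lebesgue \<Otimes>\<^sub>M lebesgue))
     = (\<integral>\<^sup>+x. (\<integral>\<^sup>+y. ennreal (g x) * indicator (Q \<times> D) (x, y) \<partial>lebesgue) \<partial>lebesgue)"
    by (subst lebesgue.nn_integral_fst[symmetric]) auto
  also have "\<dots> = (\<integral>\<^sup>+x. (ennreal (g x) * indicator Q x) * ennreal d \<partial>lebesgue)"
  proof (rule nn_integral_cong)
    fix x
    have "(\<integral>\<^sup>+y. ennreal (g x) * indicator (Q \<times> D) (x, y) \<partial>lebesgue)
      = (\<integral>\<^sup>+y. (ennreal (g x) * indicator Q x) * indicator D y \<partial>lebesgue)"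
      by (intro nn_integral_cong) (simp add: indicator_times mult.assoc)
    also have "\<dots> = (ennreal (g x) * indicator Q x) * ennreal d"
      by (simp add: nn_integral_cmult d)
    finally show "(\<integral>\<^sup>+y. ennreal (g x) * indicator (Q \<times> D) (x, y) \<partial>lebesgue) = (ennreal (g x) * indicator Q x) * ennreal d" .
  qed
  also have "\<dots> = (\<integral>\<^sup>+x. (ennreal (g x) * indicator Q x) \<partial>lebesgue) * ennreal d"
    by (rule nn_integral_multc) auto
  finally show ?thesis by (simp add: mult.commute)
qed

text \<open>Hoelder's inequality on Q x Q with the exponents s and s', where 1/s = e. The
  normalisation of \<open>osc\<close> contributes m^(2e), and G does not depend on the second
  variable, which contributes m^(1-e). For s infinite, e = 0 and the essential supremum is simply
  taken out of the integral.\<close>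

lemma osc_Holder:
  fixes h :: "real ^ 'n \<Rightarrow> 'b::{real_normed_vector, second_countable_topology}" and G :: "real ^ 'n \<Rightarrow> real"
  assumes s: "1 < s" and e: "e = real_of_ereal (1 / s)"
    and h [measurable]: "h \<in> borel_measurable lebesgue" and G [measurable]: "G \<in> borel_measurable lebesgue"
    and Q [measurable]: "Q \<in> sets lebesgue" and G0: "\<And>x. 0 \<le> G x"
    and m: "emeasure lebesgue Q = ennreal m" "0 < m"
    and osc: "osc s h Q \<le> ennreal t" and t: "0 \<le> t"
    and J: "(\<integral>\<^sup>+x\<in>Q. ennreal (G x powr (1 / (1 - e))) \<partial>lebesgue) \<le> ennreal J" "0 \<le> J"
  shows "(\<integral>\<^sup>+z\<in>Q \<times> Q. ennreal (norm (h (fst z) - h (snd z)) * G (fst z)) \<partial>(lebesgue \<Otimes>\<^sub>M lebesgue))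
     \<le> ennreal (t * m powr (1 + e) * J powr (1 - e))"
proof -
  let ?M = "lebesgue \<Otimes>\<^sub>M lebesgue :: ((real ^ 'n) \<times> (real ^ 'n)) measure"
  have QQ [measurable]: "Q \<times> Q \<in> sets ?M" by measurable
  define d where "d = (\<lambda>z. norm (h (fst z) - h (snd z)))"
  have d [measurable]: "d \<in> borel_measurable ?M" unfolding d_def by measurable
  have e01: "0 \<le> e" "e < 1"
  proof -
    show "0 \<le> e" using s unfolding e by (intro real_of_ereal_inverse_nonneg) (auto intro: less_trans[of 0 1])
    show "e < 1" using s unfolding e by (cases s) (auto simp: one_ereal_def)
  qed
  note prodJ = nn_integral_lebesgue_times_fst[OF Q Q m(1)]
  show ?thesis
  proof (cases "s = \<infinity>")
    case True
    then have e0: "e = 0" by (simp add: e)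
    let ?R = "restrict_space ?M (Q \<times> Q)"
    have "AE z in ?R. ennreal (d z) \<le> ennreal t"
      using esssup_AE[of "\<lambda>z. ennreal (norm (h (fst z) - h (snd z)))" ?R] osc True
      unfolding d_def osc_def by (auto elim!: eventually_mono)
    then have ae: "AE z in ?M. z \<in> Q \<times> Q \<longrightarrow> ennreal (d z) \<le> ennreal t"
      by (subst (asm) AE_restrict_space_iff) auto
    have "(\<integral>\<^sup>+z\<in>Q \<times> Q. ennreal (d z * G (fst z)) \<partial>?M) \<le> (\<integral>\<^sup>+z. ennreal t * (ennreal (G (fst z)) * indicator (Q \<times> Q) z) \<partial>?M)"
    proof (rule nn_integral_mono_AE)
      show "AE z in ?M. ennreal (d z * G (fst z)) * indicator (Q \<times> Q) z \<le> ennreal t * (ennreal (G (fst z)) * indicator (Q \<times> Q) z)"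
        using ae
      proof eventually_elim
        case (elim z)
        show ?case
        proof (cases "z \<in> Q \<times> Q")
          case True
          then have "ennreal (d z) * ennreal (G (fst z)) \<le> ennreal t * ennreal (G (fst z))"
            using elim by (intro mult_right_mono) auto
          then show ?thesis using True G0 by (simp add: ennreal_mult d_def)
        qed simp
      qed
    qed
    also have "\<dots> = ennreal t * (ennreal m * (\<integral>\<^sup>+x\<in>Q. ennreal (G x) \<partial>lebesgue))"
      by (subst nn_integral_cmult) (auto simp: prodJ)
    also have "\<dots> \<le> ennreal t * (ennreal m * ennreal J)"
      using J G0 e0 by (intro mult_left_mono) (auto simp: powr_one_gt_zero_iff)
    also have "\<dots> = ennreal (t * m powr (1 + e) * J powr (1 - e))"
      using t m J(2) e0 by (simp add: ennreal_mult[symmetric] mult.assoc)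
    finally show ?thesis by (simp add: d_def)
  next
    case False
    then obtain s' where s': "s = ereal s'" using s by (cases s) auto
    have s1: "1 < s'" using s s' by (simp add: one_ereal_def)
    have es: "e = 1 / s'" using s' s1 by (simp add: e one_ereal_def)
    define N where "N = (\<integral>\<^sup>+z\<in>Q \<times> Q. ennreal (d z powr s') \<partial>?M)"
    have "epowr (N / (ennreal m)\<^sup>2) (1 / s') \<le> ennreal t"
      using osc False by (simp add: osc_def s' N_def d_def m(1))
    then have "N / (ennreal m)\<^sup>2 \<le> ennreal (t powr s')"
      using epowr_le_ennrealD[of "N / (ennreal m)\<^sup>2" "1 / s'" t] s1 by simp
    then have N: "N \<le> ennreal (t powr s' * m\<^sup>2)"
    proof -
      assume le: "N / (ennreal m)\<^sup>2 \<le> ennreal (t powr s')"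
      have m2: "(ennreal m)\<^sup>2 = ennreal (m\<^sup>2)" using m(2) by (simp add: ennreal_power)
      have "N = N / ennreal (m\<^sup>2) * ennreal (m\<^sup>2)"
        using m(2) by (simp add: ennreal_divide_times mult_divide_eq_ennreal)
      also have "\<dots> \<le> ennreal (t powr s') * ennreal (m\<^sup>2)"
        using le unfolding m2 by (intro mult_right_mono) auto
      finally show ?thesis by (simp add: ennreal_mult)
    qed
    have "(\<integral>\<^sup>+z\<in>Q \<times> Q. ennreal (d z * G (fst z)) \<partial>?M)
       = (\<integral>\<^sup>+z. ennreal ((d z powr s' * indicator (Q \<times> Q) z) powr e *
            (G (fst z) powr (1 / (1 - e)) * indicator (Q \<times> Q) z) powr (1 - e)) \<partial>?M)"
      using e01 s1 G0 by (intro nn_integral_cong) (auto simp: indicator_def powr_powr es d_def)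
    also have "\<dots> \<le> ennreal ((t powr s' * m\<^sup>2) powr e * (m * J) powr (1 - e))"
    proof (rule nn_integral_Holder)
      show "(\<integral>\<^sup>+z. ennreal (d z powr s' * indicator (Q \<times> Q) z) \<partial>?M) \<le> ennreal (t powr s' * m\<^sup>2)"
        using N by (simp add: N_def nn_integral_set_ennreal)
      have "(\<integral>\<^sup>+z. ennreal (G (fst z) powr (1 / (1 - e)) * indicator (Q \<times> Q) z) \<partial>?M)
         = ennreal m * (\<integral>\<^sup>+x\<in>Q. ennreal (G x powr (1 / (1 - e))) \<partial>lebesgue)"
        using prodJ[of "\<lambda>x. G x powr (1 / (1 - e))"] by (simp add: nn_integral_set_ennreal)
      also have "\<dots> \<le> ennreal m * ennreal J" using J by (intro mult_left_mono) auto
      finally show "(\<integral>\<^sup>+z. ennreal (G (fst z) powr (1 / (1 - e)) * indicator (Q \<times> Q) z) \<partial>?M) \<le> ennreal (m * J)"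
        using m J by (simp add: ennreal_mult)
    qed (use e01 m J t in auto)
    also have "(t powr s' * m\<^sup>2) powr e * (m * J) powr (1 - e) = t * (m powr (2 * e) * m powr (1 - e)) * J powr (1 - e)"
    proof -
      have "(t powr s') powr e = t" using s1 t by (simp add: powr_powr es)
      moreover have "(m\<^sup>2) powr e = m powr (2 * e)" using m(2) by (simp add: powr_powr flip: powr_numeral)
      ultimately show ?thesis using t m J by (simp add: powr_mult)
    qed
    also have "m powr (2 * e) * m powr (1 - e) = m powr (1 + e)" by (simp add: add.commute flip: powr_add)
    finally show ?thesis by (simp add: d_def)
  qed
qed

lemma emeasure_UN_disjoint_le:
  assumes "countable I" "disjoint_family_on X I" "\<And>i. i \<in> I \<Longrightarrow> X i \<in> sets M" "sets N = sets M"
    and le: "\<And>i. i \<in> I \<Longrightarrow> emeasure M (X i) \<le> K * emeasure N (X i)"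
  shows "emeasure M (\<Union>i\<in>I. X i) \<le> K * emeasure N (\<Union>i\<in>I. X i)"
proof -
  have "emeasure M (\<Union>i\<in>I. X i) = (\<integral>\<^sup>+i. emeasure M (X i) \<partial>count_space I)"
    using assms by (intro emeasure_UN_countable) auto
  also have "\<dots> \<le> (\<integral>\<^sup>+i. K * emeasure N (X i) \<partial>count_space I)"
    using le by (intro nn_integral_mono) auto
  also have "\<dots> = K * (\<integral>\<^sup>+i. emeasure N (X i) \<partial>count_space I)" by (rule nn_integral_cmult) auto
  also have "(\<integral>\<^sup>+i. emeasure N (X i) \<partial>count_space I) = emeasure N (\<Union>i\<in>I. X i)"
    using assms by (intro emeasure_UN_countable[symmetric]) auto
  finally show ?thesis .
qed

lemma ennreal_le_of_add_le:
  assumes "ennreal (x + y) \<le> b + ennreal y" "0 \<le> y"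
  shows "ennreal x \<le> b"
proof (cases b)
  case (real r)
  then have "ennreal (x + y) \<le> ennreal (r + y)" using assms by (simp add: ennreal_plus)
  then have "x + y \<le> r + y" using real assms(2) by (subst (asm) ennreal_le_iff) auto
  then show ?thesis using real by (simp add: ennreal_leI)
qed simp

text \<open>For y in D, |h(x)| <= |h(x) - h(y)| + t0. Averaging over y in D bounds |h(x)| without
  knowing h to be integrable; the factor 4 is the loss in enlarging D to Q.\<close>

lemma good_set_integral_le:
  fixes h :: "real ^ 'n \<Rightarrow> 'b::{real_normed_vector, second_countable_topology}" and G :: "real ^ 'n \<Rightarrow> real"
  assumes s: "1 < s" and e: "e = real_of_ereal (1 / s)"
    and h [measurable]: "h \<in> borel_measurable lebesgue" and G [measurable]: "G \<in> borel_measurable lebesgue"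
    and Q [measurable]: "Q \<in> sets lebesgue" and G0: "\<And>x. 0 \<le> G x"
    and m: "emeasure lebesgue Q = ennreal m" "0 < m"
    and osc: "osc s h Q \<le> ennreal t" and t: "0 \<le> t"
    and J: "(\<integral>\<^sup>+x\<in>Q. ennreal (G x powr (1 / (1 - e))) \<partial>lebesgue) \<le> ennreal J" "0 \<le> J"
    and D [measurable]: "D \<in> sets lebesgue" and DQ: "D \<subseteq> Q" "ennreal (m / 4) \<le> emeasure lebesgue D"
    and hD: "\<And>x. x \<in> D \<Longrightarrow> norm (h x) \<le> t0" and t0: "0 \<le> t0"
  shows "(\<integral>\<^sup>+x\<in>Q. ennreal (norm (h x) * G x) \<partial>lebesgue) \<le> ennreal ((4 * t + t0) * (m powr e * J powr (1 - e)))"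
proof -
  let ?M = "lebesgue \<Otimes>\<^sub>M lebesgue :: ((real ^ 'n) \<times> (real ^ 'n)) measure"
  let ?A = "\<integral>\<^sup>+x\<in>Q. ennreal (norm (h x) * G x) \<partial>lebesgue"
  let ?B = "\<integral>\<^sup>+x\<in>Q. ennreal (G x) \<partial>lebesgue"
  have e01: "0 \<le> e" "e < 1"
  proof -
    show "0 \<le> e" using s unfolding e by (intro real_of_ereal_inverse_nonneg) (auto intro: less_trans[of 0 1])
    show "e < 1" using s unfolding e by (cases s) (auto simp: one_ereal_def)
  qed
  have "emeasure lebesgue D \<le> ennreal m" unfolding m(1)[symmetric] using DQ by (intro emeasure_mono) auto
  then obtain d where d: "emeasure lebesgue D = ennreal d" "0 \<le> d"
    by (metis ennreal_cases neq_top_trans ennreal_neq_top)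
  then have md: "m / 4 \<le> d" using DQ(2) by simp
  note Fub = nn_integral_lebesgue_times_fst[OF Q D d(1)]
  have B: "?B \<le> ennreal (m powr e * J powr (1 - e))"
    using set_nn_integral_Holder[of "1 - e" G lebesgue Q m J] e01 G0 m J by simp
  have "ennreal d * ?A = (\<integral>\<^sup>+z. ennreal (norm (h (fst z)) * G (fst z)) * indicator (Q \<times> D) z \<partial>?M)"
    by (rule Fub[symmetric]) auto
  also have "\<dots> \<le> (\<integral>\<^sup>+z. ennreal (norm (h (fst z) - h (snd z)) * G (fst z)) * indicator (Q \<times> Q) z
        + ennreal t0 * (ennreal (G (fst z)) * indicator (Q \<times> D) z) \<partial>?M)"
  proof (rule nn_integral_mono)
    fix z :: "(real ^ 'n) \<times> (real ^ 'n)"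
    show "ennreal (norm (h (fst z)) * G (fst z)) * indicator (Q \<times> D) z
      \<le> ennreal (norm (h (fst z) - h (snd z)) * G (fst z)) * indicator (Q \<times> Q) z + ennreal t0 * (ennreal (G (fst z)) * indicator (Q \<times> D) z)"
    proof (cases "z \<in> Q \<times> D")
      case True
      then have z: "z \<in> Q \<times> Q" "norm (h (snd z)) \<le> t0" using DQ hD by auto
      have "norm (h (fst z)) \<le> norm (h (fst z) - h (snd z)) + t0"
        using norm_triangle_ineq2[of "h (fst z)" "h (snd z)"] z(2) by linarith
      then have "norm (h (fst z)) * G (fst z) \<le> (norm (h (fst z) - h (snd z)) + t0) * G (fst z)"
        using G0 by (intro mult_right_mono) auto
      then have "ennreal (norm (h (fst z)) * G (fst z)) \<le> ennreal (norm (h (fst z) - h (snd z)) * G (fst z) + t0 * G (fst z))"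
        by (intro ennreal_leI) (simp add: distrib_right)
      then show ?thesis using True z G0 t0 by (simp add: ennreal_plus ennreal_mult)
    qed simp
  qed
  also have "\<dots> = (\<integral>\<^sup>+z\<in>Q \<times> Q. ennreal (norm (h (fst z) - h (snd z)) * G (fst z)) \<partial>?M) + ennreal t0 * (ennreal d * ?B)"
    by (subst nn_integral_add) (auto simp: nn_integral_cmult Fub)
  also have "\<dots> \<le> ennreal (t * m powr (1 + e) * J powr (1 - e)) + ennreal t0 * (ennreal d * ennreal (m powr e * J powr (1 - e)))"
    by (intro add_mono mult_left_mono osc_Holder[OF s e h G Q G0 m osc t J] B) auto
  also have "\<dots> \<le> ennreal (d * ((4 * t + t0) * (m powr e * J powr (1 - e))))"
  proof -
    have "t * m powr (1 + e) * J powr (1 - e) = m * (t * (m powr e * J powr (1 - e)))"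
      using m(2) by (simp add: powr_add)
    also have "\<dots> \<le> (4 * d) * (t * (m powr e * J powr (1 - e)))"
      using md t by (intro mult_right_mono) auto
    finally have "t * m powr (1 + e) * J powr (1 - e) + t0 * (d * (m powr e * J powr (1 - e)))
      \<le> d * ((4 * t + t0) * (m powr e * J powr (1 - e)))" by (simp add: algebra_simps)
    then have "ennreal (t * m powr (1 + e) * J powr (1 - e) + t0 * (d * (m powr e * J powr (1 - e))))
      \<le> ennreal (d * ((4 * t + t0) * (m powr e * J powr (1 - e))))" by (rule ennreal_leI)
    then show ?thesis using t t0 d(2) by (simp add: ennreal_plus ennreal_mult)
  qed
  also have "\<dots> = ennreal d * ennreal ((4 * t + t0) * (m powr e * J powr (1 - e)))"
    using d(2) by (rule ennreal_mult')
  finally show ?thesis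
    using md m(2) by (subst (asm) ennreal_mult_le_mult_iff) auto
qed

context dyadic_grid
begin

text \<open>The selected cubes are the maximal ones in which U has density above 2^-(n+1). The
  parent of such a cube fails this, so U fills at most half of the cube itself; summing the measures
  gives at most 2^(n+1) 2^-(n+2) = 1/2 of the large cube. Openness of U replaces the Lebesgue
  differentiation theorem: each point of U lies in a small dyadic cube contained in U.\<close>

lemma calderon_zygmund_open:
  assumes O: "open U" and small: "emeasure lebesgue (U \<inter> dyad q) \<le> ennreal (1 / 2 ^ (CARD('n) + 2)) * emeasure lebesgue (dyad q)"
  obtains \<P> where "\<And>P. P \<in> \<P> \<Longrightarrow> fst q < fst P" "\<And>P. P \<in> \<P> \<Longrightarrow> dyad P \<subseteq> dyad q"
    "disjoint_family_on dyad \<P>" "U \<inter> dyad q \<subseteq> (\<Union>P\<in>\<P>. dyad P)"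
    "emeasure lebesgue (\<Union>P\<in>\<P>. dyad P) \<le> ennreal (1 / 2) * emeasure lebesgue (dyad q)"
    "\<And>P. P \<in> \<P> \<Longrightarrow> ennreal (1 / 2) * emeasure lebesgue (dyad P) \<le> emeasure lebesgue (dyad P - U)"
proof -
  let ?N = "CARD('n)"
  have U [measurable]: "U \<in> sets lebesgue" using O by auto
  define \<Q> where "\<Q> = {P. fst q \<le> fst P \<and> dyad P \<subseteq> dyad q \<and>
      ennreal (1 / 2 ^ (?N + 1)) * emeasure lebesgue (dyad P) < emeasure lebesgue (dyad P \<inter> U)}"
  define \<P> where "\<P> = {P \<in> \<Q>. \<forall>P'\<in>\<Q>. dyad P \<subseteq> dyad P' \<longrightarrow> P' = P}"
  have inj: "inj_on dyad \<Q>"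
  proof (rule inj_onI)
    fix P P' assume eq: "dyad P = dyad P'"
    obtain x where x: "x \<in> dyad P" using dyad_nonempty by blast
    have "ennreal (side (fst P) ^ ?N) = ennreal (side (fst P') ^ ?N)" using emeasure_dyad[of P] emeasure_dyad[of P'] eq by simp
    then have "side (fst P) ^ ?N = side (fst P') ^ ?N" using side_pos by (simp add: less_imp_le)
    then have "side (fst P) = side (fst P')"
      using side_pos[of "fst P"] side_pos[of "fst P'"] by (subst (asm) power_eq_iff_eq_base) auto
    then have "fst P = fst P'" by (rule side_inj)
    then show "P = P'" using x eq mem_dyad_iff_coord[of x P] mem_dyad_iff_coord[of x P'] by simp
  qed
  have nest: "dyad P' \<subseteq> dyad P" if "fst P \<le> fst P'" "dyad P \<inter> dyad P' \<noteq> {}" for P P'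
    using dyad_nested(1)[OF that] .
  note max = maximal_indices[of \<Q> dyad, OF nest dyad_nonempty inj, folded \<P>_def]
  have fin: "emeasure lebesgue (dyad P) < \<infinity>" for P by (simp only: emeasure_dyad) simp
  have meq: "ennreal (1 / 2 ^ (?N + 1)) * emeasure lebesgue (dyad P) = ennreal (side (fst P) ^ ?N / 2 ^ (?N + 1))" for P
    unfolding emeasure_dyad by (subst ennreal_mult[symmetric]) (auto simp: side_pos less_imp_le)
  have qnot: "q \<notin> \<Q>"
  proof
    assume "q \<in> \<Q>"
    then have "ennreal (1 / 2 ^ (?N + 1)) * emeasure lebesgue (dyad q) < emeasure lebesgue (dyad q \<inter> U)" by (simp add: \<Q>_def)
    also have "\<dots> \<le> ennreal (1 / 2 ^ (?N + 2)) * emeasure lebesgue (dyad q)" using small by (simp add: Int_commute)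
    also have "\<dots> \<le> ennreal (1 / 2 ^ (?N + 1)) * emeasure lebesgue (dyad q)"
      by (intro mult_right_mono ennreal_leI divide_left_mono) auto
    finally show False by simp
  qed
  have lt: "fst q < fst P" if "P \<in> \<Q>" for P
  proof (rule ccontr)
    assume "\<not> fst q < fst P"
    then have eq: "fst P = fst q" using that by (simp add: \<Q>_def)
    obtain x where x: "x \<in> dyad P" using dyad_nonempty by blast
    then have "x \<in> dyad q" using that by (auto simp: \<Q>_def)
    then have "P = q" using x eq mem_dyad_iff_coord[of x P] mem_dyad_iff_coord[of x q] by simp
    then show False using qnot that by simp
  qed
  show thesis
  proof (rule that[of \<P>])
    show "fst q < fst P" "dyad P \<subseteq> dyad q" if "P \<in> \<P>" for P using that lt[of P] by (auto simp: \<P>_def \<Q>_def)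
    show "disjoint_family_on dyad \<P>" by (rule max(2))
    show "U \<inter> dyad q \<subseteq> (\<Union>P\<in>\<P>. dyad P)"
    proof
      fix x assume x: "x \<in> U \<inter> dyad q"
      obtain k where k: "fst q \<le> k" "dyad (coord x k) \<subseteq> U" using small_dyad_in_open[OF O, of x "fst q"] x by blast
      have "dyad q \<inter> dyad (coord x k) \<noteq> {}" using mem_dyad_coord[of x k] x by auto
      then have sub: "dyad (coord x k) \<subseteq> dyad q" using k(1) by (intro nest) (auto simp: coord_def)
      have "ennreal (side k ^ ?N / 2 ^ (?N + 1)) < ennreal (side k ^ ?N)"
      proof (rule ennreal_lessI)
        have "side k ^ ?N * 1 < side k ^ ?N * 2 ^ (?N + 1)"
          using side_pos[of k] by (intro mult_strict_left_mono one_less_power) auto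
        then show "side k ^ ?N / 2 ^ (?N + 1) < side k ^ ?N" by (simp add: divide_less_eq)
      qed (simp add: side_pos)
      then have "coord x k \<in> \<Q>"
        using k sub meq[of "coord x k"] by (simp add: \<Q>_def Int_absorb2 emeasure_dyad coord_def del: emeasure_completion)
      then obtain M where "M \<in> \<P>" "dyad (coord x k) \<subseteq> dyad M" using max(1) by blast
      then show "x \<in> (\<Union>P\<in>\<P>. dyad P)" using mem_dyad_coord[of x k] by blast
    qed
    show "emeasure lebesgue (\<Union>P\<in>\<P>. dyad P) \<le> ennreal (1 / 2) * emeasure lebesgue (dyad q)"
    proof -
      let ?D = "density lebesgue (indicator U)"
      have ed: "emeasure ?D A = emeasure lebesgue (A \<inter> U)" if "A \<in> sets lebesgue" for A
        using that by (subst emeasure_density) (auto simp: indicator_inter_arith[symmetric] Int_commute)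
      have "emeasure lebesgue (\<Union>P\<in>\<P>. dyad P) \<le> ennreal (2 ^ (?N + 1)) * emeasure ?D (\<Union>P\<in>\<P>. dyad P)"
      proof (rule emeasure_UN_disjoint_le)
        show "countable \<P>" by (rule countableI_type)
        fix P assume "P \<in> \<P>"
        then have "ennreal (1 / 2 ^ (?N + 1)) * emeasure lebesgue (dyad P) \<le> emeasure lebesgue (dyad P \<inter> U)"
          by (auto simp: \<P>_def \<Q>_def)
        then have "ennreal (2 ^ (?N + 1)) * (ennreal (1 / 2 ^ (?N + 1)) * emeasure lebesgue (dyad P)) \<le> ennreal (2 ^ (?N + 1)) * emeasure ?D (dyad P)"
          by (intro mult_left_mono) (auto simp: ed)
        also have "ennreal (2 ^ (?N + 1)) * (ennreal (1 / 2 ^ (?N + 1)) * emeasure lebesgue (dyad P)) = emeasure lebesgue (dyad P)"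
          by (subst mult.assoc[symmetric], subst ennreal_mult[symmetric]) auto
        finally show "emeasure lebesgue (dyad P) \<le> ennreal (2 ^ (?N + 1)) * emeasure ?D (dyad P)" .
      qed (use max(2) in auto)
      also have "emeasure ?D (\<Union>P\<in>\<P>. dyad P) = emeasure lebesgue ((\<Union>P\<in>\<P>. dyad P) \<inter> U)"
        by (rule ed) (auto intro!: sets.countable_UN' countableI_type)
      also have "\<dots> \<le> emeasure lebesgue (U \<inter> dyad q)"
        by (intro emeasure_mono) (auto simp: \<P>_def \<Q>_def)
      also have "\<dots> \<le> ennreal (1 / 2 ^ (?N + 2)) * emeasure lebesgue (dyad q)" by (rule small)
      finally have "emeasure lebesgue (\<Union>P\<in>\<P>. dyad P) \<le> ennreal (2 ^ (?N + 1)) * (ennreal (1 / 2 ^ (?N + 2)) * emeasure lebesgue (dyad q))"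
        by (simp add: mult_left_mono del: emeasure_completion)
      also have "\<dots> = ennreal (1 / 2) * emeasure lebesgue (dyad q)"
        by (subst mult.assoc[symmetric], subst ennreal_mult[symmetric]) auto
      finally show ?thesis .
    qed
    show "ennreal (1 / 2) * emeasure lebesgue (dyad P) \<le> emeasure lebesgue (dyad P - U)" if P: "P \<in> \<P>" for P
    proof -
      have PQ: "P \<in> \<Q>" using P by (simp add: \<P>_def)
      have pos: "0 < fst P" using lt[OF PQ] by simp
      note par = dyad_parent[OF pos]
      have "parent P \<notin> \<Q>"
      proof
        assume "parent P \<in> \<Q>"
        then have "parent P = P" using P par(2) by (auto simp: \<P>_def)
        then show False using par(1) pos by simp
      qed
      moreover have "fst q \<le> fst (parent P)" using lt[OF PQ] par(1) by simp
      moreover have "dyad (parent P) \<subseteq> dyad q"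
      proof (rule nest)
        show "fst q \<le> fst (parent P)" by fact
        have "dyad P \<subseteq> dyad q" using PQ by (simp add: \<Q>_def)
        then show "dyad q \<inter> dyad (parent P) \<noteq> {}" using dyad_nonempty[of P] par(2) by blast
      qed
      ultimately have "emeasure lebesgue (dyad (parent P) \<inter> U) \<le> ennreal (1 / 2 ^ (?N + 1)) * emeasure lebesgue (dyad (parent P))"
        by (auto simp: \<Q>_def not_less)
      also have "\<dots> = ennreal (1 / 2 ^ (?N + 1)) * ennreal (2 ^ ?N) * emeasure lebesgue (dyad P)"
        unfolding par(3) by (simp add: mult.assoc ennreal_power[symmetric] del: emeasure_completion)
      also have "ennreal (1 / 2 ^ (?N + 1)) * ennreal (2 ^ ?N) = ennreal (1 / 2)"
        by (subst ennreal_mult[symmetric]) auto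
      finally have "emeasure lebesgue (dyad (parent P) \<inter> U) \<le> ennreal (1 / 2) * emeasure lebesgue (dyad P)" .
      then have "emeasure lebesgue (dyad P \<inter> U) \<le> ennreal (1 / 2) * emeasure lebesgue (dyad P)"
        using par(2) by (intro order_trans[OF emeasure_mono[of "dyad P \<inter> U" "dyad (parent P) \<inter> U"]]) auto
      moreover have "emeasure lebesgue (dyad P) = emeasure lebesgue (dyad P \<inter> U) + emeasure lebesgue (dyad P - U)"
        by (subst plus_emeasure) (auto simp only: Int_Diff_Un sets.Int sets.Diff sets_dyad_trip U)
      ultimately have le: "emeasure lebesgue (dyad P) \<le> ennreal (1 / 2) * emeasure lebesgue (dyad P) + emeasure lebesgue (dyad P - U)"
        by (metis add_right_mono)
      define b where "b = emeasure lebesgue (dyad P - U)"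
      define m where "m = side (fst P) ^ ?N"
      have m: "0 \<le> m" by (simp add: m_def side_pos less_imp_le)
      have half: "ennreal (1 / 2) * ennreal m = ennreal (m / 2)"
        using m by (subst ennreal_mult[symmetric]) auto
      have "ennreal (m / 2 + m / 2) \<le> b + ennreal (m / 2)"
        using le unfolding b_def[symmetric] emeasure_dyad m_def[symmetric] half by (simp add: add.commute)
      then have "ennreal (m / 2) \<le> b" by (rule ennreal_le_of_add_le) (use m in simp)
      then show ?thesis unfolding b_def[symmetric] emeasure_dyad m_def[symmetric] half .
    qed
  qed
qed

end

section \<open>Sparse domination\<close>

lemma restrict_fun_measurable [measurable]:
  fixes g :: "real ^ 'n \<Rightarrow> 'b::{real_normed_vector, second_countable_topology}"
  assumes [measurable]: "A \<in> sets lebesgue" "g \<in> borel_measurable lebesgue"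
  shows "restrict_fun A g \<in> borel_measurable lebesgue"
  unfolding restrict_fun_def by measurable

lemma restrict_fun_Lp_c:
  fixes g :: "real ^ 'n \<Rightarrow> 'b::{real_normed_vector, second_countable_topology}"
  assumes "g \<in> Lp_c p" "A \<in> sets lebesgue"
  shows "restrict_fun A g \<in> Lp_c p"
proof -
  have "g \<in> borel_measurable lebesgue" "bounded {x. g x \<noteq> 0}" using assms by (auto simp: Lp_c_def)
  moreover have "(\<integral>\<^sup>+x. ennreal (norm (restrict_fun A g x) powr p) \<partial>lebesgue) < \<infinity>"
  proof -
    have "(\<integral>\<^sup>+x. ennreal (norm (restrict_fun A g x) powr p) \<partial>lebesgue) \<le> (\<integral>\<^sup>+x. ennreal (norm (g x) powr p) \<partial>lebesgue)"
      by (intro nn_integral_mono) (auto simp: restrict_fun_def indicator_def)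
    also have "\<dots> < \<infinity>" using assms by (simp add: Lp_c_def)
    finally show ?thesis .
  qed
  moreover have "{x. restrict_fun A g x \<noteq> 0} \<subseteq> {x. g x \<noteq> 0}" by (auto simp: restrict_fun_def)
  ultimately show ?thesis
    using assms(2) by (auto simp: Lp_c_def intro: bounded_subset)
qed

lemma restrict_fun_restrict_fun: "restrict_fun A (restrict_fun B g) = restrict_fun (A \<inter> B) g"
  by (auto simp: restrict_fun_def indicator_def fun_eq_iff)

lemma sublinear_on_diff:
  fixes T :: "(real ^ 'n \<Rightarrow> 'b) \<Rightarrow> real ^ 'n \<Rightarrow> 'b::{real_normed_field, euclidean_space}"
  assumes sub: "sublinear_on (Lp_c p) T" and g: "g \<in> Lp_c p" and A: "A \<in> sets lebesgue"
  shows "AE x in lebesgue. norm (T g x) \<le> norm (T (restrict_fun A g) x) + norm (T (restrict_fun (- A) g) x)"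
    and "AE x in lebesgue. norm (T (restrict_fun (- A) g) x) \<le> norm (T g x) + norm (T (restrict_fun A g) x)"
proof -
  have cA: "- A \<in> sets lebesgue" using A by (simp only: Compl_in_sets_lebesgue)
  let ?r = "restrict_fun A g" and ?r' = "restrict_fun (- A) g"
  have r: "?r \<in> Lp_c p" "?r' \<in> Lp_c p" using restrict_fun_Lp_c[OF g] A cA by auto
  have m: "(\<lambda>y. - 1 * ?r y) \<in> Lp_c p" using r(1) by (simp add: Lp_c_def)
  have g1: "(\<lambda>y. ?r y + ?r' y) = g" and g2: "(\<lambda>y. g y + - 1 * ?r y) = ?r'"
    by (auto simp: restrict_fun_def indicator_def fun_eq_iff)
  have add: "AE x in lebesgue. norm (T (\<lambda>y. a y + b y) x) \<le> norm (T a x) + norm (T b x)"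
    if "a \<in> Lp_c p" "b \<in> Lp_c p" for a b
    using sub[unfolded sublinear_on_def, THEN conjunct2, THEN conjunct1, rule_format, OF that] .
  show "AE x in lebesgue. norm (T g x) \<le> norm (T ?r x) + norm (T ?r' x)"
    using add[OF r] unfolding g1 .
  note 1 = add[OF g m]
  note 2 = sub[unfolded sublinear_on_def, THEN conjunct2, THEN conjunct2, rule_format, OF r(1), of "- 1"]
  from 1 2 show "AE x in lebesgue. norm (T ?r' x) \<le> norm (T g x) + norm (T ?r x)"
    unfolding g2 by eventually_elim simp
qed

text \<open>\<open>cT\<close> and \<open>cM\<close> are the values at a small number \<open>\<tau>\<close> of the functions \<open>\<phi>\<close> in the weak bounds of \<open>T\<close> and of
  its sharp maximal truncation, so that the exceptional sets fill only a small part of a cube.\<close>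

locale dyadic_operator = dyadic_grid x0 L for x0 :: "real ^ 'n" and L +
  fixes T :: "(real ^ 'n \<Rightarrow> 'b) \<Rightarrow> real ^ 'n \<Rightarrow> 'b::{real_normed_field, euclidean_space}"
    and p0 \<alpha> e \<tau> cT cM :: real and s :: ereal and f :: "real ^ 'n \<Rightarrow> 'b"
  assumes p0: "1 \<le> p0" and \<alpha>: "0 \<le> \<alpha>" and s: "1 < s" and e: "e = real_of_ereal (1 / s)"
    and sub: "sublinear_on (Lp_c p0) T"
    and \<tau>: "0 < \<tau>" "\<tau> * 3 ^ CARD('n) * 2 ^ (CARD('n) + 5) \<le> 1"
    and cT0: "0 \<le> cT" and cM0: "0 \<le> cM"
    and weakT: "\<And>c l g. 0 < l \<Longrightarrow> set_borel_measurable lebesgue (cube c l) g \<Longrightarrow>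
          (\<integral>\<^sup>+x\<in>cube c l. ennreal (norm (g x) powr p0) \<partial>lebesgue) < \<infinity> \<Longrightarrow>
          emeasure lebesgue {x \<in> cube c l. ennreal (norm (T (restrict_fun (cube c l) g) x))
              > ennreal cT * avg p0 (cube c l) g * epowr (emeasure lebesgue (cube c l)) (\<alpha> / real CARD('n))}
            \<le> ennreal \<tau> * emeasure lebesgue (cube c l)"
    and weakM: "\<And>c l g. 0 < l \<Longrightarrow> set_borel_measurable lebesgue (cube c l) g \<Longrightarrow>
          (\<integral>\<^sup>+x\<in>cube c l. ennreal (norm (g x) powr p0) \<partial>lebesgue) < \<infinity> \<Longrightarrow>
          emeasure lebesgue {x \<in> cube c l. sharp_grand_maximal T s (restrict_fun (cube c l) g) x
              > ennreal cM * avg p0 (cube c l) g * epowr (emeasure lebesgue (cube c l)) (\<alpha> / real CARD('n))}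
            \<le> ennreal \<tau> * emeasure lebesgue (cube c l)"
    and f: "f \<in> Lp_c p0"
begin

section \<open>Exceptional sets of a cube of the grid\<close>

definition vol :: "nat \<times> (int ^ 'n) \<Rightarrow> real" where
  "vol q = side (fst q) ^ CARD('n)"

definition mass :: "nat \<times> (int ^ 'n) \<Rightarrow> real" where
  "mass q = enn2real (\<integral>\<^sup>+x\<in>trip q. ennreal (norm (f x) powr p0) \<partial>lebesgue)"

text \<open>\<open>amp q\<close> is \<open>\<bar>3Q\<bar> ^ (\<alpha> / n) \<langle>\<bar>f\<bar>\<rangle>\<^bsub>p0, 3Q\<^esub>\<close> for the cube \<open>Q\<close> with index \<open>q\<close>.\<close>

definition amp :: "nat \<times> (int ^ 'n) \<Rightarrow> real" where
  "amp q = (3 ^ CARD('n) * vol q) powr (\<alpha> / real CARD('n)) * (mass q / (3 ^ CARD('n) * vol q)) powr (1 / p0)"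

definition loc :: "nat \<times> (int ^ 'n) \<Rightarrow> real ^ 'n \<Rightarrow> 'b" where
  "loc q = restrict_fun (trip q) f"

lemma vol_pos: "0 < vol q"
  by (simp add: vol_def side_pos)

lemma emeasure_dyad_vol: "emeasure lebesgue (dyad q) = ennreal (vol q)"
  by (simp only: vol_def emeasure_dyad)

lemma emeasure_trip_vol: "emeasure lebesgue (trip q) = ennreal (3 ^ CARD('n) * vol q)"
  by (simp only: vol_def emeasure_trip power_mult_distrib)

lemma f_meas [measurable]: "f \<in> borel_measurable lebesgue"
  using f by (simp add: Lp_c_def)

lemma mass_nonneg: "0 \<le> mass q"
  by (simp add: mass_def)

lemma nn_integral_mass_fin: "(\<integral>\<^sup>+x\<in>A. ennreal (norm (f x) powr p0) \<partial>lebesgue) < \<infinity>"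
proof -
  have "(\<integral>\<^sup>+x\<in>A. ennreal (norm (f x) powr p0) \<partial>lebesgue) \<le> (\<integral>\<^sup>+x. ennreal (norm (f x) powr p0) \<partial>lebesgue)"
    by (intro nn_integral_mono) (auto simp: indicator_def)
  also have "\<dots> < \<infinity>" using f by (simp add: Lp_c_def)
  finally show ?thesis .
qed

lemma nn_integral_mass: "(\<integral>\<^sup>+x\<in>trip q. ennreal (norm (f x) powr p0) \<partial>lebesgue) = ennreal (mass q)"
  using nn_integral_mass_fin[of "trip q"] by (simp add: mass_def)

lemma amp_nonneg: "0 \<le> amp q"
  by (simp add: amp_def)

lemma threshold:
  assumes "0 \<le> k"
  shows "ennreal k * avg p0 (trip q) f * epowr (emeasure lebesgue (trip q)) (\<alpha> / real CARD('n)) = ennreal (k * amp q)"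
proof -
  define m where "m = 3 ^ CARD('n) * vol q"
  have m: "0 < m" using vol_pos by (simp add: m_def)
  have 1: "avg p0 (trip q) f = ennreal ((mass q / m) powr (1 / p0))"
    unfolding avg_def nn_integral_mass emeasure_trip_vol m_def[symmetric]
    using m mass_nonneg[of q] p0 by (subst divide_ennreal) (auto intro!: epowr_ennreal)
  have 2: "epowr (emeasure lebesgue (trip q)) (\<alpha> / real CARD('n)) = ennreal (m powr (\<alpha> / real CARD('n)))"
    unfolding emeasure_trip_vol m_def[symmetric] using m \<alpha> by (cases "\<alpha> = 0") (auto simp: epowr_def)
  show ?thesis
    unfolding 1 2 amp_def m_def[symmetric] using assms by (simp add: ennreal_mult[symmetric] mult_ac)
qed

lemma loc_meas [measurable]: "loc q \<in> borel_measurable lebesgue"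
  unfolding loc_def by measurable

lemma loc_Lp: "loc q \<in> Lp_c p0"
  unfolding loc_def by (intro restrict_fun_Lp_c f) simp

lemma T_meas: "g \<in> Lp_c p0 \<Longrightarrow> T g \<in> borel_measurable lebesgue"
  using sub unfolding sublinear_on_def by blast

lemma T_loc_meas [measurable]: "T (loc q) \<in> borel_measurable lebesgue"
  by (intro T_meas loc_Lp)

lemma set_borel_measurable_f: "set_borel_measurable lebesgue A f" if [measurable]: "A \<in> sets lebesgue" for A
  unfolding set_borel_measurable_def by measurable

definition large_T :: "nat \<times> (int ^ 'n) \<Rightarrow> (real ^ 'n) set" where
  "large_T q = {x \<in> trip q. cT * amp q < norm (T (loc q) x)}"

definition large_sharp :: "nat \<times> (int ^ 'n) \<Rightarrow> (real ^ 'n) set" where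
  "large_sharp q = {x \<in> trip q. ennreal (cM * amp q) < sharp_grand_maximal T s (loc q) x}"

lemma large_T_sets [measurable]: "large_T q \<in> sets lebesgue"
proof -
  have "large_T q = trip q \<inter> {x \<in> space lebesgue. cT * amp q < norm (T (loc q) x)}" by (auto simp: large_T_def)
  also have "\<dots> \<in> sets lebesgue" by measurable
  finally show ?thesis .
qed

lemma emeasure_large_T: "emeasure lebesgue (large_T q) \<le> ennreal (\<tau> * (3 ^ CARD('n) * vol q))"
proof -
  have "large_T q = {x \<in> cube (centre q) (3 * side (fst q)). ennreal (norm (T (restrict_fun (cube (centre q) (3 * side (fst q))) f) x))
     > ennreal cT * avg p0 (cube (centre q) (3 * side (fst q))) f * epowr (emeasure lebesgue (cube (centre q) (3 * side (fst q)))) (\<alpha> / real CARD('n))}"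
    unfolding trip_def[symmetric] threshold[OF cT0] large_T_def loc_def
    using cT0 amp_nonneg by (auto simp: ennreal_less_iff)
  also have "emeasure lebesgue \<dots> \<le> ennreal \<tau> * emeasure lebesgue (trip q)"
    unfolding trip_def
    using side_pos nn_integral_mass_fin by (intro weakT set_borel_measurable_f) auto
  also have "\<dots> = ennreal (\<tau> * (3 ^ CARD('n) * vol q))"
    unfolding emeasure_trip_vol by (rule ennreal_mult'[symmetric]) (use \<tau> in auto)
  finally show ?thesis .
qed

text \<open>The sharp maximal function exceeds a level exactly on the union of the cubes whose
  oscillation does. This union is uncountable, hence the need for
  \<open>sets_lebesgue_Union_cubes\<close>.\<close>

lemma large_sharp_sets [measurable]: "large_sharp q \<in> sets lebesgue"
proof -
  have "large_sharp q = trip q \<inter> (\<Union>(c, l)\<in>{(c, l). 0 < l \<and>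
     ennreal (cM * amp q) < osc s (T (restrict_fun (- cube c (3 * l)) (loc q))) (cube c l)}. cube c l)"
    unfolding large_sharp_def sharp_grand_maximal_def by (auto simp: less_SUP_iff)
  also have "\<dots> \<in> sets lebesgue" by (intro sets.Int sets_dyad_trip sets_lebesgue_Union_cubes)
  finally show ?thesis .
qed

lemma emeasure_large_sharp: "emeasure lebesgue (large_sharp q) \<le> ennreal (\<tau> * (3 ^ CARD('n) * vol q))"
proof -
  have "large_sharp q = {x \<in> cube (centre q) (3 * side (fst q)). sharp_grand_maximal T s (restrict_fun (cube (centre q) (3 * side (fst q))) f) x
     > ennreal cM * avg p0 (cube (centre q) (3 * side (fst q))) f * epowr (emeasure lebesgue (cube (centre q) (3 * side (fst q)))) (\<alpha> / real CARD('n))}"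
    unfolding trip_def[symmetric] threshold[OF cM0] large_sharp_def loc_def ..
  also have "emeasure lebesgue \<dots> \<le> ennreal \<tau> * emeasure lebesgue (trip q)"
    unfolding trip_def
    using side_pos nn_integral_mass_fin by (intro weakM set_borel_measurable_f) auto
  also have "\<dots> = ennreal (\<tau> * (3 ^ CARD('n) * vol q))"
    unfolding emeasure_trip_vol by (rule ennreal_mult'[symmetric]) (use \<tau> in auto)
  finally show ?thesis .
qed

definition residues_set :: "(int ^ 'n) set" where
  "residues_set = {v. \<forall>i. v $ i \<in> {0..2}}"

text \<open>Each residue class contributes at most 3^n vol q / \<open>avg_ratio\<close> to the
  measure of \<open>large_avg q\<close>; the choice makes the total vol q / 2^(n+4).\<close>

definition avg_ratio :: real where
  "avg_ratio = real (card residues_set) * 3 ^ CARD('n) * 2 ^ (CARD('n) + 4)"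

text \<open>The average of |f|^p0 over the triple of P exceeds \<open>avg_ratio\<close> times the
  average over the triple of q; the denominators are cleared and the factors 3^n cancelled.\<close>

definition bad :: "nat \<times> (int ^ 'n) \<Rightarrow> nat \<times> (int ^ 'n) \<Rightarrow> bool" where
  "bad q P \<longleftrightarrow> fst q \<le> fst P \<and> dyad P \<subseteq> dyad q \<and> avg_ratio * vol P * mass q < mass P * vol q"

definition large_avg :: "nat \<times> (int ^ 'n) \<Rightarrow> (real ^ 'n) set" where
  "large_avg q = (\<Union>P\<in>{P. bad q P}. dyad P)"

lemma card_residues_set: "1 \<le> card residues_set"
proof -
  have "0 \<in> residues_set" by (simp add: residues_set_def)
  moreover have "finite residues_set" using finite_residues by (simp only: residues_set_def)
  ultimately have "0 < card residues_set" unfolding card_gt_0_iff by blast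
  then show ?thesis by simp
qed

lemma avg_ratio: "1 \<le> avg_ratio"
proof -
  have "1 * 1 * 1 \<le> real (card residues_set) * 3 ^ CARD('n) * 2 ^ (CARD('n) + 4)"
    using card_residues_set by (intro mult_mono one_le_power) auto
  then show ?thesis by (simp add: avg_ratio_def)
qed

lemma large_avg_sets [measurable]: "large_avg q \<in> sets lebesgue"
  unfolding large_avg_def by (intro sets.countable_UN' countableI_type) auto

lemma mass_mono: "trip P \<subseteq> trip q \<Longrightarrow> mass P \<le> mass q"
proof -
  assume "trip P \<subseteq> trip q"
  then have "(\<integral>\<^sup>+x\<in>trip P. ennreal (norm (f x) powr p0) \<partial>lebesgue) \<le> (\<integral>\<^sup>+x\<in>trip q. ennreal (norm (f x) powr p0) \<partial>lebesgue)"
    by (intro nn_integral_mono) (auto simp: indicator_def)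
  then show ?thesis using mass_nonneg by (simp add: nn_integral_mass)
qed

text \<open>A weak (1,1) bound for the dyadic maximal function over triples. Triples of different
  bad cubes overlap, so in each residue class the maximal triples are taken; these are disjoint and
  lie in \<open>trip q\<close>, and their masses add up to at most \<open>mass q\<close>.\<close>

lemma emeasure_large_avg: "emeasure lebesgue (large_avg q) \<le> ennreal (vol q / 2 ^ (CARD('n) + 4))"
proof (cases "\<exists>P. bad q P")
  case False
  then have "large_avg q = {}" unfolding large_avg_def by blast
  then show ?thesis by simp
next
  case True
  then obtain P0 where P0: "bad q P0" by blast
  have sub: "trip P \<subseteq> trip q" if "bad q P" for P
  proof (rule dyad_nested(2))
    show "fst q \<le> fst P" using that by (simp add: bad_def)
    show "dyad q \<inter> dyad P \<noteq> {}" using that dyad_nonempty[of P] by (auto simp: bad_def)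
  qed
  have mq: "0 < mass q"
  proof -
    have "0 \<le> avg_ratio * vol P0 * mass q" using avg_ratio vol_pos[of P0] mass_nonneg[of q] by simp
    then have "0 < mass P0 * vol q" using P0 by (simp add: bad_def)
    then have "0 < mass P0" using vol_pos[of q] by (simp add: zero_less_mult_iff)
    then show ?thesis using mass_mono[OF sub[OF P0]] by simp
  qed
  define \<nu> where "\<nu> = density lebesgue (\<lambda>x. ennreal (norm (f x) powr p0))"
  have \<nu>: "emeasure \<nu> A = (\<integral>\<^sup>+x\<in>A. ennreal (norm (f x) powr p0) \<partial>lebesgue)" if "A \<in> sets lebesgue" for A
    unfolding \<nu>_def using that by (subst emeasure_density) auto
  define K where "K = 3 ^ CARD('n) * vol q / (avg_ratio * mass q)"
  have K0: "0 \<le> K" using avg_ratio mq vol_pos[of q] by (simp add: K_def)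
  define \<M> where "\<M> = (\<lambda>r. {P \<in> {P. bad q P \<and> residue P = r}. \<forall>P'\<in>{P. bad q P \<and> residue P = r}. trip P \<subseteq> trip P' \<longrightarrow> P' = P})"
  have max1: "\<exists>M\<in>\<M> r. trip P \<subseteq> trip M" if "bad q P" "residue P = r" for P r
    unfolding \<M>_def
    by (rule maximal_indices(1)[OF trip_nested trip_nonempty inj_on_subset[OF inj_trip subset_UNIV]]) (use that in auto)
  have max2: "disjoint_family_on trip (\<M> r)" for r
    unfolding \<M>_def
    by (rule maximal_indices(2)[OF trip_nested trip_nonempty inj_on_subset[OF inj_trip subset_UNIV]]) auto
  have part: "emeasure lebesgue (\<Union>P\<in>\<M> r. trip P) \<le> ennreal (3 ^ CARD('n) * vol q / avg_ratio)" for r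
  proof -
    have "emeasure lebesgue (\<Union>P\<in>\<M> r. trip P) \<le> ennreal K * emeasure \<nu> (\<Union>P\<in>\<M> r. trip P)"
    proof (rule emeasure_UN_disjoint_le)
      show "disjoint_family_on trip (\<M> r)" by (rule max2)
      show "sets \<nu> = sets lebesgue" by (simp add: \<nu>_def)
      show "countable (\<M> r)" by (rule countableI_type)
      fix P assume "P \<in> \<M> r"
      then have "avg_ratio * vol P * mass q < mass P * vol q" by (auto simp: \<M>_def bad_def)
      then have "vol P \<le> vol q / (avg_ratio * mass q) * mass P"
        using avg_ratio mq by (simp add: field_simps)
      then have "3 ^ CARD('n) * vol P \<le> 3 ^ CARD('n) * (vol q / (avg_ratio * mass q) * mass P)" by (intro mult_left_mono) auto
      then have "3 ^ CARD('n) * vol P \<le> K * mass P" by (simp add: K_def)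
      then have "ennreal (3 ^ CARD('n) * vol P) \<le> ennreal K * ennreal (mass P)"
        using K0 by (subst ennreal_mult'[symmetric]) (auto intro: ennreal_leI)
      then show "emeasure lebesgue (trip P) \<le> ennreal K * emeasure \<nu> (trip P)"
        by (simp only: emeasure_trip_vol \<nu>[OF sets_dyad_trip(2)] nn_integral_mass)
    qed auto
    also have "emeasure \<nu> (\<Union>P\<in>\<M> r. trip P) \<le> emeasure \<nu> (trip q)"
      using sub by (intro emeasure_mono) (auto simp: \<M>_def \<nu>_def)
    also have "emeasure \<nu> (trip q) = ennreal (mass q)" by (simp only: \<nu>[OF sets_dyad_trip(2)] nn_integral_mass)
    finally have "emeasure lebesgue (\<Union>P\<in>\<M> r. trip P) \<le> ennreal K * ennreal (mass q)"
      by (simp add: mult_left_mono del: emeasure_completion)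
    also have "\<dots> = ennreal (3 ^ CARD('n) * vol q / avg_ratio)"
      using K0 mq by (subst ennreal_mult'[symmetric]) (auto simp: K_def)
    finally show ?thesis .
  qed
  have fin: "finite residues_set" using finite_residues by (simp add: residues_set_def)
  have "large_avg q \<subseteq> (\<Union>r\<in>residues_set. \<Union>P\<in>\<M> r. trip P)"
  proof
    fix x assume "x \<in> large_avg q"
    then obtain P where P: "bad q P" "x \<in> dyad P" by (auto simp: large_avg_def)
    obtain M where M: "M \<in> \<M> (residue P)" "trip P \<subseteq> trip M"
      using max1[OF P(1) refl] by blast
    moreover have "x \<in> trip P" using P(2) dyad_subset_trip by blast
    moreover have "residue P \<in> residues_set" using residue_range by (simp add: residues_set_def)
    ultimately show "x \<in> (\<Union>r\<in>residues_set. \<Union>P\<in>\<M> r. trip P)" by blast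
  qed
  then have "emeasure lebesgue (large_avg q) \<le> emeasure lebesgue (\<Union>r\<in>residues_set. \<Union>P\<in>\<M> r. trip P)"
    using fin by (intro emeasure_mono sets.finite_UN sets.countable_UN' countableI_type) auto
  also have "\<dots> \<le> (\<Sum>r\<in>residues_set. emeasure lebesgue (\<Union>P\<in>\<M> r. trip P))"
    by (intro emeasure_subadditive_finite fin) (auto intro!: sets.countable_UN' countableI_type)
  also have "\<dots> \<le> (\<Sum>r\<in>residues_set. ennreal (3 ^ CARD('n) * vol q / avg_ratio))" by (intro sum_mono part)
  also have "\<dots> = ennreal (\<Sum>r\<in>residues_set. 3 ^ CARD('n) * vol q / avg_ratio)"
    using avg_ratio vol_pos[of q] by (intro sum_ennreal) auto
  also have "(\<Sum>r\<in>residues_set. 3 ^ CARD('n) * vol q / avg_ratio) = vol q / 2 ^ (CARD('n) + 4)"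
    using card_residues_set by (simp add: avg_ratio_def)
  finally show ?thesis .
qed


section \<open>The stopping step\<close>

lemma e01: "0 \<le> e" "e < 1"
proof -
  show "0 \<le> e" using s unfolding e by (intro real_of_ereal_inverse_nonneg) (auto intro: less_trans[of 0 1])
  show "e < 1" using s unfolding e by (cases s) (auto simp: one_ereal_def)
qed

text \<open>4 cM comes from the oscillation of h, with the 4 of a good set filling a quarter of the
  cube; cT and cT * \<open>avg_ratio\<close> bound h on that set through \<open>T\<close> on the
  large and on the small triple.\<close>

definition step_const :: real where
  "step_const = 4 * cM + (cT + cT * avg_ratio)"

lemma step_const_nonneg: "0 \<le> step_const"
  using cT0 cM0 avg_ratio by (simp add: step_const_def)

lemma amp_le:
  assumes "trip P \<subseteq> trip q" "mass P * vol q \<le> avg_ratio * vol P * mass q" "vol P \<le> vol q"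
  shows "amp P \<le> avg_ratio * amp q"
proof -
  let ?k = "3 ^ CARD('n) :: real"
  have v: "0 < vol P" "0 < vol q" using vol_pos by auto
  have C30: "0 \<le> avg_ratio" using avg_ratio by simp
  have "mass P / (?k * vol P) \<le> avg_ratio * (mass q / (?k * vol q))"
    using assms(2) v by (simp add: field_simps)
  then have "(mass P / (?k * vol P)) powr (1 / p0) \<le> (avg_ratio * (mass q / (?k * vol q))) powr (1 / p0)"
    using p0 v mass_nonneg by (intro powr_mono2) auto
  also have "\<dots> = avg_ratio powr (1 / p0) * (mass q / (?k * vol q)) powr (1 / p0)"
    by (rule powr_mult)
  also have "\<dots> \<le> avg_ratio * (mass q / (?k * vol q)) powr (1 / p0)"
  proof (rule mult_right_mono)
    have "avg_ratio powr (1 / p0) \<le> avg_ratio powr 1" using avg_ratio p0 by (intro powr_mono) auto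
    then show "avg_ratio powr (1 / p0) \<le> avg_ratio" using C30 by simp
  qed simp
  finally have "(mass P / (?k * vol P)) powr (1 / p0) \<le> avg_ratio * (mass q / (?k * vol q)) powr (1 / p0)" .
  moreover have "(?k * vol P) powr (\<alpha> / real CARD('n)) \<le> (?k * vol q) powr (\<alpha> / real CARD('n))"
    using v assms(3) \<alpha> by (intro powr_mono2) auto
  ultimately have "amp P \<le> (?k * vol q) powr (\<alpha> / real CARD('n)) * (avg_ratio * (mass q / (?k * vol q)) powr (1 / p0))"
    unfolding amp_def by (intro mult_mono) auto
  then show ?thesis by (simp add: amp_def mult_ac)
qed

text \<open>The point z lies outside \<open>large_sharp q\<close> and outside
  \<open>large_avg q\<close>, so it bounds the oscillation of h on P and compares
  \<open>amp P\<close> with \<open>amp q\<close>. On D both \<open>T (loc q)\<close> and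
  \<open>T (loc P)\<close> are below their thresholds, hence so is h up to a constant. D keeps a
  quarter of P: half of P lies outside U, and \<open>large_T P\<close> takes away at most a
  quarter.\<close>

lemma child_step:
  fixes G :: "real ^ 'n \<Rightarrow> real"
  assumes P: "fst q < fst P" "dyad P \<subseteq> dyad q"
    and z: "z \<in> dyad P" "z \<notin> large_sharp q" "z \<notin> large_avg q"
    and U [measurable]: "U \<in> sets lebesgue" and U1: "large_T q \<subseteq> U"
    and half: "ennreal (1 / 2) * emeasure lebesgue (dyad P) \<le> emeasure lebesgue (dyad P - U)"
    and G [measurable]: "G \<in> borel_measurable lebesgue" and G0: "\<And>x. 0 \<le> G x"
    and J: "(\<integral>\<^sup>+x\<in>dyad P. ennreal (G x powr (1 / (1 - e))) \<partial>lebesgue) \<le> ennreal J" "0 \<le> J"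
  shows "(\<integral>\<^sup>+x\<in>dyad P. ennreal (norm (T (loc q) x) * G x) \<partial>lebesgue)
    \<le> (\<integral>\<^sup>+x\<in>dyad P. ennreal (norm (T (loc P) x) * G x) \<partial>lebesgue)
       + ennreal (step_const * amp q * (vol P powr e * J powr (1 - e)))"
proof -
  let ?k = "3 ^ CARD('n) :: real"
  define g where "g = restrict_fun (- trip P) (loc q)"
  define h where "h = T g"
  have trip: "trip P \<subseteq> trip q"
  proof (rule dyad_nested(2))
    show "fst q \<le> fst P" using P by simp
    show "dyad q \<inter> dyad P \<noteq> {}" using z(1) P(2) by auto
  qed
  have r: "restrict_fun (trip P) (loc q) = loc P"
    using trip by (simp add: loc_def restrict_fun_restrict_fun Int_absorb2)
  have c: "- trip P \<in> sets lebesgue" by (simp only: Compl_in_sets_lebesgue sets_dyad_trip)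
  have h [measurable]: "h \<in> borel_measurable lebesgue"
    unfolding h_def g_def by (intro T_meas restrict_fun_Lp_c loc_Lp c)
  have ae: "AE x in lebesgue. norm (T (loc q) x) \<le> norm (T (loc P) x) + norm (h x)"
    "AE x in lebesgue. norm (h x) \<le> norm (T (loc q) x) + norm (T (loc P) x)"
    using sublinear_on_diff[OF sub loc_Lp[of q] sets_dyad_trip(2)[of P]] unfolding r g_def[symmetric] h_def[symmetric] .
  have zq: "z \<in> trip q" using z(1) P(2) dyad_subset_trip by blast
  have osc: "osc s h (dyad P) \<le> ennreal (cM * amp q)"
  proof -
    have "osc s h (dyad P) \<le> sharp_grand_maximal T s (loc q) z"
      unfolding sharp_grand_maximal_def
      by (rule SUP_upper2[of "(centre P, side (fst P))"])
        (use z(1) side_pos in \<open>auto simp: dyad_def h_def g_def trip_def\<close>)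
    also have "\<dots> \<le> ennreal (cM * amp q)" using z(2) zq by (simp add: large_sharp_def not_less)
    finally show ?thesis .
  qed
  have volle: "vol P \<le> vol q"
  proof -
    have "emeasure lebesgue (dyad P) \<le> emeasure lebesgue (dyad q)" using P(2) by (intro emeasure_mono) auto
    then show ?thesis unfolding emeasure_dyad_vol using vol_pos[of q] by simp
  qed
  have "\<not> bad q P" using z(1,3) unfolding large_avg_def by blast
  then have amp: "amp P \<le> avg_ratio * amp q"
    using P trip volle by (intro amp_le) (auto simp: bad_def)
  \<comment> \<open>Sublinearity holds only almost everywhere, so the bound for h is part of the
    definition of D; the points where it fails form the null set N below.\<close>
  define D where "D = {x \<in> dyad P. x \<notin> U \<and> norm (T (loc P) x) \<le> cT * amp P \<and> norm (h x) \<le> norm (T (loc q) x) + norm (T (loc P) x)}"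
  define N where "N = {x \<in> space lebesgue. \<not> norm (h x) \<le> norm (T (loc q) x) + norm (T (loc P) x)}"
  have N [measurable]: "N \<in> sets lebesgue" unfolding N_def by measurable
  have "emeasure lebesgue N = 0" using ae(2) unfolding N_def by (subst (asm) AE_iff_measurable[OF N[unfolded N_def] refl]) auto
  have D [measurable]: "D \<in> sets lebesgue"
  proof -
    have "D = (dyad P - U) \<inter> {x \<in> space lebesgue. norm (T (loc P) x) \<le> cT * amp P \<and> norm (h x) \<le> norm (T (loc q) x) + norm (T (loc P) x)}"
      by (auto simp: D_def)
    also have "\<dots> \<in> sets lebesgue" by measurable
    finally show ?thesis .
  qed
  have D4: "ennreal (vol P / 4) \<le> emeasure lebesgue D"
  proof -
    have half': "ennreal (1 / 2) * emeasure lebesgue (dyad P) = ennreal (vol P / 2)"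
      unfolding emeasure_dyad_vol by (subst ennreal_mult[symmetric]) (auto simp: vol_pos less_imp_le)
    have "dyad P - U \<subseteq> D \<union> (large_T P \<union> N)"
      using dyad_subset_trip[of P] by (auto simp: D_def large_T_def N_def)
    then have "emeasure lebesgue (dyad P - U) \<le> emeasure lebesgue (D \<union> (large_T P \<union> N))"
      by (intro emeasure_mono) auto
    also have "\<dots> \<le> emeasure lebesgue D + (emeasure lebesgue (large_T P) + emeasure lebesgue N)"
      by (intro order_trans[OF emeasure_subadditive] add_left_mono) auto
    also have "\<dots> \<le> emeasure lebesgue D + ennreal (vol P / 4)"
    proof (rule add_left_mono)
      have "\<tau> * ?k \<le> 1 / 4"
      proof -
        have "\<tau> * ?k * 4 \<le> \<tau> * ?k * 2 ^ (CARD('n) + 5)"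
        proof (rule mult_left_mono)
          have "(2::real) ^ 2 \<le> 2 ^ (CARD('n) + 5)" by (rule power_increasing) auto
          then show "(4::real) \<le> 2 ^ (CARD('n) + 5)" by simp
        qed (use \<tau> in auto)
        then show ?thesis using \<tau>(2) by simp
      qed
      then have "\<tau> * (?k * vol P) \<le> vol P / 4"
        using mult_right_mono[of "\<tau> * ?k" "1 / 4" "vol P"] vol_pos[of P] by (simp add: mult.assoc)
      then have "emeasure lebesgue (large_T P) \<le> ennreal (vol P / 4)"
        using emeasure_large_T[of P] by (meson ennreal_leI order_trans)
      then show "emeasure lebesgue (large_T P) + emeasure lebesgue N \<le> ennreal (vol P / 4)"
        using \<open>emeasure lebesgue N = 0\<close> by (simp del: emeasure_completion)
    qed
    finally have le: "ennreal (vol P / 2) \<le> emeasure lebesgue D + ennreal (vol P / 4)"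
      using half unfolding half' by (rule order_trans[rotated])
    show ?thesis
      by (rule ennreal_le_of_add_le[of _ "vol P / 4"]) (use le vol_pos[of P] in simp_all)
  qed
  have hD: "norm (h x) \<le> (cT + cT * avg_ratio) * amp q" if "x \<in> D" for x
  proof -
    have x: "x \<in> dyad P" "x \<notin> U" "norm (T (loc P) x) \<le> cT * amp P" "norm (h x) \<le> norm (T (loc q) x) + norm (T (loc P) x)"
      using that by (auto simp: D_def)
    have "x \<in> trip q" using x(1) P(2) dyad_subset_trip by blast
    moreover have "x \<notin> large_T q" using x(2) U1 by blast
    ultimately have "norm (T (loc q) x) \<le> cT * amp q" by (simp add: large_T_def not_less)
    moreover have "cT * amp P \<le> cT * (avg_ratio * amp q)" using amp cT0 by (intro mult_left_mono)
    ultimately show ?thesis using x(3,4) by (simp add: algebra_simps)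
  qed
  have h_int: "(\<integral>\<^sup>+x\<in>dyad P. ennreal (norm (h x) * G x) \<partial>lebesgue)
     \<le> ennreal ((4 * (cM * amp q) + (cT + cT * avg_ratio) * amp q) * (vol P powr e * J powr (1 - e)))"
  proof (rule good_set_integral_le[OF s e h G _ G0 emeasure_dyad_vol vol_pos osc _ J D _ D4 hD])
    show "0 \<le> cM * amp q" using cM0 amp_nonneg by simp
    show "0 \<le> (cT + cT * avg_ratio) * amp q" using cT0 amp_nonneg avg_ratio by simp
  qed (auto simp: D_def)
  have "(\<integral>\<^sup>+x\<in>dyad P. ennreal (norm (T (loc q) x) * G x) \<partial>lebesgue)
    \<le> (\<integral>\<^sup>+x. ennreal (norm (T (loc P) x) * G x) * indicator (dyad P) x + ennreal (norm (h x) * G x) * indicator (dyad P) x \<partial>lebesgue)"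
  proof (rule nn_integral_mono_AE)
    show "AE x in lebesgue. ennreal (norm (T (loc q) x) * G x) * indicator (dyad P) x
      \<le> ennreal (norm (T (loc P) x) * G x) * indicator (dyad P) x + ennreal (norm (h x) * G x) * indicator (dyad P) x"
      using ae(1)
    proof eventually_elim
      case (elim x)
      have "norm (T (loc q) x) * G x \<le> norm (T (loc P) x) * G x + norm (h x) * G x"
        using mult_right_mono[OF elim G0[of x]] by (simp add: distrib_right)
      then have "ennreal (norm (T (loc q) x) * G x) \<le> ennreal (norm (T (loc P) x) * G x + norm (h x) * G x)" by (rule ennreal_leI)
      then show ?case using G0[of x] by (simp add: ennreal_plus indicator_def)
    qed
  qed
  also have "\<dots> = (\<integral>\<^sup>+x\<in>dyad P. ennreal (norm (T (loc P) x) * G x) \<partial>lebesgue) + (\<integral>\<^sup>+x\<in>dyad P. ennreal (norm (h x) * G x) \<partial>lebesgue)"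
    by (rule nn_integral_add) auto
  also have "\<dots> \<le> (\<integral>\<^sup>+x\<in>dyad P. ennreal (norm (T (loc P) x) * G x) \<partial>lebesgue)
       + ennreal (step_const * amp q * (vol P powr e * J powr (1 - e)))"
    using h_int by (intro add_left_mono) (simp add: step_const_def algebra_simps)
  finally show ?thesis .
qed

text \<open>G is quantified inside, so that one choice of children serves all truncations of G. J
  may be any family of upper bounds for the integrals of G^(q0'), with q0' = 1/(1-e), so that the
  bounds of the original function can be used for its truncations. F allows finitely many children
  only, those off which G is not forced to vanish.\<close>

definition stopping :: "nat \<times> (int ^ 'n) \<Rightarrow> (nat \<times> (int ^ 'n)) set \<Rightarrow> bool" where
  "stopping q \<P> \<longleftrightarrow> (\<forall>P\<in>\<P>. fst q < fst P \<and> dyad P \<subseteq> dyad q) \<and> disjoint_family_on dyad \<P> \<and>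
     emeasure lebesgue (\<Union>P\<in>\<P>. dyad P) \<le> ennreal (1 / 2) * emeasure lebesgue (dyad q) \<and>
     (\<forall>G J F. G \<in> borel_measurable lebesgue \<longrightarrow> (\<forall>x. 0 \<le> G x) \<longrightarrow>
        (\<forall>P. (\<integral>\<^sup>+x\<in>dyad P. ennreal (G x powr (1 / (1 - e))) \<partial>lebesgue) \<le> ennreal (J P)) \<longrightarrow>
        (\<forall>P. 0 \<le> J P) \<longrightarrow> finite F \<longrightarrow> F \<subseteq> \<P> \<longrightarrow> (\<Sum>P\<in>F. J P) \<le> J q \<longrightarrow>
        (\<forall>P\<in>\<P> - F. \<forall>x\<in>dyad P. G x = 0) \<longrightarrow>
        (\<integral>\<^sup>+x\<in>dyad q. ennreal (norm (T (loc q) x) * G x) \<partial>lebesgue)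
          \<le> ennreal ((cT + step_const) * amp q * (vol q powr e * J q powr (1 - e)))
            + (\<Sum>P\<in>F. \<integral>\<^sup>+x\<in>dyad P. ennreal (norm (T (loc P) x) * G x) \<partial>lebesgue))"

text \<open>The exceptional set E is enlarged to an open set U and decomposed by
  \<open>calderon_zygmund_open\<close>. Off the children |T| is at most cT \<open>amp q\<close>.
  Each child contains a point outside U, where \<open>child_step\<close> applies, and Hoelder's
  inequality for sums collects the errors of the children.\<close>

lemma stopping_exists: "\<exists>\<P>. stopping q \<P>"
proof -
  let ?k = "3 ^ CARD('n) :: real"
  define E where "E = large_T q \<union> large_sharp q \<union> large_avg q"
  define \<delta> where "\<delta> = vol q / 2 ^ (CARD('n) + 4)"
  have \<delta>: "0 < \<delta>" using vol_pos by (simp add: \<delta>_def)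
  have E [measurable]: "E \<in> sets lebesgue" unfolding E_def by measurable
  obtain U where U: "open U" "E \<subseteq> U" "U - E \<in> lmeasurable" "emeasure lebesgue (U - E) < ennreal \<delta>"
    using sets_lebesgue_outer_open[OF E \<delta>] by blast
  have Us [measurable]: "U \<in> sets lebesgue" using U(1) by auto
  have "emeasure lebesgue (U \<inter> dyad q) \<le> emeasure lebesgue (large_T q \<union> (large_sharp q \<union> (large_avg q \<union> (U - E))))"
    by (intro emeasure_mono) (auto simp: E_def)
  also have "\<dots> \<le> emeasure lebesgue (large_T q) + (emeasure lebesgue (large_sharp q) + (emeasure lebesgue (large_avg q) + emeasure lebesgue (U - E)))"
    by (intro order_trans[OF emeasure_subadditive] add_left_mono) auto
  \<comment> \<open>The choice of \<tau> gives \<delta>/2 for each of the two weak bounds; the large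
    averages and the passage to an open set cost \<delta> each. The sum 3 \<delta> is below 4
    \<delta> = vol q / 2^(n+2), the smallness required by the decomposition.\<close>
  also have "\<dots> \<le> ennreal (\<delta> / 2) + (ennreal (\<delta> / 2) + (ennreal \<delta> + ennreal \<delta>))"
  proof -
    have "\<tau> * (?k * vol q) \<le> \<delta> / 2"
    proof -
      have "\<tau> * ?k \<le> 1 / 2 ^ (CARD('n) + 5)" using \<tau>(2) by (simp add: field_simps)
      then have "\<tau> * ?k * vol q \<le> 1 / 2 ^ (CARD('n) + 5) * vol q" using vol_pos[of q] by (intro mult_right_mono) auto
      then show ?thesis by (simp add: \<delta>_def mult.assoc power_add)
    qed
    then have "ennreal (\<tau> * (?k * vol q)) \<le> ennreal (\<delta> / 2)" by (rule ennreal_leI)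
    then show ?thesis
      using emeasure_large_avg[of q] U(4)
      by (intro add_mono order_trans[OF emeasure_large_T] order_trans[OF emeasure_large_sharp]) (auto simp: \<delta>_def)
  qed
  also have "\<dots> = ennreal (3 * \<delta>)" using \<delta> by (simp add: ennreal_plus[symmetric] del: ennreal_plus)
  also have "\<dots> \<le> ennreal (vol q / 2 ^ (CARD('n) + 2))"
    using vol_pos[of q] by (intro ennreal_leI) (simp add: \<delta>_def power_add field_simps)
  also have "\<dots> = ennreal (1 / 2 ^ (CARD('n) + 2)) * emeasure lebesgue (dyad q)"
    unfolding emeasure_dyad_vol by (subst ennreal_mult[symmetric]) (auto simp: vol_pos less_imp_le)
  finally obtain \<P> where \<P>: "\<And>P. P \<in> \<P> \<Longrightarrow> fst q < fst P" "\<And>P. P \<in> \<P> \<Longrightarrow> dyad P \<subseteq> dyad q"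
    "disjoint_family_on dyad \<P>" "U \<inter> dyad q \<subseteq> (\<Union>P\<in>\<P>. dyad P)"
    "emeasure lebesgue (\<Union>P\<in>\<P>. dyad P) \<le> ennreal (1 / 2) * emeasure lebesgue (dyad q)"
    "\<And>P. P \<in> \<P> \<Longrightarrow> ennreal (1 / 2) * emeasure lebesgue (dyad P) \<le> emeasure lebesgue (dyad P - U)"
    by (rule calderon_zygmund_open[OF U(1)]) blast
  have "(\<integral>\<^sup>+x\<in>dyad q. ennreal (norm (T (loc q) x) * G x) \<partial>lebesgue)
          \<le> ennreal ((cT + step_const) * amp q * (vol q powr e * J q powr (1 - e)))
            + (\<Sum>P\<in>F. \<integral>\<^sup>+x\<in>dyad P. ennreal (norm (T (loc P) x) * G x) \<partial>lebesgue)"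
    if G [measurable]: "G \<in> borel_measurable lebesgue" and G0: "\<And>x. 0 \<le> G x"
      and J: "\<And>P. (\<integral>\<^sup>+x\<in>dyad P. ennreal (G x powr (1 / (1 - e))) \<partial>lebesgue) \<le> ennreal (J P)" "\<And>P. 0 \<le> J P"
      and F: "finite F" "F \<subseteq> \<P>" and Jsum: "(\<Sum>P\<in>F. J P) \<le> J q"
      and G_zero: "\<And>P x. P \<in> \<P> - F \<Longrightarrow> x \<in> dyad P \<Longrightarrow> G x = 0" for G J F
  proof -
    define A where "A = vol q powr e * J q powr (1 - e)"
    have A0: "0 \<le> A" by (simp add: A_def)
    have "(\<integral>\<^sup>+x\<in>dyad q. ennreal (norm (T (loc q) x) * G x) \<partial>lebesgue)
      \<le> (\<integral>\<^sup>+x. ennreal (cT * amp q) * (ennreal (G x) * indicator (dyad q) x)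
           + (\<Sum>P\<in>F. ennreal (norm (T (loc q) x) * G x) * indicator (dyad P) x) \<partial>lebesgue)"
    proof (rule nn_integral_mono)
      fix x
      show "ennreal (norm (T (loc q) x) * G x) * indicator (dyad q) x \<le> ennreal (cT * amp q) * (ennreal (G x) * indicator (dyad q) x)
           + (\<Sum>P\<in>F. ennreal (norm (T (loc q) x) * G x) * indicator (dyad P) x)"
      proof (cases "x \<in> dyad q")
        case x: True
        consider "x \<notin> (\<Union>P\<in>\<P>. dyad P)" | P where "P \<in> F" "x \<in> dyad P" | P where "P \<in> \<P> - F" "x \<in> dyad P" by blast
        then show ?thesis
        proof cases
          case 1
          then have "x \<notin> large_T q" using \<P>(4) U(2) x by (auto simp: E_def)
          then have "norm (T (loc q) x) \<le> cT * amp q"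
            using x dyad_subset_trip[of q] by (auto simp: large_T_def not_less)
          then have "norm (T (loc q) x) * G x \<le> cT * amp q * G x" using G0 by (intro mult_right_mono)
          then have "ennreal (norm (T (loc q) x) * G x) \<le> ennreal (cT * amp q) * ennreal (G x)"
            using G0 cT0 amp_nonneg by (simp add: ennreal_leI flip: ennreal_mult)
          then show ?thesis using x by (simp add: add_increasing2)
        next
          case 2
          have "ennreal (norm (T (loc q) x) * G x) * indicator (dyad P) x \<le> (\<Sum>P\<in>F. ennreal (norm (T (loc q) x) * G x) * indicator (dyad P) x)"
            using 2(1) F(1) by (intro member_le_sum) auto
          then show ?thesis using 2(2) x by (simp add: add_increasing)
        next
          case 3
          then have "G x = 0" by (rule G_zero)
          then show ?thesis by simp
        qed
      qed simp
    qed
    also have "\<dots> = ennreal (cT * amp q) * (\<integral>\<^sup>+x\<in>dyad q. ennreal (G x) \<partial>lebesgue)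
        + (\<Sum>P\<in>F. \<integral>\<^sup>+x\<in>dyad P. ennreal (norm (T (loc q) x) * G x) \<partial>lebesgue)"
      by (subst nn_integral_add) (auto simp: nn_integral_cmult nn_integral_sum)
    also have "\<dots> \<le> ennreal (cT * amp q) * ennreal A
        + (\<Sum>P\<in>F. (\<integral>\<^sup>+x\<in>dyad P. ennreal (norm (T (loc P) x) * G x) \<partial>lebesgue) + ennreal (step_const * amp q * (vol P powr e * J P powr (1 - e))))"
    proof (intro add_mono mult_left_mono sum_mono)
      show "(\<integral>\<^sup>+x\<in>dyad q. ennreal (G x) \<partial>lebesgue) \<le> ennreal A"
        using set_nn_integral_Holder[of "1 - e" G lebesgue "dyad q" "vol q" "J q"] e01 G0 J vol_pos[of q]
        by (simp add: A_def emeasure_dyad_vol less_imp_le del: emeasure_completion)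
      fix P assume "P \<in> F"
      then have P: "P \<in> \<P>" using F by auto
      have "emeasure lebesgue (dyad P - U) \<noteq> 0"
      proof
        assume 0: "emeasure lebesgue (dyad P - U) = 0"
        have "ennreal (1 / 2) * emeasure lebesgue (dyad P) = ennreal (vol P / 2)"
          unfolding emeasure_dyad_vol by (subst ennreal_mult[symmetric]) (auto simp: vol_pos less_imp_le)
        then have "ennreal (vol P / 2) \<le> 0" using \<P>(6)[OF P] unfolding 0 by simp
        then show False using vol_pos[of P] by (simp add: ennreal_eq_0_iff)
      qed
      then have "dyad P - U \<noteq> {}" by (metis emeasure_empty)
      then obtain z where z: "z \<in> dyad P" "z \<notin> U" by blast
      show "(\<integral>\<^sup>+x\<in>dyad P. ennreal (norm (T (loc q) x) * G x) \<partial>lebesgue)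
        \<le> (\<integral>\<^sup>+x\<in>dyad P. ennreal (norm (T (loc P) x) * G x) \<partial>lebesgue) + ennreal (step_const * amp q * (vol P powr e * J P powr (1 - e)))"
        by (rule child_step[OF \<P>(1,2)[OF P] z(1) _ _ Us _ \<P>(6)[OF P] G G0 J])
          (use z(2) U(2) in \<open>auto simp: E_def\<close>)
    qed auto
    also have "\<dots> = ennreal (cT * amp q) * ennreal A + (\<Sum>P\<in>F. ennreal (step_const * amp q * (vol P powr e * J P powr (1 - e))))
        + (\<Sum>P\<in>F. (\<integral>\<^sup>+x\<in>dyad P. ennreal (norm (T (loc P) x) * G x) \<partial>lebesgue))"
      by (simp add: sum.distrib add_ac)
    also have "\<dots> \<le> ennreal ((cT + step_const) * amp q * A) + (\<Sum>P\<in>F. (\<integral>\<^sup>+x\<in>dyad P. ennreal (norm (T (loc P) x) * G x) \<partial>lebesgue))"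
    proof (rule add_right_mono)
      have "(\<Sum>P\<in>F. vol P) \<le> vol q"
      proof -
        have "ennreal (\<Sum>P\<in>F. vol P) = (\<Sum>P\<in>F. emeasure lebesgue (dyad P))"
          unfolding emeasure_dyad_vol using vol_pos by (intro sum_ennreal[symmetric]) (auto simp: less_imp_le)
        also have "\<dots> = emeasure lebesgue (\<Union>P\<in>F. dyad P)"
          using F(1) disjoint_family_on_mono[OF F(2) \<P>(3)] by (intro sum_emeasure) auto
        also have "\<dots> \<le> emeasure lebesgue (dyad q)" using F \<P>(2) by (intro emeasure_mono) auto
        finally show ?thesis unfolding emeasure_dyad_vol using vol_pos[of q] by (simp add: less_imp_le)
      qed
      moreover have "(\<Sum>P\<in>F. vol P powr e * J P powr (1 - e)) \<le> (\<Sum>P\<in>F. vol P) powr e * (\<Sum>P\<in>F. J P) powr (1 - e)"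
        using F(1) vol_pos J(2) e01 by (intro powr_sum_Holder) (auto simp: less_imp_le)
      ultimately have "(\<Sum>P\<in>F. vol P powr e * J P powr (1 - e)) \<le> A"
        unfolding A_def using Jsum e01 vol_pos J(2)
        by (elim order_trans) (intro mult_mono powr_mono2, auto intro!: sum_nonneg simp: less_imp_le)
      then have "step_const * amp q * (\<Sum>P\<in>F. vol P powr e * J P powr (1 - e)) \<le> step_const * amp q * A"
        using step_const_nonneg amp_nonneg by (intro mult_left_mono) auto
      then have "(\<Sum>P\<in>F. step_const * amp q * (vol P powr e * J P powr (1 - e))) \<le> step_const * amp q * A"
        by (simp add: sum_distrib_left)
      then have "(\<Sum>P\<in>F. ennreal (step_const * amp q * (vol P powr e * J P powr (1 - e)))) \<le> ennreal (step_const * amp q * A)"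
        using step_const_nonneg amp_nonneg by (subst sum_ennreal) (auto intro: ennreal_leI)
      then have "ennreal (cT * amp q) * ennreal A + (\<Sum>P\<in>F. ennreal (step_const * amp q * (vol P powr e * J P powr (1 - e))))
        \<le> ennreal (cT * amp q) * ennreal A + ennreal (step_const * amp q * A)" by (rule add_left_mono)
      also have "\<dots> = ennreal ((cT + step_const) * amp q * A)"
        using cT0 step_const_nonneg amp_nonneg[of q] A0 by (simp add: distrib_right flip: ennreal_mult ennreal_plus)
      finally show "ennreal (cT * amp q) * ennreal A + (\<Sum>P\<in>F. ennreal (step_const * amp q * (vol P powr e * J P powr (1 - e))))
        \<le> ennreal ((cT + step_const) * amp q * A)" .
    qed
    finally show ?thesis by (simp add: A_def)
  qed
  then have "stopping q \<P>" unfolding stopping_def using \<P>(1,2,3,5) by (intro conjI allI impI ballI) auto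
  then show ?thesis by blast
qed


section \<open>The tree of stopping cubes and its sparseness\<close>

definition children :: "nat \<times> (int ^ 'n) \<Rightarrow> (nat \<times> (int ^ 'n)) set" where
  "children q = (SOME \<P>. stopping q \<P>)"

lemma stopping_children: "stopping q (children q)"
  unfolding children_def using stopping_exists by (rule someI_ex)

lemma children_less: "P \<in> children q \<Longrightarrow> fst q < fst P"
  and children_subset: "P \<in> children q \<Longrightarrow> dyad P \<subseteq> dyad q"
  using stopping_children[of q, unfolded stopping_def, THEN conjunct1] by blast+

lemma children_disjoint: "disjoint_family_on dyad (children q)"
  using stopping_children[of q, unfolded stopping_def, THEN conjunct2, THEN conjunct1] .

lemma children_half: "emeasure lebesgue (\<Union>P\<in>children q. dyad P) \<le> ennreal (1 / 2) * emeasure lebesgue (dyad q)"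
  using stopping_children[of q, unfolded stopping_def, THEN conjunct2, THEN conjunct2, THEN conjunct1] .

lemma children_unique:
  assumes "P \<in> children q" "P' \<in> children q" "x \<in> dyad P" "x \<in> dyad P'"
  shows "P = P'"
proof (rule ccontr)
  assume "P \<noteq> P'"
  then have "dyad P \<inter> dyad P' = {}" by (rule disjoint_family_onD[OF children_disjoint assms(1,2)])
  then show False using assms(3,4) by blast
qed

inductive_set tree :: "nat \<times> (int ^ 'n) \<Rightarrow> (nat \<times> (int ^ 'n)) set" for r where
  root: "r \<in> tree r"
| child: "q \<in> tree r \<Longrightarrow> P \<in> children q \<Longrightarrow> P \<in> tree r"

lemma tree_subset: "q \<in> tree r \<Longrightarrow> dyad q \<subseteq> dyad r"
proof (induction rule: tree.induct)
  case (child q P)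
  then show ?case using children_subset[OF child(2)] by simp
qed simp

lemma dyad_eq_level: "fst q = fst q' \<Longrightarrow> x \<in> dyad q \<Longrightarrow> x \<in> dyad q' \<Longrightarrow> q = q'"
  using mem_dyad_iff_coord[of x q] mem_dyad_iff_coord[of x q'] by simp

lemma dyad_subset_level: "dyad q \<subseteq> dyad q' \<Longrightarrow> fst q' \<le> fst q"
proof (rule ccontr)
  assume sub: "dyad q \<subseteq> dyad q'" and "\<not> fst q' \<le> fst q"
  then have lt: "side (fst q') < side (fst q)" using L by (auto simp: side_def intro!: divide_strict_left_mono power_strict_increasing)
  have "emeasure lebesgue (dyad q) \<le> emeasure lebesgue (dyad q')" using sub by (intro emeasure_mono) auto
  then have "side (fst q) ^ CARD('n) \<le> side (fst q') ^ CARD('n)"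
    unfolding emeasure_dyad using side_pos[of "fst q'"] by (simp add: less_imp_le)
  moreover have "side (fst q') ^ CARD('n) < side (fst q) ^ CARD('n)"
    using lt side_pos[of "fst q'"] by (intro power_strict_mono) auto
  ultimately show False by simp
qed

lemma dyad_inj:
  assumes "dyad q = dyad q'"
  shows "q = q'"
proof -
  obtain x where "x \<in> dyad q" using dyad_nonempty by blast
  moreover have "fst q = fst q'" using dyad_subset_level[of q q'] dyad_subset_level[of q' q] assms by simp
  ultimately show ?thesis using dyad_eq_level assms by blast
qed

text \<open>Induction on the level of q through its predecessor p in the tree. If q' is at least as
  large as p, apply the induction hypothesis to p. Otherwise q' lies inside a child of p, if it is
  not q already, and this child must be q because the children are disjoint.\<close>

lemma tree_child_cover:
  assumes "q \<in> tree r" "q' \<in> tree r" "dyad q \<subseteq> dyad q'"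
  shows "q = q' \<or> (\<exists>c\<in>children q'. dyad q \<subseteq> dyad c)"
  using assms
proof (induction "fst q" arbitrary: q q' rule: less_induct)
  case less
  from less.prems(1) show ?case
  proof cases
    case root
    then have "dyad q = dyad q'" using less.prems tree_subset[of q' r] by blast
    then show ?thesis by (auto dest: dyad_inj)
  next
    case (child p)
    obtain x where x: "x \<in> dyad q" using dyad_nonempty by blast
    have xp: "x \<in> dyad p" and xq': "x \<in> dyad q'" using x child(2) children_subset less.prems(3) by blast+
    have pq: "fst p < fst q" using child(2) by (rule children_less)
    show ?thesis
    proof (cases "fst q' \<le> fst p")
      case True
      then have "dyad p \<subseteq> dyad q'" using xp xq' by (intro dyad_nested(1)) auto
      then have "p = q' \<or> (\<exists>c\<in>children q'. dyad p \<subseteq> dyad c)"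
        by (intro less.hyps[OF pq child(1) less.prems(2)])
      then show ?thesis using child(2) children_subset[OF child(2)] by blast
    next
      case False
      then have sub: "dyad q' \<subseteq> dyad p" using xp xq' by (intro dyad_nested(1)) auto
      have le: "fst q' \<le> fst q" using less.prems(3) by (rule dyad_subset_level)
      show ?thesis
      proof (cases "fst q' = fst q")
        case True
        then show ?thesis using dyad_eq_level[OF True xq' x] by simp
      next
        case False
        then have "fst q' < fst q" using le by simp
        then have "q' = p \<or> (\<exists>c\<in>children p. dyad q' \<subseteq> dyad c)"
          using less.hyps[of q' p] less.prems(2) child(1) sub by blast
        moreover have "q' \<noteq> p" using \<open>\<not> fst q' \<le> fst p\<close> by auto
        ultimately obtain c where c: "c \<in> children p" "dyad q' \<subseteq> dyad c" by blast
        then have "c = q" using children_unique[OF c(1) child(2), of x] x xq' by blast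
        then have "dyad q = dyad q'" using c(2) less.prems(3) by blast
        then show ?thesis by (auto dest: dyad_inj)
      qed
    qed
  qed
qed

text \<open>The disjoint sets \<open>E\<^sub>Q \<subseteq> Q\<close> witnessing sparseness.\<close>

definition major :: "nat \<times> (int ^ 'n) \<Rightarrow> (real ^ 'n) set" where
  "major q = dyad q - (\<Union>P\<in>children q. dyad P)"

lemma major_sets [measurable]: "major q \<in> sets lebesgue"
  unfolding major_def by (intro sets.Diff sets.countable_UN' countableI_type) auto

lemma major_subset: "major q \<subseteq> dyad q"
  by (auto simp: major_def)

lemma emeasure_major: "ennreal (vol q / 2) \<le> emeasure lebesgue (major q)"
proof -
  let ?U = "\<Union>P\<in>children q. dyad P"
  have U [measurable]: "?U \<in> sets lebesgue" by (intro sets.countable_UN' countableI_type) auto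
  have half: "ennreal (1 / 2) * emeasure lebesgue (dyad q) = ennreal (vol q / 2)"
    unfolding emeasure_dyad_vol by (subst ennreal_mult[symmetric]) (auto simp: vol_pos less_imp_le)
  have "ennreal (vol q) = emeasure lebesgue (dyad q)" by (rule emeasure_dyad_vol[symmetric])
  also have "\<dots> \<le> emeasure lebesgue (major q \<union> ?U)" by (intro emeasure_mono) (auto simp: major_def)
  also have "\<dots> \<le> emeasure lebesgue (major q) + emeasure lebesgue ?U" by (intro emeasure_subadditive) auto
  also have "\<dots> \<le> emeasure lebesgue (major q) + ennreal (vol q / 2)"
    using children_half[of q] unfolding half by (rule add_left_mono)
  finally have le: "ennreal (vol q) \<le> emeasure lebesgue (major q) + ennreal (vol q / 2)" .
  show ?thesis
    by (rule ennreal_le_of_add_le[of _ "vol q / 2"]) (use le vol_pos[of q] in simp_all)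
qed

lemma tree_below:
  assumes "q \<in> tree r" "q' \<in> tree r" "x \<in> dyad q" "x \<in> dyad q'" "fst q < fst q'"
  shows "x \<in> (\<Union>P\<in>children q. dyad P)"
proof -
  have "dyad q' \<subseteq> dyad q" using assms by (intro dyad_nested(1)) auto
  then show ?thesis using tree_child_cover[OF assms(2,1)] assms by blast
qed

lemma major_disjoint: "disjoint_family_on major (tree r)"
  unfolding disjoint_family_on_def
proof (intro ballI impI, rule ccontr)
  fix q q' assume q: "q \<in> tree r" "q' \<in> tree r" "q \<noteq> q'" "major q \<inter> major q' \<noteq> {}"
  then obtain x where x: "x \<in> major q" "x \<in> major q'" by auto
  then have xd: "x \<in> dyad q" "x \<in> dyad q'" by (auto simp: major_def)
  consider "fst q < fst q'" | "fst q' < fst q" | "fst q = fst q'" by linarith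
  then show False
  proof cases
    case 1
    then show ?thesis using tree_below[OF q(1,2) xd] x by (auto simp: major_def)
  next
    case 2
    then show ?thesis using tree_below[OF q(2,1) xd(2,1)] x by (auto simp: major_def)
  next
    case 3
    then show ?thesis using dyad_eq_level[OF 3 xd] q(3) by simp
  qed
qed

text \<open>Setting G to zero on this set makes G vanish on all stopping cubes of level above N, so
  that the recursion from r ends at level N.\<close>

definition deep :: "nat \<times> (int ^ 'n) \<Rightarrow> nat \<Rightarrow> (real ^ 'n) set" where
  "deep r N = (\<Union>q\<in>{q \<in> tree r. N < fst q}. dyad q)"

lemma deep_sets [measurable]: "deep r N \<in> sets lebesgue"
  unfolding deep_def by (intro sets.countable_UN' countableI_type) auto

text \<open>The points in infinitely many cubes of the tree form a null set: their density relative to each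
  cube is at most half the supremum of these densities.\<close>

lemma deep_null: "emeasure lebesgue ((\<Inter>N. deep r N) \<inter> dyad r) = 0"
proof -
  define B where "B = (\<Inter>N. deep r N)"
  have B [measurable]: "B \<in> sets lebesgue" unfolding B_def by (intro sets.countable_INT'') auto
  have cover: "B \<inter> dyad q \<subseteq> (\<Union>P\<in>children q. B \<inter> dyad P)" if q: "q \<in> tree r" for q
  proof
    fix x assume x: "x \<in> B \<inter> dyad q"
    then have "x \<in> deep r (fst q)" unfolding B_def by blast
    then obtain q' where "q' \<in> tree r" "fst q < fst q'" "x \<in> dyad q'" unfolding deep_def by blast
    then have "x \<in> (\<Union>P\<in>children q. dyad P)" using tree_below[OF q] x by blast
    then show "x \<in> (\<Union>P\<in>children q. B \<inter> dyad P)" using x by blast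
  qed
  define \<nu> where "\<nu> = density lebesgue (indicator B)"
  have \<nu>: "emeasure \<nu> A = emeasure lebesgue (B \<inter> A)" if "A \<in> sets lebesgue" for A
    unfolding \<nu>_def using that by (subst emeasure_density) (auto simp: indicator_inter_arith[symmetric])
  have "\<forall>q\<in>tree r. emeasure lebesgue (B \<inter> dyad q) \<le> ennreal (1 / 2 ^ k) * emeasure lebesgue (dyad q)" for k
  proof (induction k)
    case 0
    have "emeasure lebesgue (B \<inter> dyad q) \<le> emeasure lebesgue (dyad q)" for q by (intro emeasure_mono) auto
    then show ?case by (simp del: emeasure_completion)
  next
    case (Suc k)
    show ?case
    proof
      fix q assume q: "q \<in> tree r"
      let ?U = "\<Union>P\<in>children q. dyad P"
      have U [measurable]: "?U \<in> sets lebesgue" by (intro sets.countable_UN' countableI_type) auto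
      have "emeasure lebesgue (B \<inter> dyad q) \<le> emeasure lebesgue (B \<inter> ?U)"
        using cover[OF q] by (intro emeasure_mono) auto
      also have "\<dots> = emeasure \<nu> ?U" by (rule \<nu>[symmetric]) simp
      also have "\<dots> \<le> ennreal (1 / 2 ^ k) * emeasure lebesgue ?U"
      proof (rule emeasure_UN_disjoint_le)
        fix P assume "P \<in> children q"
        then have "P \<in> tree r" using q by (rule tree.child[rotated])
        then show "emeasure \<nu> (dyad P) \<le> ennreal (1 / 2 ^ k) * emeasure lebesgue (dyad P)"
          using Suc.IH by (subst \<nu>) auto
      qed (auto simp: \<nu>_def children_disjoint intro: countableI_type)
      also have "\<dots> \<le> ennreal (1 / 2 ^ k) * (ennreal (1 / 2) * emeasure lebesgue (dyad q))"
        by (intro mult_left_mono children_half) auto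
      also have "\<dots> = ennreal (1 / 2 ^ Suc k) * emeasure lebesgue (dyad q)"
        by (subst mult.assoc[symmetric], subst ennreal_mult[symmetric]) (auto simp: mult.commute)
      finally show "emeasure lebesgue (B \<inter> dyad q) \<le> ennreal (1 / 2 ^ Suc k) * emeasure lebesgue (dyad q)" .
    qed
  qed
  then have le: "emeasure lebesgue (B \<inter> dyad r) \<le> ennreal (vol r / 2 ^ k)" for k
  proof -
    assume a: "\<And>k. \<forall>q\<in>tree r. emeasure lebesgue (B \<inter> dyad q) \<le> ennreal (1 / 2 ^ k) * emeasure lebesgue (dyad q)"
    have "emeasure lebesgue (B \<inter> dyad r) \<le> ennreal (1 / 2 ^ k) * emeasure lebesgue (dyad r)" using a tree.root by blast
    also have "\<dots> = ennreal (vol r / 2 ^ k)"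
      unfolding emeasure_dyad_vol by (subst ennreal_mult[symmetric]) (auto simp: vol_pos less_imp_le)
    finally show ?thesis .
  qed
  have "(\<lambda>k. ennreal (vol r / 2 ^ k)) \<longlonglongrightarrow> ennreal 0"
    by (intro tendsto_ennrealI LIMSEQ_divide_realpow_zero) auto
  then have "emeasure lebesgue (B \<inter> dyad r) \<le> ennreal 0"
    by (rule LIMSEQ_le_const) (use le in blast)
  then show ?thesis unfolding B_def by (simp only: ennreal_0 le_zero_eq)
qed

lemma finite_subdyads: "finite {q. fst q \<le> N \<and> dyad q \<subseteq> dyad r}"
proof -
  have "{q. fst q \<le> N \<and> dyad q \<subseteq> dyad r} \<subseteq> (\<Union>k\<le>N. {q. fst q = k \<and> dyad q \<subseteq> dyad r})" by auto
  moreover have "finite {q. fst q = k \<and> dyad q \<subseteq> dyad r}" for k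
  proof (rule finite_if_finite_subsets_card_bdd[THEN conjunct1])
    fix F assume F: "F \<subseteq> {q. fst q = k \<and> dyad q \<subseteq> dyad r}" "finite F"
    define v where "v = side k ^ CARD('n)"
    have v: "0 < v" by (simp add: v_def side_pos)
    have "(\<Sum>q\<in>F. vol q) = (\<Sum>q\<in>F. v)" using F(1) by (intro sum.cong) (auto simp: vol_def v_def)
    then have "real (card F) * v = (\<Sum>q\<in>F. vol q)" by simp
    also have "ennreal (\<Sum>q\<in>F. vol q) = (\<Sum>q\<in>F. emeasure lebesgue (dyad q))"
      unfolding emeasure_dyad_vol using vol_pos by (intro sum_ennreal[symmetric]) (auto simp: less_imp_le)
    also have "\<dots> = emeasure lebesgue (\<Union>q\<in>F. dyad q)"
    proof (rule sum_emeasure)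
      show "disjoint_family_on dyad F"
        unfolding disjoint_family_on_def
      proof (intro ballI impI equals0I)
        fix q q' x assume q: "q \<in> F" "q' \<in> F" "q \<noteq> q'" "x \<in> dyad q \<inter> dyad q'"
        then have "fst q = fst q'" using F(1) by auto
        then show False using dyad_eq_level[of q q' x] q by blast
      qed
    qed (use F in auto)
    also have "\<dots> \<le> emeasure lebesgue (dyad r)" using F by (intro emeasure_mono) auto
    finally have "real (card F) * v \<le> vol r" unfolding emeasure_dyad_vol using vol_pos[of r] by (simp add: less_imp_le)
    then have "real (card F) \<le> vol r / v" using v by (simp add: field_simps)
    then show "card F \<le> nat \<lceil>vol r / v\<rceil>" by linarith
  qed
  then have "finite (\<Union>k\<le>N. {q. fst q = k \<and> dyad q \<subseteq> dyad r})" by simp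
  ultimately show ?thesis by (rule finite_subset)
qed

definition Jint :: "(real ^ 'n \<Rightarrow> real) \<Rightarrow> nat \<times> (int ^ 'n) \<Rightarrow> real" where
  "Jint G q = enn2real (\<integral>\<^sup>+x\<in>dyad q. ennreal (G x powr (1 / (1 - e))) \<partial>lebesgue)"

text \<open>This is \<open>amp q\<close> times |Q| times the q0'-average of G over the cube Q of
  index q, because q0' = 1/(1-e).\<close>

definition form_term :: "(real ^ 'n \<Rightarrow> real) \<Rightarrow> nat \<times> (int ^ 'n) \<Rightarrow> real" where
  "form_term G q = amp q * (vol q powr e * Jint G q powr (1 - e))"

lemma form_term_nonneg: "0 \<le> form_term G q"
  by (simp add: form_term_def amp_nonneg)

lemma sparse_domination:
  fixes G :: "real ^ 'n \<Rightarrow> real"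
  assumes G [measurable]: "G \<in> borel_measurable lebesgue" and G0: "\<And>x. 0 \<le> G x"
    and Gint: "(\<integral>\<^sup>+x. ennreal (G x powr (1 / (1 - e))) \<partial>lebesgue) < \<infinity>"
    and B: "\<And>F. finite F \<Longrightarrow> F \<subseteq> tree r \<Longrightarrow> (\<Sum>q\<in>F. form_term G q) \<le> B"
  shows "(\<integral>\<^sup>+x\<in>dyad r. ennreal (norm (T (loc r) x) * G x) \<partial>lebesgue) \<le> ennreal ((cT + step_const) * B)"
proof -
  have B0: "0 \<le> B" using B[of "{}"] by simp
  have K0: "0 \<le> cT + step_const" using cT0 step_const_nonneg by simp
  have J: "(\<integral>\<^sup>+x\<in>dyad q. ennreal (G x powr (1 / (1 - e))) \<partial>lebesgue) = ennreal (Jint G q)" for q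
  proof -
    have "(\<integral>\<^sup>+x\<in>dyad q. ennreal (G x powr (1 / (1 - e))) \<partial>lebesgue) \<le> (\<integral>\<^sup>+x. ennreal (G x powr (1 / (1 - e))) \<partial>lebesgue)"
      by (intro nn_integral_mono) (auto simp: indicator_def)
    then have "(\<integral>\<^sup>+x\<in>dyad q. ennreal (G x powr (1 / (1 - e))) \<partial>lebesgue) < \<infinity>" using Gint by (rule order_le_less_trans)
    then show ?thesis by (simp add: Jint_def)
  qed
  have J0: "0 \<le> Jint G q" for q by (simp add: Jint_def)
  define GN where "GN = (\<lambda>N x. G x * indicator (- deep r N) x)"
  have cd [measurable]: "- deep r N \<in> sets lebesgue" for N by (simp only: Compl_in_sets_lebesgue deep_sets)
  have GN [measurable]: "GN N \<in> borel_measurable lebesgue" for N unfolding GN_def by measurable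
  have GN0: "0 \<le> GN N x" for N x using G0 by (simp add: GN_def)
  have level: "(\<integral>\<^sup>+x\<in>dyad q. ennreal (norm (T (loc q) x) * GN N x) \<partial>lebesgue)
      \<le> (\<Sum>P\<in>{P \<in> tree r. fst P \<le> N \<and> dyad P \<subseteq> dyad q}. ennreal ((cT + step_const) * form_term G P))"
    if "q \<in> tree r" "fst q \<le> N" for q N
    using that
  proof (induction "N - fst q" arbitrary: q rule: less_induct)
    case less
    define S where "S = (\<lambda>q. {P \<in> tree r. fst P \<le> N \<and> dyad P \<subseteq> dyad q})"
    have finS: "finite (S q)" for q unfolding S_def by (rule finite_subset[OF _ finite_subdyads[of N q]]) auto
    define F where "F = {P \<in> children q. fst P \<le> N}"
    have FS: "P \<in> S q" if "P \<in> F" for P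
      using that tree.child[OF less.prems(1)] children_subset by (auto simp: F_def S_def)
    have finF: "finite F" by (rule finite_subset[OF _ finS[of q]]) (use FS in blast)
    have sub: "F \<subseteq> children q" by (auto simp: F_def)
    have disjF: "disjoint_family_on dyad F" using disjoint_family_on_mono[OF sub children_disjoint] .
    have "(\<integral>\<^sup>+x\<in>dyad q. ennreal (norm (T (loc q) x) * GN N x) \<partial>lebesgue)
       \<le> ennreal ((cT + step_const) * amp q * (vol q powr e * Jint G q powr (1 - e)))
            + (\<Sum>P\<in>F. \<integral>\<^sup>+x\<in>dyad P. ennreal (norm (T (loc P) x) * GN N x) \<partial>lebesgue)"
    proof (rule stopping_children[of q, unfolded stopping_def, THEN conjunct2, THEN conjunct2, THEN conjunct2, rule_format])
      show "(\<integral>\<^sup>+x\<in>dyad P. ennreal (GN N x powr (1 / (1 - e))) \<partial>lebesgue) \<le> ennreal (Jint G P)" for P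
        unfolding J[symmetric] using e01
        by (intro nn_integral_mono) (auto simp: GN_def indicator_def)
      show "(\<Sum>P\<in>F. Jint G P) \<le> Jint G q"
      proof -
        let ?g = "\<lambda>x. ennreal (G x powr (1 / (1 - e)))"
        have "ennreal (\<Sum>P\<in>F. Jint G P) = (\<Sum>P\<in>F. \<integral>\<^sup>+x\<in>dyad P. ?g x \<partial>lebesgue)"
          unfolding J using J0 by (intro sum_ennreal[symmetric])
        also have "\<dots> = (\<integral>\<^sup>+x. (\<Sum>P\<in>F. ?g x * indicator (dyad P) x) \<partial>lebesgue)"
          by (intro nn_integral_sum[symmetric]) auto
        also have "\<dots> = (\<integral>\<^sup>+x\<in>(\<Union>P\<in>F. dyad P). ?g x \<partial>lebesgue)"
          using finF disjF by (simp add: sum_distrib_left[symmetric] indicator_UN_disjoint)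
        also have "\<dots> \<le> (\<integral>\<^sup>+x\<in>dyad q. ?g x \<partial>lebesgue)"
          using sub children_subset[of _ q] by (intro nn_integral_mono) (auto simp: indicator_def)
        finally show ?thesis unfolding J using J0 by simp
      qed
      fix P x assume P: "P \<in> children q - F" "x \<in> dyad P"
      then have "P \<in> tree r" "N < fst P" using tree.child[OF less.prems(1)] by (auto simp: F_def)
      then have "x \<in> deep r N" using P(2) unfolding deep_def by blast
      then show "GN N x = 0" by (simp add: GN_def)
    qed (use GN0 J0 finF sub in auto)
    also have "\<dots> \<le> ennreal ((cT + step_const) * form_term G q) + (\<Sum>P\<in>F. \<Sum>R\<in>S P. ennreal ((cT + step_const) * form_term G R))"
    proof (intro add_mono sum_mono)
      show "ennreal ((cT + step_const) * amp q * (vol q powr e * Jint G q powr (1 - e))) \<le> ennreal ((cT + step_const) * form_term G q)"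
        by (simp add: form_term_def mult.assoc)
      fix P assume P: "P \<in> F"
      have lt: "fst q < fst P" using P children_less by (auto simp: F_def)
      have "fst P \<le> N" using P by (simp add: F_def)
      moreover have "P \<in> tree r" using FS[OF P] by (simp add: S_def)
      ultimately show "(\<integral>\<^sup>+x\<in>dyad P. ennreal (norm (T (loc P) x) * GN N x) \<partial>lebesgue) \<le> (\<Sum>R\<in>S P. ennreal ((cT + step_const) * form_term G R))"
        unfolding S_def using lt by (intro less.hyps) auto
    qed
    also have "(\<Sum>P\<in>F. \<Sum>R\<in>S P. ennreal ((cT + step_const) * form_term G R)) = (\<Sum>R\<in>(\<Union>P\<in>F. S P). ennreal ((cT + step_const) * form_term G R))"
    proof (rule sum.UNION_disjoint[symmetric])
      show "\<forall>P\<in>F. \<forall>P'\<in>F. P \<noteq> P' \<longrightarrow> S P \<inter> S P' = {}"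
      proof (intro ballI impI equals0I)
        fix P P' R assume P: "P \<in> F" "P' \<in> F" "P \<noteq> P'" "R \<in> S P \<inter> S P'"
        obtain x where "x \<in> dyad R" using dyad_nonempty by blast
        then have "x \<in> dyad P" "x \<in> dyad P'" using P(4) by (auto simp: S_def)
        then show False using children_unique[of P q P' x] P sub by blast
      qed
    qed (use finF finS in auto)
    also have "ennreal ((cT + step_const) * form_term G q) + (\<Sum>R\<in>(\<Union>P\<in>F. S P). ennreal ((cT + step_const) * form_term G R))
       = (\<Sum>R\<in>insert q (\<Union>P\<in>F. S P). ennreal ((cT + step_const) * form_term G R))"
    proof (rule sum.insert[symmetric])
      show "q \<notin> (\<Union>P\<in>F. S P)"
      proof
        assume "q \<in> (\<Union>P\<in>F. S P)"
        then obtain P where P: "P \<in> F" "dyad q \<subseteq> dyad P" by (auto simp: S_def)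
        then have "fst P \<le> fst q" by (intro dyad_subset_level)
        then show False using P(1) sub children_less[of P q] by auto
      qed
    qed (use finF finS in auto)
    also have "\<dots> \<le> (\<Sum>R\<in>S q. ennreal ((cT + step_const) * form_term G R))"
    proof (rule sum_mono2)
      show "insert q (\<Union>P\<in>F. S P) \<subseteq> S q"
      proof -
        have "q \<in> S q" using less.prems by (simp add: S_def)
        moreover have "S P \<subseteq> S q" if "P \<in> F" for P
          using children_subset[of P q] that sub unfolding S_def by blast
        ultimately show ?thesis by blast
      qed
    qed (use finS in auto)
    finally show ?case by (simp add: S_def)
  qed
  have bound: "(\<integral>\<^sup>+x. ennreal (norm (T (loc r) x) * GN (fst r + N) x) * indicator (dyad r) x \<partial>lebesgue) \<le> ennreal ((cT + step_const) * B)" for N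
  proof -
    let ?S = "{P \<in> tree r. fst P \<le> fst r + N \<and> dyad P \<subseteq> dyad r}"
    have fin: "finite ?S" by (rule finite_subset[OF _ finite_subdyads[of "fst r + N" r]]) auto
    have "(\<integral>\<^sup>+x. ennreal (norm (T (loc r) x) * GN (fst r + N) x) * indicator (dyad r) x \<partial>lebesgue)
      \<le> (\<Sum>P\<in>?S. ennreal ((cT + step_const) * form_term G P))" by (rule level) (auto intro: tree.root)
    also have "\<dots> = ennreal (\<Sum>P\<in>?S. (cT + step_const) * form_term G P)"
      using K0 form_term_nonneg by (intro sum_ennreal) auto
    also have "\<dots> \<le> ennreal ((cT + step_const) * B)"
      unfolding sum_distrib_left[symmetric] using K0 B[OF fin] by (intro ennreal_leI mult_left_mono) auto
    finally show ?thesis .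
  qed
  have "(\<integral>\<^sup>+x\<in>dyad r. ennreal (norm (T (loc r) x) * G x) \<partial>lebesgue)
    \<le> (\<integral>\<^sup>+x. (SUP N. ennreal (norm (T (loc r) x) * GN (fst r + N) x) * indicator (dyad r) x) \<partial>lebesgue)"
  proof (rule nn_integral_mono_AE)
    have "(\<Inter>N. deep r N) \<inter> dyad r \<in> null_sets lebesgue"
      using deep_null[of r] by (intro null_setsI sets.Int sets.countable_INT'') auto
    then have "AE x in lebesgue. x \<notin> (\<Inter>N. deep r N) \<inter> dyad r" by (rule AE_not_in)
    then show "AE x in lebesgue. ennreal (norm (T (loc r) x) * G x) * indicator (dyad r) x
       \<le> (SUP N. ennreal (norm (T (loc r) x) * GN (fst r + N) x) * indicator (dyad r) x)"
    proof eventually_elim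
      case (elim x)
      show ?case
      proof (cases "x \<in> dyad r")
        case True
        then obtain N where "x \<notin> deep r N" using elim by blast
        moreover have "deep r (fst r + N) \<subseteq> deep r N" unfolding deep_def by fastforce
        ultimately have "x \<in> - deep r (fst r + N)" by blast
        then have "GN (fst r + N) x = G x" by (simp add: GN_def)
        then show ?thesis by (intro SUP_upper2[of N]) auto
      qed simp
    qed
  qed
  also have "\<dots> = (SUP N. \<integral>\<^sup>+x. ennreal (norm (T (loc r) x) * GN (fst r + N) x) * indicator (dyad r) x \<partial>lebesgue)"
  proof (rule nn_integral_monotone_convergence_SUP)
    show "incseq (\<lambda>N x. ennreal (norm (T (loc r) x) * GN (fst r + N) x) * indicator (dyad r) x)"
    proof (intro incseq_SucI le_funI mult_right_mono ennreal_leI mult_left_mono)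
      fix N x
      have "deep r (fst r + Suc N) \<subseteq> deep r (fst r + N)" unfolding deep_def by fastforce
      then show "GN (fst r + N) x \<le> GN (fst r + Suc N) x" using G0[of x] by (auto simp: GN_def indicator_def)
    qed auto
  qed auto
  also have "\<dots> \<le> ennreal ((cT + step_const) * B)" by (intro SUP_least bound)
  finally show ?thesis .
qed

end

section \<open>Two-weight estimates\<close>

text \<open>The flag \<open>d\<close> stands for the case \<open>p = q\<close>, \<open>\<alpha> > 0\<close>.\<close>

definition bracket :: "bool \<Rightarrow> real \<Rightarrow> real \<Rightarrow> real \<Rightarrow> real \<Rightarrow> real" where
  "bracket d p q A B =
     (if d then A powr (1 - (1 - 1 / p)\<^sup>2) * B powr ((1 - 1 / p)\<^sup>2) + A powr ((1 / p)\<^sup>2) * B powr (1 - (1 / p)\<^sup>2)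
      else A powr (1 / q) + B powr (1 - 1 / p))"

lemma bracket_nonneg: "0 \<le> bracket d p q A B"
  by (simp add: bracket_def)

text \<open>The left-hand side is the geometric mean of the two terms of the bracket.\<close>

lemma naive_le_bracket:
  assumes "0 < A" "0 < B"
  shows "A powr (1 / p) * B powr (1 - 1 / p) \<le> bracket True p q A B"
proof -
  define t where "t = 1 / p"
  define X where "X = A powr (1 - (1 - t)\<^sup>2) * B powr ((1 - t)\<^sup>2)"
  define Y where "Y = A powr (t\<^sup>2) * B powr (1 - t\<^sup>2)"
  have XY: "0 < X" "0 < Y" using assms by (auto simp: X_def Y_def)
  have "X * Y = A powr (1 - (1 - t)\<^sup>2 + t\<^sup>2) * B powr ((1 - t)\<^sup>2 + (1 - t\<^sup>2))"
    unfolding X_def Y_def powr_add by (simp add: mult_ac)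
  also have "1 - (1 - t)\<^sup>2 + t\<^sup>2 = t + t" by (simp add: power2_eq_square algebra_simps)
  also have "(1 - t)\<^sup>2 + (1 - t\<^sup>2) = (1 - t) + (1 - t)" by (simp add: power2_eq_square algebra_simps)
  also have "A powr (t + t) * B powr ((1 - t) + (1 - t)) = (A powr t * B powr (1 - t))\<^sup>2"
    unfolding powr_add by (simp add: power2_eq_square mult_ac)
  finally have "(A powr t * B powr (1 - t))\<^sup>2 = X * Y" by simp
  also have "\<dots> \<le> (X + Y)\<^sup>2" using XY by (simp add: power2_eq_square algebra_simps)
  finally have "A powr t * B powr (1 - t) \<le> X + Y" by (rule power2_le_imp_le) (use XY in auto)
  then show ?thesis by (simp add: bracket_def X_def Y_def t_def)
qed

lemma powr_mult_le:
  fixes k A t :: real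
  assumes "1 \<le> k" "0 \<le> A" "0 \<le> t" "t \<le> 1"
  shows "(k * A) powr t \<le> k * A powr t"
proof -
  have "(k * A) powr t = k powr t * A powr t" by (rule powr_mult)
  also have "\<dots> \<le> k * A powr t"
  proof (rule mult_right_mono)
    have "k powr t \<le> k powr 1" using assms by (intro powr_mono) auto
    then show "k powr t \<le> k" using assms by simp
  qed simp
  finally show ?thesis .
qed

definition admissible_exponent :: "real \<Rightarrow> real \<Rightarrow> real \<Rightarrow> real \<Rightarrow> real \<Rightarrow> real \<Rightarrow> bool" where
  "admissible_exponent p q a \<beta> \<gamma> \<epsilon> \<longleftrightarrow> 0 < \<epsilon> \<and> 0 < - a * \<epsilon> \<and> - a * \<epsilon> < 1 \<and> \<epsilon> * \<beta> \<le> 1 / p \<and>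
     \<epsilon> * \<gamma> \<le> 1 - 1 / q \<and> 1 \<le> 1 / p + (1 - 1 / q) - \<epsilon> * (a + \<beta> + \<gamma>)"

text \<open>The auxiliary exponent is fixed by choice from p, q, a, \<beta>, \<gamma> alone, so that
  the constant cannot depend on the weights or on the family of cubes.\<close>

definition two_weight_const :: "bool \<Rightarrow> real \<Rightarrow> real \<Rightarrow> real \<Rightarrow> real \<Rightarrow> real \<Rightarrow> real \<Rightarrow> real" where
  "two_weight_const d p q a \<beta> \<gamma> \<Lambda> =
     (if d then 4 * (\<Lambda> * \<Lambda>)
      else let \<epsilon> = SOME \<epsilon>. admissible_exponent p q a \<beta> \<gamma> \<epsilon>
        in 8 * (2 powr (1 + \<epsilon>) * (4 * \<Lambda> / (1 - 2 powr (a * \<epsilon>)))) * \<Lambda>)"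

lemma admissible_exponent_Eps:
  assumes "1 < p" "p \<le> q" "a < 0" "p < q \<or> a + \<beta> + \<gamma> = 0"
  shows "admissible_exponent p q a \<beta> \<gamma> (SOME \<epsilon>. admissible_exponent p q a \<beta> \<gamma> \<epsilon>)"
proof (rule someI_ex)
  show "\<exists>\<epsilon>. admissible_exponent p q a \<beta> \<gamma> \<epsilon>"
    using two_weight_exponent_exists[OF assms] unfolding admissible_exponent_def by metis
qed

lemma two_weight_const_nonneg:
  assumes pq: "1 < p" "p \<le> q" and a: "a < 0" and \<Lambda>: "1 \<le> \<Lambda>"
    and d: "\<not> d \<Longrightarrow> p < q \<or> a + \<beta> + \<gamma> = 0"
  shows "0 \<le> two_weight_const d p q a \<beta> \<gamma> \<Lambda>"
proof (cases d)
  case False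
  define \<epsilon> where "\<epsilon> = (SOME \<epsilon>. admissible_exponent p q a \<beta> \<gamma> \<epsilon>)"
  have "0 < - a * \<epsilon>"
    using admissible_exponent_Eps[OF pq a d[OF False]] unfolding \<epsilon>_def admissible_exponent_def by blast
  then have "2 powr (a * \<epsilon>) < (1::real)" by (intro powr_less_one) auto
  then show ?thesis using False \<Lambda> by (simp add: two_weight_const_def \<epsilon>_def[symmetric] Let_def)
qed (simp add: two_weight_const_def)

text \<open>For d, the local characteristic is estimated by K at once, and what is left is the form
  of \<open>bilinear_naive_le\<close>. The dimensional part \<Lambda> >= 1 of the Carleson constants
  is pulled out of powers with exponent at most 1.\<close>

lemma discrete_two_weight_bound:
  fixes mu U V x y :: "'a set \<Rightarrow> real"
  assumes pq: "1 < p" "p \<le> q" and a: "a < 0" and \<Lambda>: "1 \<le> \<Lambda>"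
    and d: "d \<Longrightarrow> p = q" "\<not> d \<Longrightarrow> p < q \<or> a + \<beta> + \<gamma> = 0"
    and S: "finite S" "laminar S" "\<And>Q. Q \<in> S \<Longrightarrow> 0 < mu Q"
    and U: "\<And>Q. Q \<in> S \<Longrightarrow> 0 < U Q" and V: "\<And>Q. Q \<in> S \<Longrightarrow> 0 < V Q"
    and x: "\<And>Q. Q \<in> S \<Longrightarrow> 0 < x Q" and y: "\<And>Q. Q \<in> S \<Longrightarrow> 0 < y Q"
    and car: "carleson_on S \<Lambda> mu" "carleson_on S (\<Lambda> * A) U" "carleson_on S (\<Lambda> * B) V"
    and sup: "superadditive_on S U" "superadditive_on S V" and AB: "0 < A" "0 < B" and K: "0 \<le> K"
      "\<And>Q. Q \<in> S \<Longrightarrow> mu Q powr a * U Q powr \<beta> * V Q powr \<gamma> \<le> K"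
    and XY: "\<And>S'. S' \<subseteq> S \<Longrightarrow> record_sum S' x p U \<le> X"
      "\<And>S'. S' \<subseteq> S \<Longrightarrow> record_sum S' y (q / (q - 1)) V \<le> Y"
  shows "(\<Sum>Q\<in>S. mu Q powr a * U Q powr (1 / p + \<beta>) * V Q powr (1 - 1 / q + \<gamma>) * x Q * y Q)
    \<le> two_weight_const d p q a \<beta> \<gamma> \<Lambda> * K * bracket d p q A B * (X powr (1 / p) * Y powr (1 - 1 / q))"
proof (cases d)
  case False
  define \<epsilon> where "\<epsilon> = (SOME \<epsilon>. admissible_exponent p q a \<beta> \<gamma> \<epsilon>)"
  have \<epsilon>: "0 < \<epsilon>" "0 < - a * \<epsilon>" "- a * \<epsilon> < 1" "\<epsilon> * \<beta> \<le> 1 / p" "\<epsilon> * \<gamma> \<le> 1 - 1 / q"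
      "1 \<le> 1 / p + (1 - 1 / q) - \<epsilon> * (a + \<beta> + \<gamma>)"
    using admissible_exponent_Eps[OF pq a d(2)[OF False]] unfolding \<epsilon>_def admissible_exponent_def by blast+
  define C where "C = 8 * (2 powr (1 + \<epsilon>) * (4 * \<Lambda> / (1 - 2 powr (a * \<epsilon>))))"
  have C: "two_weight_const d p q a \<beta> \<gamma> \<Lambda> = C * \<Lambda>"
    using False by (simp add: two_weight_const_def C_def \<epsilon>_def[symmetric] Let_def)
  have C0: "0 \<le> C"
  proof -
    have "2 powr (a * \<epsilon>) < (1::real)" using \<epsilon> by (intro powr_less_one) auto
    then show ?thesis using \<Lambda> by (simp add: C_def)
  qed
  have "(\<Sum>Q\<in>S. mu Q powr a * U Q powr (1 / p + \<beta>) * V Q powr (1 - 1 / q + \<gamma>) * x Q * y Q)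
      \<le> C * K * ((\<Lambda> * A) powr (1 / q) + (\<Lambda> * B) powr (1 - 1 / p)) * (X powr (1 / p) * Y powr (1 - 1 / q))"
    unfolding C_def using \<Lambda> by (intro two_weight_form_le[OF S U V x y car sup pq \<epsilon> _ K XY]) auto
  also have "\<dots> \<le> C * K * (\<Lambda> * bracket d p q A B) * (X powr (1 / p) * Y powr (1 - 1 / q))"
  proof (intro mult_right_mono mult_left_mono)
    have "(\<Lambda> * A) powr (1 / q) + (\<Lambda> * B) powr (1 - 1 / p) \<le> \<Lambda> * A powr (1 / q) + \<Lambda> * B powr (1 - 1 / p)"
      using \<Lambda> AB pq by (intro add_mono powr_mult_le) auto
    then show "(\<Lambda> * A) powr (1 / q) + (\<Lambda> * B) powr (1 - 1 / p) \<le> \<Lambda> * bracket d p q A B"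
      using False by (simp add: bracket_def distrib_left)
  qed (use C0 K in auto)
  finally show ?thesis unfolding C by (simp add: mult_ac)
next
  case True
  then have pq': "q = p" using d(1) by simp
  let ?R = "record_sum S x p U powr (1 / p) * record_sum S y (p / (p - 1)) V powr (1 - 1 / p)"
  have "(\<Sum>Q\<in>S. mu Q powr a * U Q powr (1 / p + \<beta>) * V Q powr (1 - 1 / q + \<gamma>) * x Q * y Q)
    \<le> (\<Sum>Q\<in>S. K * (U Q powr (1 / p) * V Q powr (1 - 1 / p) * x Q * y Q))"
  proof (rule sum_mono)
    fix Q assume Q: "Q \<in> S"
    have "mu Q powr a * U Q powr (1 / p + \<beta>) * V Q powr (1 - 1 / q + \<gamma>) * x Q * y Q
      = (mu Q powr a * U Q powr \<beta> * V Q powr \<gamma>) * (U Q powr (1 / p) * V Q powr (1 - 1 / p) * x Q * y Q)"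
      unfolding pq' powr_add by (simp only: mult_ac)
    also have "\<dots> \<le> K * (U Q powr (1 / p) * V Q powr (1 - 1 / p) * x Q * y Q)"
      using x[OF Q] y[OF Q] by (intro mult_right_mono K(2)[OF Q]) auto
    finally show "mu Q powr a * U Q powr (1 / p + \<beta>) * V Q powr (1 - 1 / q + \<gamma>) * x Q * y Q
      \<le> K * (U Q powr (1 / p) * V Q powr (1 - 1 / p) * x Q * y Q)" .
  qed
  also have "\<dots> = K * (\<Sum>Q\<in>S. U Q powr (1 / p) * V Q powr (1 - 1 / p) * x Q * y Q)" by (simp only: sum_distrib_left)
  also have "\<dots> \<le> K * (4 * ((\<Lambda> * A) powr (1 / p) * (\<Lambda> * B) powr (1 - 1 / p)) * ?R)"
    by (intro mult_left_mono bilinear_naive_le[OF S(1,2) U V x y car(2,3) sup pq(1)] K)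
  also have "\<dots> \<le> K * (4 * ((\<Lambda> * A powr (1 / p)) * (\<Lambda> * B powr (1 - 1 / p))) * (X powr (1 / p) * Y powr (1 - 1 / q)))"
  proof (intro mult_left_mono mult_mono powr_mult_le)
    have rs: "0 \<le> record_sum S x p U" "0 \<le> record_sum S y (p / (p - 1)) V"
      by (intro record_sum_nonneg less_imp_le U V; assumption)+
    show "record_sum S x p U powr (1 / p) \<le> X powr (1 / p)"
      using rs(1) XY(1)[of S] pq by (intro powr_mono2) auto
    show "record_sum S y (p / (p - 1)) V powr (1 - 1 / p) \<le> Y powr (1 - 1 / q)"
      unfolding pq' using rs(2) XY(2)[of S] pq by (intro powr_mono2) (auto simp: pq')
  qed (use \<Lambda> AB pq K in auto)
  also have "\<dots> = 4 * (\<Lambda> * \<Lambda>) * K * (A powr (1 / p) * B powr (1 - 1 / p)) * (X powr (1 / p) * Y powr (1 - 1 / q))" by simp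
  also have "\<dots> \<le> 4 * (\<Lambda> * \<Lambda>) * K * bracket d p q A B * (X powr (1 / p) * Y powr (1 - 1 / q))"
  proof (intro mult_right_mono mult_left_mono)
    show "A powr (1 / p) * B powr (1 - 1 / p) \<le> bracket d p q A B"
      using naive_le_bracket[OF AB, of p q] True by simp
  qed (use K in auto)
  finally show ?thesis using True by (simp add: two_weight_const_def)
qed

section \<open>Weighted norms, A_infinity constants and the discrete quantities\<close>

definition embedding_const :: "real \<Rightarrow> real \<Rightarrow> real" where
  "embedding_const p0 p = (let c = 1 / (1 - 2 powr (- (p - p0))) in 2 * c * (2 * c) powr (p / p0 - 1))"

lemma embedding_const_pos: "p0 < p \<Longrightarrow> 0 < embedding_const p0 p"
proof -
  assume "p0 < p"
  then have "2 powr (- (p - p0)) < (1::real)" by (intro powr_less_one) auto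
  then have "0 < 1 / (1 - 2 powr (- (p - p0)))" by simp
  then show ?thesis unfolding embedding_const_def Let_def by (intro mult_pos_pos powr_gt_zero[THEN iffD2]) auto
qed

text \<open>The exponent in u is chosen so that u^(1 - p/p0) = w, that is, |f|^p w = (|f|^p0 /
  u)^(p/p0) u. The same relation links \<sigma>, v and the exponents q0' < q', so this serves g as
  well.\<close>

lemma weighted_record_sum_le:
  fixes f :: "real ^ 'n \<Rightarrow> 'b::{real_normed_vector, second_countable_topology}" and w :: "real ^ 'n \<Rightarrow> real"
  assumes p: "0 < p0" "p0 < p"
    and f [measurable]: "f \<in> borel_measurable lebesgue"
    and w: "w \<in> borel_measurable lebesgue" "AE x in lebesgue. 0 < w x"
    and u_def: "u = (\<lambda>x. w x powr (p0 / (p0 - p)))"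
    and S: "finite S" "laminar S" "S \<subseteq> sets lebesgue"
    and U: "\<And>A. A \<in> S \<Longrightarrow> wmeas u A = ennreal (U A)" "\<And>A. A \<in> S \<Longrightarrow> 0 < U A"
    and Fi: "\<And>A. A \<in> S \<Longrightarrow> (\<integral>\<^sup>+x\<in>A. ennreal (norm (f x) powr p0) \<partial>lebesgue) = ennreal (Fi A)" "\<And>A. A \<in> S \<Longrightarrow> 0 < Fi A"
  shows "ennreal (record_sum S (\<lambda>A. (Fi A / U A) powr (1 / p0)) p U)
    \<le> ennreal (embedding_const p0 p) * (\<integral>\<^sup>+x. ennreal (norm (f x) powr p * w x) \<partial>lebesgue)"
proof -
  note [measurable] = w(1)
  have u [measurable]: "u \<in> borel_measurable lebesgue" unfolding u_def by measurable
  have "AE x in lebesgue. norm (f x) powr p * w x = (norm (f x) powr p0 / u x) powr (p / p0) * u x"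
    using w(2)
  proof eventually_elim
    case (elim x)
    have 1: "p0 / (p0 - p) * (p / p0) = p / (p0 - p)" "p0 / (p0 - p) - p / (p0 - p) = 1"
      using p by (simp_all flip: diff_divide_distrib)
    have "(norm (f x) powr p0 / u x) powr (p / p0) * u x = norm (f x) powr p * (u x / u x powr (p / p0))"
      using p by (simp add: powr_divide powr_powr)
    also have "u x / u x powr (p / p0) = w x powr (p0 / (p0 - p) - p / (p0 - p))"
      unfolding u_def powr_powr 1(1) by (simp only: powr_diff)
    also have "\<dots> = w x" unfolding 1 using elim by simp
    finally show ?case by simp
  qed
  then show ?thesis
    unfolding embedding_const_def Let_def
  proof (intro record_sum_embedding[OF p S, where F = "\<lambda>x. norm (f x) powr p0" and u = u and Fi = Fi])
    show "AE z in lebesgue. 0 < u z" using w(2) by eventually_elim (simp add: u_def)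
  qed (use U Fi in \<open>auto simp: wmeas_def\<close>)
qed

lemma wmeas_superadditive:
  assumes S: "finite S" "S \<subseteq> sets lebesgue" and u [measurable]: "u \<in> borel_measurable lebesgue"
    and U: "\<And>A. A \<in> S \<Longrightarrow> wmeas u A = ennreal (U A)" "\<And>A. A \<in> S \<Longrightarrow> 0 \<le> U A"
  shows "superadditive_on S U"
  unfolding superadditive_on_def
proof (intro ballI allI impI)
  fix B D assume B: "B \<in> S" and D: "D \<subseteq> S" "\<forall>Q\<in>D. Q \<subseteq> B" "pairwise disjnt D"
  have fin: "finite D" using D(1) S(1) by (rule finite_subset)
  have disj: "disjoint_family_on (\<lambda>Q. Q) D" using D(3) by (simp add: disjoint_family_on_def pairwise_def disjnt_def)
  have "ennreal (\<Sum>Q\<in>D. U Q) = (\<Sum>Q\<in>D. ennreal (U Q))" using U(2) D(1) by (intro sum_ennreal[symmetric]) auto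
  also have "\<dots> = (\<Sum>Q\<in>D. wmeas u Q)" using U(1) D(1) by (intro sum.cong) auto
  also have "\<dots> = (\<integral>\<^sup>+x. (\<Sum>Q\<in>D. ennreal (u x) * indicator Q x) \<partial>lebesgue)"
    unfolding wmeas_def using S(2) D(1) by (intro nn_integral_sum[symmetric]) auto
  also have "\<dots> = (\<integral>\<^sup>+x\<in>(\<Union>Q\<in>D. Q). ennreal (u x) \<partial>lebesgue)"
  proof (rule nn_integral_cong)
    fix x
    have "(\<Sum>Q\<in>D. indicator Q x :: ennreal) = indicator (\<Union>Q\<in>D. Q) x"
      by (rule indicator_UN_disjoint[OF fin disj, symmetric])
    then show "(\<Sum>Q\<in>D. ennreal (u x) * indicator Q x) = ennreal (u x) * indicator (\<Union>Q\<in>D. Q) x"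
      by (simp only: sum_distrib_left[symmetric])
  qed
  also have "\<dots> \<le> wmeas u B"
    unfolding wmeas_def using D(2) by (intro nn_integral_mono) (auto simp: indicator_def)
  also have "\<dots> = ennreal (U B)" by (rule U(1)[OF B])
  finally show "(\<Sum>Q\<in>D. U Q) \<le> U B" using U(2)[OF B] by (simp add: ennreal_le_iff)
qed

lemma HL_maximal_ge:
  assumes "0 < l" "x \<in> cube c l" "cube c l \<subseteq> R"
    and u: "\<And>x. 0 \<le> u x" "wmeas u (cube c l) = ennreal m" "0 \<le> m" and v: "emeasure lebesgue (cube c l) = ennreal v" "0 < v"
  shows "ennreal (m / v) \<le> HL_maximal (restrict_fun R u) x"
proof -
  have "(\<integral>\<^sup>+x\<in>cube c l. ennreal (norm (restrict_fun R u x) powr 1) \<partial>lebesgue) = wmeas u (cube c l)"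
    unfolding wmeas_def using assms(3) u(1)
    by (intro nn_integral_cong) (auto simp: restrict_fun_def indicator_def)
  then have "avg 1 (cube c l) (restrict_fun R u) = epowr (ennreal m / ennreal v) 1"
    unfolding avg_def u(2) v(1) by simp
  also have "\<dots> = ennreal (m / v)" using u(3) v(2) by (simp add: divide_ennreal epowr_ennreal)
  finally have "ennreal (m / v) = avg 1 (cube c l) (restrict_fun R u)" by simp
  also have "\<dots> \<le> HL_maximal (restrict_fun R u) x"
    unfolding HL_maximal_def by (rule SUP_upper2[of "(c, l)"]) (use assms in auto)
  finally show ?thesis .
qed

lemma A_infinity_const_bound:
  assumes l: "0 < l" and u: "wmeas u (cube c l) = ennreal m" "0 < m" and A: "A_infinity_const u \<le> ennreal A" "0 \<le> A"
  shows "(\<integral>\<^sup>+x\<in>cube c l. HL_maximal (restrict_fun (cube c l) u) x \<partial>lebesgue) \<le> ennreal (A * m)"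
proof -
  let ?I = "\<integral>\<^sup>+x\<in>cube c l. HL_maximal (restrict_fun (cube c l) u) x \<partial>lebesgue"
  have "?I / wmeas u (cube c l) \<le> A_infinity_const u"
    unfolding A_infinity_const_def by (rule SUP_upper2[of "(c, l)"]) (use l in auto)
  then have "?I / ennreal m \<le> ennreal A" using A(1) unfolding u(1) by (rule order_trans)
  then have "?I / ennreal m * ennreal m \<le> ennreal A * ennreal m" by (intro mult_right_mono) auto
  also have "?I / ennreal m * ennreal m = ?I" using u(2) by (simp add: ennreal_divide_times mult_divide_eq_ennreal)
  finally show ?thesis using A(2) u(2) by (simp add: ennreal_mult)
qed

text \<open>On a cube the maximal function is at least the average over that same cube. The lower
  bound keeps the product of an infinite and a finite A_infinity constant infinite.\<close>

lemma A_infinity_const_ge_1: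
  assumes u: "\<And>x. 0 \<le> u x" "\<And>c l. 0 < l \<Longrightarrow> wmeas u (cube c l) < \<infinity>" "\<And>c l. 0 < l \<Longrightarrow> 0 < wmeas u (cube c l)"
  shows "1 \<le> A_infinity_const (u :: real ^ 'n \<Rightarrow> real)"
proof -
  define Q where "Q = cube (0 :: real ^ 'n) 1"
  have v: "emeasure lebesgue Q = ennreal 1" unfolding Q_def by (subst emeasure_cube) auto
  obtain m where m: "wmeas u Q = ennreal m" "0 \<le> m"
    using u(2)[of 1 0] unfolding Q_def by (cases "wmeas u (cube (0 :: real ^ 'n) 1)") auto
  have m0: "0 < m" using u(3)[of 1 0] m unfolding Q_def by simp
  have "ennreal m = (\<integral>\<^sup>+x. ennreal (m / 1) * indicator Q x \<partial>lebesgue)"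
    using v by (subst nn_integral_cmult_indicator) (auto simp: Q_def)
  also have "\<dots> \<le> (\<integral>\<^sup>+x\<in>Q. HL_maximal (restrict_fun Q u) x \<partial>lebesgue)"
  proof (intro nn_integral_mono)
    fix x
    show "ennreal (m / 1) * indicator Q x \<le> HL_maximal (restrict_fun Q u) x * indicator Q x"
      using HL_maximal_ge[of 1 x 0 Q u m 1] u(1) m v by (auto simp: Q_def[symmetric] indicator_def simp del: emeasure_completion)
  qed
  finally have "wmeas u Q / wmeas u Q \<le> (\<integral>\<^sup>+x\<in>Q. HL_maximal (restrict_fun Q u) x \<partial>lebesgue) / wmeas u Q"
    unfolding m(1) by (rule divide_right_mono_ennreal)
  also have "\<dots> \<le> A_infinity_const u"
    unfolding A_infinity_const_def Q_def by (rule SUP_upper2[of "(0, 1)"]) auto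
  also have "wmeas u Q / wmeas u Q = 1" using m0 unfolding m(1) by (simp add: ennreal_divide_self)
  finally show ?thesis .
qed

section \<open>Carleson constants of the tree and the weighted bound for the sparse form\<close>

context dyadic_operator
begin

text \<open>Sparseness in the form in which it is used: the sets \<open>major q\<close> are disjoint
  and fill at least half of their cubes, so a sum over cubes becomes an integral.\<close>

lemma sum_major_le:
  assumes F: "finite F" "F \<subseteq> tree r" and k: "\<And>q. q \<in> F \<Longrightarrow> 0 \<le> k q"
    and H: "\<And>q x. q \<in> F \<Longrightarrow> x \<in> major q \<Longrightarrow> ennreal (k q) \<le> H x"
  shows "ennreal (\<Sum>q\<in>F. k q * (vol q / 2)) \<le> (\<integral>\<^sup>+x. H x \<partial>lebesgue)"
proof -
  have "ennreal (\<Sum>q\<in>F. k q * (vol q / 2)) = (\<Sum>q\<in>F. ennreal (k q * (vol q / 2)))"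
    using k vol_pos by (intro sum_ennreal[symmetric]) (simp add: less_imp_le)
  also have "\<dots> = (\<Sum>q\<in>F. ennreal (k q) * ennreal (vol q / 2))"
    by (intro sum.cong refl ennreal_mult' k)
  also have "\<dots> \<le> (\<Sum>q\<in>F. ennreal (k q) * emeasure lebesgue (major q))"
    by (intro sum_mono mult_left_mono emeasure_major) auto
  also have "\<dots> = (\<integral>\<^sup>+x. (\<Sum>q\<in>F. ennreal (k q) * indicator (major q) x) \<partial>lebesgue)"
    by (subst nn_integral_sum) (auto simp: nn_integral_cmult_indicator)
  also have "\<dots> \<le> (\<integral>\<^sup>+x. H x \<partial>lebesgue)"
  proof (rule nn_integral_mono)
    fix x
    show "(\<Sum>q\<in>F. ennreal (k q) * indicator (major q) x) \<le> H x"
    proof (cases "\<exists>q\<in>F. x \<in> major q")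
      case False
      then have "(\<Sum>q\<in>F. ennreal (k q) * indicator (major q) x) = 0" by (intro sum.neutral) auto
      then show ?thesis by simp
    next
      case True
      then obtain q where q: "q \<in> F" "x \<in> major q" by blast
      have "x \<notin> major q'" if "q' \<in> F" "q' \<noteq> q" for q'
      proof -
        have "major q' \<inter> major q = {}"
          using that q F(2) by (intro disjoint_family_onD[OF major_disjoint[of r]]) auto
        then show ?thesis using q by blast
      qed
      then have 0: "(\<Sum>q'\<in>F - {q}. ennreal (k q') * indicator (major q') x) = 0" by (intro sum.neutral) auto
      have "(\<Sum>q\<in>F. ennreal (k q) * indicator (major q) x)
         = ennreal (k q) * indicator (major q) x + (\<Sum>q'\<in>F - {q}. ennreal (k q') * indicator (major q') x)"
        by (rule sum.remove[OF F(1) q(1)])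
      also have "\<dots> = ennreal (k q)" unfolding 0 using q(2) by simp
      finally show ?thesis using H[OF q] by simp
    qed
  qed
  finally show ?thesis .
qed

text \<open>The 2 comes from \<open>emeasure_major\<close>, the power of 3 from the ratio of the
  measures of a triple and its cube.\<close>

definition carleson_const :: real where
  "carleson_const = 2 * 3 ^ CARD('n)"

lemma carleson_const_ge_1: "1 \<le> carleson_const"
proof -
  have "(1::real) \<le> 3 ^ CARD('n)" by (intro one_le_power) auto
  then show ?thesis unfolding carleson_const_def by linarith
qed

lemma measure_trip: "measure lebesgue (trip q) = 3 ^ CARD('n) * vol q"
  unfolding measure_def emeasure_trip_vol using vol_pos[of q] by (simp add: less_imp_le)

lemma sum_trip_subset:
  fixes h :: "(real ^ 'n) set \<Rightarrow> real"
  shows "(\<Sum>A\<in>{A \<in> trip ` F. A \<subseteq> R}. h A) = (\<Sum>q\<in>{q \<in> F. trip q \<subseteq> R}. h (trip q))"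
proof -
  have "{A \<in> trip ` F. A \<subseteq> R} = trip ` {q \<in> F. trip q \<subseteq> R}" by auto
  then show ?thesis using inj_on_subset[OF inj_trip subset_UNIV] by (simp add: sum.reindex)
qed

lemma carleson_trip_vol:
  assumes F: "finite F" "F \<subseteq> tree r"
  shows "carleson_on (trip ` F) carleson_const (measure lebesgue)"
  unfolding carleson_on_def
proof
  fix R assume "R \<in> trip ` F"
  then obtain q' where R: "R = trip q'" by blast
  let ?F = "{q \<in> F. trip q \<subseteq> R}"
  have "ennreal (\<Sum>q\<in>?F. 1 * (vol q / 2)) \<le> (\<integral>\<^sup>+x. indicator R x \<partial>lebesgue)"
  proof (rule sum_major_le[where r = r])
    fix q x assume "q \<in> ?F" "x \<in> major q"
    then have "x \<in> R" using major_subset[of q] dyad_subset_trip[of q] by blast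
    then show "ennreal 1 \<le> indicator R x" by simp
  qed (use F in auto)
  also have "\<dots> = ennreal (3 ^ CARD('n) * vol q')"
    unfolding R using emeasure_trip_vol by (subst nn_integral_indicator) auto
  finally have le: "(\<Sum>q\<in>?F. vol q / 2) \<le> 3 ^ CARD('n) * vol q'"
    using vol_pos[of q'] by (simp add: ennreal_le_iff less_imp_le)
  have "(\<Sum>A\<in>{A \<in> trip ` F. A \<subseteq> R}. measure lebesgue A) = carleson_const * (\<Sum>q\<in>?F. vol q / 2)"
    unfolding sum_trip_subset measure_trip by (simp add: carleson_const_def sum_distrib_left)
  also have "\<dots> \<le> carleson_const * (3 ^ CARD('n) * vol q')" using le carleson_const_ge_1 by (intro mult_left_mono) auto
  also have "3 ^ CARD('n) * vol q' = measure lebesgue R" by (simp add: R measure_trip)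
  finally show "(\<Sum>A\<in>{A \<in> trip ` F. A \<subseteq> R}. measure lebesgue A) \<le> carleson_const * measure lebesgue R" .
qed

text \<open>On \<open>major q\<close> the maximal function of u restricted to R dominates the
  average of u over the triple of q. Integration over R turns the sum of the weights of the triples
  into the quantity that defines the A_infinity constant.\<close>

lemma carleson_trip_weight:
  assumes F: "finite F" "F \<subseteq> tree r" and u: "\<And>x. 0 \<le> u x"
    and U: "\<And>q. wmeas u (trip q) = ennreal (U (trip q))" "\<And>q. 0 < U (trip q)"
    and A: "A_infinity_const u \<le> ennreal A" "0 \<le> A"
  shows "carleson_on (trip ` F) (carleson_const * A) U"
  unfolding carleson_on_def
proof
  fix R assume "R \<in> trip ` F"
  then obtain q' where R: "R = trip q'" by blast
  let ?F = "{q \<in> F. trip q \<subseteq> R}"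
  let ?k = "3 ^ CARD('n) :: real"
  have "ennreal (\<Sum>q\<in>?F. (U (trip q) / (?k * vol q)) * (vol q / 2)) \<le> (\<integral>\<^sup>+x\<in>R. HL_maximal (restrict_fun R u) x \<partial>lebesgue)"
  proof (rule sum_major_le[where r = r])
    show "0 \<le> U (trip q) / (?k * vol q)" for q using U(2)[of q] vol_pos[of q] by simp
    fix q x assume q: "q \<in> ?F" "x \<in> major q"
    then have x: "x \<in> trip q" "x \<in> R" "trip q \<subseteq> R" using major_subset[of q] dyad_subset_trip[of q] by auto
    have "ennreal (U (trip q) / (?k * vol q)) \<le> HL_maximal (restrict_fun R u) x"
    proof (rule HL_maximal_ge[of "3 * side (fst q)" x "centre q", folded trip_def])
      show "wmeas u (trip q) = ennreal (U (trip q))" by (rule U(1))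
      show "emeasure lebesgue (trip q) = ennreal (?k * vol q)" by (rule emeasure_trip_vol)
      show "0 \<le> U (trip q)" using U(2)[of q] by simp
    qed (use x u side_pos vol_pos in auto)
    then show "ennreal (U (trip q) / (?k * vol q)) \<le> HL_maximal (restrict_fun R u) x * indicator R x"
      using x(2) by simp
  qed (use F in auto)
  also have "\<dots> \<le> ennreal (A * U R)"
    unfolding R trip_def
    by (rule A_infinity_const_bound[OF _ _ _ A]) (use side_pos U in \<open>auto simp: trip_def[symmetric]\<close>)
  finally have le: "(\<Sum>q\<in>?F. (U (trip q) / (?k * vol q)) * (vol q / 2)) \<le> A * U R"
    using A(2) U(2)[of q'] by (simp add: R ennreal_le_iff less_imp_le)
  have "(\<Sum>A\<in>{A \<in> trip ` F. A \<subseteq> R}. U A) = carleson_const * (\<Sum>q\<in>?F. (U (trip q) / (?k * vol q)) * (vol q / 2))"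
    unfolding sum_trip_subset sum_distrib_left
    by (intro sum.cong refl) (use vol_pos in \<open>auto simp: carleson_const_def less_imp_neq[symmetric]\<close>)
  also have "\<dots> \<le> carleson_const * (A * U R)" using le carleson_const_ge_1 by (intro mult_left_mono) auto
  finally show "(\<Sum>A\<in>{A \<in> trip ` F. A \<subseteq> R}. U A) \<le> carleson_const * A * U R" by simp
qed

lemma laminar_trips: "laminar (trip ` {q \<in> F. residue q = \<rho>})"
  unfolding laminar_def
proof (intro conjI ballI)
  show "{} \<notin> trip ` {q \<in> F. residue q = \<rho>}" using trip_nonempty by blast
  fix A B assume "A \<in> trip ` {q \<in> F. residue q = \<rho>}" "B \<in> trip ` {q \<in> F. residue q = \<rho>}"
  then obtain q q' where q: "A = trip q" "B = trip q'" "residue q = residue q'" by auto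
  show "A \<subseteq> B \<or> B \<subseteq> A \<or> A \<inter> B = {}"
  proof (cases "A \<inter> B = {}")
    case False
    consider "fst q \<le> fst q'" | "fst q' \<le> fst q" by linarith
    then show ?thesis
    proof cases
      case 1
      then show ?thesis using trip_nested[of q q'] False q by simp
    next
      case 2
      then show ?thesis using trip_nested[of q' q] False q by (simp add: Int_commute)
    qed
  qed simp
qed


definition gmass :: "(real ^ 'n \<Rightarrow> 'b) \<Rightarrow> nat \<times> (int ^ 'n) \<Rightarrow> real" where
  "gmass g q = enn2real (\<integral>\<^sup>+x\<in>trip q. ennreal (norm (g x) powr (1 / (1 - e))) \<partial>lebesgue)"

lemma gmass_nonneg: "0 \<le> gmass g q"
  by (simp add: gmass_def)

lemma nn_integral_gmass:
  assumes "(\<integral>\<^sup>+x. ennreal (norm (g x) powr (1 / (1 - e))) \<partial>lebesgue) < \<infinity>"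
  shows "(\<integral>\<^sup>+x\<in>trip q. ennreal (norm (g x) powr (1 / (1 - e))) \<partial>lebesgue) = ennreal (gmass g q)"
proof -
  have "(\<integral>\<^sup>+x\<in>trip q. ennreal (norm (g x) powr (1 / (1 - e))) \<partial>lebesgue) \<le> (\<integral>\<^sup>+x. ennreal (norm (g x) powr (1 / (1 - e))) \<partial>lebesgue)"
    by (intro nn_integral_mono) (auto simp: indicator_def)
  then have "(\<integral>\<^sup>+x\<in>trip q. ennreal (norm (g x) powr (1 / (1 - e))) \<partial>lebesgue) < \<infinity>"
    using assms by (rule order_le_less_trans)
  then show ?thesis by (simp add: gmass_def)
qed

text \<open>The average of g is moved from Q to its triple, so that both functions live on the same
  laminar families. Collecting the powers of |3Q| produces the exponent a.\<close>

lemma form_term_le: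
  assumes g [measurable]: "g \<in> borel_measurable lebesgue"
    and gint: "(\<integral>\<^sup>+x. ennreal (norm (g x) powr (1 / (1 - e))) \<partial>lebesgue) < \<infinity>"
  shows "form_term (\<lambda>x. norm (g x)) q
    \<le> measure lebesgue (trip q) powr (\<alpha> / real CARD('n) - 1 / p0 + e) * mass q powr (1 / p0) * gmass g q powr (1 - e)"
proof -
  define m where "m = 3 ^ CARD('n) * vol q"
  have m: "0 < m" "vol q \<le> m" using vol_pos[of q] by (auto simp: m_def)
  have "Jint (\<lambda>x. norm (g x)) q \<le> gmass g q"
  proof -
    have "(\<integral>\<^sup>+x\<in>dyad q. ennreal (norm (g x) powr (1 / (1 - e))) \<partial>lebesgue) \<le> (\<integral>\<^sup>+x\<in>trip q. ennreal (norm (g x) powr (1 / (1 - e))) \<partial>lebesgue)"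
      using dyad_subset_trip[of q] by (intro nn_integral_mono) (auto simp: indicator_def)
    then show ?thesis unfolding Jint_def gmass_def
      by (intro enn2real_mono) (simp_all add: nn_integral_gmass[OF gint])
  qed
  then have "vol q powr e * Jint (\<lambda>x. norm (g x)) q powr (1 - e) \<le> m powr e * gmass g q powr (1 - e)"
    using m vol_pos[of q] e01 by (intro mult_mono powr_mono2) (auto simp: Jint_def)
  then have "form_term (\<lambda>x. norm (g x)) q \<le> amp q * (m powr e * gmass g q powr (1 - e))"
    unfolding form_term_def by (intro mult_left_mono amp_nonneg)
  also have "amp q = m powr (\<alpha> / real CARD('n) - 1 / p0) * mass q powr (1 / p0)"
    unfolding amp_def m_def[symmetric] by (simp add: powr_divide powr_diff)
  also have "m powr (\<alpha> / real CARD('n) - 1 / p0) * mass q powr (1 / p0) * (m powr e * gmass g q powr (1 - e))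
    = m powr (\<alpha> / real CARD('n) - 1 / p0 + e) * mass q powr (1 / p0) * gmass g q powr (1 - e)"
    by (simp add: powr_add)
  finally show ?thesis by (simp add: measure_trip m_def)
qed

text \<open>\<open>T\<close> may distinguish functions that agree almost everywhere, so this has to
  be derived: all terms of the sparse form vanish. It covers the case where the norm of f is 0 and
  that of g is infinite.\<close>

lemma zero_bound:
  assumes f0: "AE x in lebesgue. f x = 0"
    and g: "g \<in> borel_measurable lebesgue" "(\<integral>\<^sup>+x. ennreal (norm (g x) powr (1 / (1 - e))) \<partial>lebesgue) < \<infinity>"
  shows "(\<integral>\<^sup>+x\<in>dyad r. ennreal (norm (T (loc r) x) * norm (g x)) \<partial>lebesgue) = 0"
proof -
  have "mass q = 0" for q
  proof -
    have "(\<integral>\<^sup>+x\<in>trip q. ennreal (norm (f x) powr p0) \<partial>lebesgue) = (\<integral>\<^sup>+x. 0 \<partial>(lebesgue :: (real ^ 'n) measure))"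
      using f0 by (intro nn_integral_cong_AE) (auto elim!: eventually_mono)
    then show ?thesis by (simp add: mass_def)
  qed
  then have "amp q = 0" for q using p0 by (simp add: amp_def)
  then have "form_term G q = 0" for G q by (simp add: form_term_def)
  then have "(\<integral>\<^sup>+x\<in>dyad r. ennreal (norm (T (loc r) x) * norm (g x)) \<partial>lebesgue) \<le> ennreal ((cT + step_const) * 0)"
    using g by (intro sparse_domination[where G = "\<lambda>x. norm (g x)"]) auto
  then show ?thesis by simp
qed

text \<open>Since 1/p0 = 1/p + \<beta> and 1 - e = 1 - 1/q + \<gamma>, the masses of f and g on a
  triple factor into powers of U and V times the values x and y, whose principal sets are bounded by
  the weighted norms. Each residue class then has the form of
  \<open>discrete_two_weight_bound\<close>, and the number of classes is dimensional.\<close>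

lemma weighted_bound:
  fixes g :: "real ^ 'n \<Rightarrow> 'b" and \<omega> \<sigma> u v :: "real ^ 'n \<Rightarrow> real"
  assumes p: "p0 < p" "p \<le> q" "e < 1 / q"
    and a_def: "a = \<alpha> / real CARD('n) - 1 / p0 + e" and a: "a < 0"
    and d: "d \<Longrightarrow> p = q" "\<not> d \<Longrightarrow> p < q \<or> a + (1 / p0 - 1 / p) + (1 / q - e) = 0"
    and g [measurable]: "g \<in> borel_measurable lebesgue"
    and gint: "(\<integral>\<^sup>+x. ennreal (norm (g x) powr (1 / (1 - e))) \<partial>lebesgue) < \<infinity>"
    and \<omega>: "\<omega> \<in> borel_measurable lebesgue" "AE x in lebesgue. 0 < \<omega> x"
    and \<sigma>: "\<sigma> \<in> borel_measurable lebesgue" "AE x in lebesgue. 0 < \<sigma> x"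
    and u_def: "u = (\<lambda>x. \<omega> x powr (p0 / (p0 - p)))"
    and v_def: "v = (\<lambda>x. \<sigma> x powr ((1 / (1 - e)) / (1 / (1 - e) - q / (q - 1))))"
    and U: "\<And>c l. 0 < l \<Longrightarrow> wmeas u (cube c l) = ennreal (U (cube c l))" "\<And>c l. 0 < l \<Longrightarrow> 0 < U (cube c l)"
    and V: "\<And>c l. 0 < l \<Longrightarrow> wmeas v (cube c l) = ennreal (V (cube c l))" "\<And>c l. 0 < l \<Longrightarrow> 0 < V (cube c l)"
    and A: "A_infinity_const u = ennreal A" "0 < A" and B: "A_infinity_const v = ennreal B" "0 < B"
    and K: "\<And>c l. 0 < l \<Longrightarrow> measure lebesgue (cube c l) powr a * U (cube c l) powr (1 / p0 - 1 / p) * V (cube c l) powr (1 / q - e) \<le> K"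
      "0 \<le> K"
    and X: "(\<integral>\<^sup>+x. ennreal (norm (f x) powr p * \<omega> x) \<partial>lebesgue) = ennreal X" "0 \<le> X"
    and Y: "(\<integral>\<^sup>+x. ennreal (norm (g x) powr (q / (q - 1)) * \<sigma> x) \<partial>lebesgue) = ennreal Y" "0 \<le> Y"
  shows "(\<integral>\<^sup>+x\<in>dyad r. ennreal (norm (T (loc r) x) * norm (g x)) \<partial>lebesgue)
    \<le> ennreal ((cT + step_const) * (real (card residues_set) *
        (two_weight_const d p q a (1 / p0 - 1 / p) (1 / q - e) carleson_const * K * bracket d p q A B
          * ((embedding_const p0 p * X) powr (1 / p) * (embedding_const (1 / (1 - e)) (q / (q - 1)) * Y) powr (1 - 1 / q)))))"
    (is "_ \<le> ennreal ((cT + step_const) * (_ * ?B))")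
proof (rule sparse_domination)
  define s0 where "s0 = 1 / (1 - e)"
  define q' where "q' = q / (q - 1)"
  have p1: "1 < p" "1 < q" using p p0 by auto
  have s0: "0 < s0" "1 / s0 = 1 - e" using e01 by (auto simp: s0_def)
  have q': "s0 < q'"
  proof -
    have "1 / q' = 1 - 1 / q" using p1 by (simp add: q'_def field_simps)
    then have "1 / q' < 1 / s0" using p(3) by (simp add: s0)
    moreover have "0 < q'" using p1 by (simp add: q'_def)
    ultimately show ?thesis using s0(1) by (simp add: field_simps)
  qed
  have um [measurable]: "u \<in> borel_measurable lebesgue" and vm [measurable]: "v \<in> borel_measurable lebesgue"
    using \<omega>(1) \<sigma>(1) unfolding u_def v_def by measurable
  have Ut: "wmeas u (trip i) = ennreal (U (trip i))" "0 < U (trip i)"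
    and Vt: "wmeas v (trip i) = ennreal (V (trip i))" "0 < V (trip i)"
    and Kt: "measure lebesgue (trip i) powr a * U (trip i) powr (1 / p0 - 1 / p) * V (trip i) powr (1 / q - e) \<le> K" for i
    unfolding trip_def using side_pos by (intro U V K(1); simp)+
  have u0: "0 \<le> u z" "0 \<le> v z" for z by (simp_all add: u_def v_def)
  have E: "0 < embedding_const p0 p" "0 < embedding_const s0 q'"
    using p(1) q' by (auto intro: embedding_const_pos)
  have B0: "0 \<le> ?B"
    using two_weight_const_nonneg[OF p1(1) p(2) a carleson_const_ge_1 d(2)] K(2) bracket_nonneg by simp
  fix F assume F: "finite F" "F \<subseteq> tree r"
  define t where "t = (\<lambda>i. measure lebesgue (trip i) powr a * mass i powr (1 / p0) * gmass g i powr (1 - e))"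
  \<comment> \<open>Terms with a vanishing mass are zero and are removed, because the levels of x
    and y are logarithms and need positive arguments.\<close>
  define F0 where "F0 = {i \<in> F. 0 < mass i \<and> 0 < gmass g i}"
  have F0: "finite F0" "F0 \<subseteq> F" using F by (auto simp: F0_def)
  have residue_class: "(\<Sum>i\<in>{i \<in> F0. residue i = \<rho>}. t i) \<le> ?B" for \<rho>
  proof -
    define F1 where "F1 = {i \<in> F0. residue i = \<rho>}"
    define S where "S = trip ` F1"
    define Fi where "Fi = (\<lambda>A. enn2real (\<integral>\<^sup>+x\<in>A. ennreal (norm (f x) powr p0) \<partial>lebesgue))"
    define Gi where "Gi = (\<lambda>A. enn2real (\<integral>\<^sup>+x\<in>A. ennreal (norm (g x) powr s0) \<partial>lebesgue))"
    define x where "x = (\<lambda>A. (Fi A / U A) powr (1 / p0))"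
    define y where "y = (\<lambda>A. (Gi A / V A) powr (1 / s0))"
    have F1: "finite F1" "F1 \<subseteq> tree r" using F0 F by (auto simp: F1_def)
    have S: "finite S" "S \<subseteq> sets lebesgue" using F1 by (auto simp: S_def)
    have lam: "laminar S" unfolding S_def F1_def by (rule laminar_trips)
    have Fi_trip: "Fi (trip i) = mass i" and Gi_trip: "Gi (trip i) = gmass g i" for i
      by (simp_all add: Fi_def Gi_def mass_def gmass_def s0_def)
    have in_S: "0 < measure lebesgue Q" "wmeas u Q = ennreal (U Q)" "0 < U Q" "wmeas v Q = ennreal (V Q)" "0 < V Q"
      "(\<integral>\<^sup>+x\<in>Q. ennreal (norm (f x) powr p0) \<partial>lebesgue) = ennreal (Fi Q)" "0 < Fi Q"
      "(\<integral>\<^sup>+x\<in>Q. ennreal (norm (g x) powr s0) \<partial>lebesgue) = ennreal (Gi Q)" "0 < Gi Q"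
      "measure lebesgue Q powr a * U Q powr (1 / p0 - 1 / p) * V Q powr (1 / q - e) \<le> K"
      if "Q \<in> S" for Q
    proof -
      obtain i where "i \<in> F1" and iQ: "Q = trip i" using \<open>Q \<in> S\<close> unfolding S_def by blast
      then have i: "Q = trip i" "0 < mass i" "0 < gmass g i" by (simp_all add: F1_def F0_def)
      show "0 < measure lebesgue Q" unfolding i measure_trip using vol_pos[of i] by simp
      show "wmeas u Q = ennreal (U Q)" "0 < U Q" "wmeas v Q = ennreal (V Q)" "0 < V Q"
        "measure lebesgue Q powr a * U Q powr (1 / p0 - 1 / p) * V Q powr (1 / q - e) \<le> K"
        unfolding i by (rule Ut Vt Kt)+
      show "(\<integral>\<^sup>+x\<in>Q. ennreal (norm (f x) powr p0) \<partial>lebesgue) = ennreal (Fi Q)" "0 < Fi Q"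
        unfolding i Fi_trip by (rule nn_integral_mass i(2))+
      show "(\<integral>\<^sup>+x\<in>Q. ennreal (norm (g x) powr s0) \<partial>lebesgue) = ennreal (Gi Q)" "0 < Gi Q"
        unfolding i Gi_trip s0_def by (rule nn_integral_gmass[OF gint] i(3))+
    qed
    \<comment> \<open>The exponents are left unsimplified to match the two-weight form, in which
      U^\<beta> V^\<gamma> belongs to the characteristic.\<close>
    have "(\<Sum>i\<in>F1. t i) = (\<Sum>i\<in>F1. (\<lambda>Q. measure lebesgue Q powr a * U Q powr (1 / p + (1 / p0 - 1 / p)) *
        V Q powr (1 - 1 / q + (1 / q - e)) * x Q * y Q) (trip i))"
    proof (rule sum.cong[OF refl])
      fix i assume "i \<in> F1"
      then have "trip i \<in> S" by (simp add: S_def)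
      note Q = in_S(3,5,7,9)[OF this]
      have 1: "U (trip i) powr (1 / p0) * x (trip i) = mass i powr (1 / p0)"
        using Q unfolding x_def Fi_trip by (simp add: powr_divide)
      have 2: "V (trip i) powr (1 - e) * y (trip i) = gmass g i powr (1 - e)"
        using Q unfolding y_def Gi_trip s0(2) by (simp add: powr_divide)
      have 3: "1 / p + (1 / p0 - 1 / p) = 1 / p0" "1 - 1 / q + (1 / q - e) = 1 - e" by simp_all
      show "t i = (\<lambda>Q. measure lebesgue Q powr a * U Q powr (1 / p + (1 / p0 - 1 / p)) *
        V Q powr (1 - 1 / q + (1 / q - e)) * x Q * y Q) (trip i)"
        unfolding t_def 3 1[symmetric] 2[symmetric] by (simp only: mult_ac)
    qed
    also have "\<dots> = (\<Sum>Q\<in>S. measure lebesgue Q powr a * U Q powr (1 / p + (1 / p0 - 1 / p)) *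
        V Q powr (1 - 1 / q + (1 / q - e)) * x Q * y Q)"
      unfolding S_def by (rule sum.reindex_cong[OF inj_on_subset[OF inj_trip subset_UNIV] refl, symmetric]) simp
    also have "\<dots> \<le> ?B"
    proof (rule discrete_two_weight_bound[OF p1(1) p(2) a carleson_const_ge_1 d S(1) lam in_S(1,3,5)])
      show "0 < x Q" if "Q \<in> S" for Q using in_S(3,7)[OF that] by (simp add: x_def)
      show "0 < y Q" if "Q \<in> S" for Q using in_S(5,9)[OF that] by (simp add: y_def)
      show "carleson_on S carleson_const (measure lebesgue)" unfolding S_def by (rule carleson_trip_vol[OF F1])
      show "carleson_on S (carleson_const * A) U"
        unfolding S_def using A by (intro carleson_trip_weight[OF F1 u0(1) Ut]) auto
      show "carleson_on S (carleson_const * B) V"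
        unfolding S_def using B by (intro carleson_trip_weight[OF F1 u0(2) Vt]) auto
      show "superadditive_on S U" "superadditive_on S V"
        by (rule wmeas_superadditive[OF S um]; simp add: in_S less_imp_le)
          (rule wmeas_superadditive[OF S vm]; simp add: in_S less_imp_le)
      show "record_sum S' x p U \<le> embedding_const p0 p * X" if "S' \<subseteq> S" for S'
      proof -
        have S': "Q \<in> S" if "Q \<in> S'" for Q using \<open>S' \<subseteq> S\<close> that by auto
        have "ennreal (record_sum S' x p U) \<le> ennreal (embedding_const p0 p) * ennreal X"
          unfolding x_def X(1)[symmetric]
          by (rule weighted_record_sum_le[OF _ p(1) f_meas \<omega> u_def])
            (use p0 S that finite_subset[OF that S(1)] laminar_subset[OF lam that] in_S[OF S'] in auto)
        also have "\<dots> = ennreal (embedding_const p0 p * X)" using E by (simp add: ennreal_mult' less_imp_le)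
        finally show ?thesis using E X(2) by (subst (asm) ennreal_le_iff) auto
      qed
      show "record_sum S' y (q / (q - 1)) V \<le> embedding_const (1 / (1 - e)) (q / (q - 1)) * Y" if "S' \<subseteq> S" for S'
      proof -
        have S': "Q \<in> S" if "Q \<in> S'" for Q using \<open>S' \<subseteq> S\<close> that by auto
        have "ennreal (record_sum S' y q' V) \<le> ennreal (embedding_const s0 q') * ennreal Y"
          unfolding y_def Y(1)[symmetric] q'_def[symmetric]
          by (rule weighted_record_sum_le[OF s0(1) q' g \<sigma> v_def[folded s0_def q'_def]])
            (use S that finite_subset[OF that S(1)] laminar_subset[OF lam that] in_S[OF S'] in auto)
        also have "\<dots> = ennreal (embedding_const s0 q' * Y)" using E by (simp add: ennreal_mult' less_imp_le)
        finally show ?thesis unfolding q'_def[symmetric] s0_def[symmetric] using E Y(2) by (subst (asm) ennreal_le_iff) auto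
      qed
    qed (use A(2) B(2) K(2) in_S(10) in auto)
    finally show ?thesis by (simp add: F1_def)
  qed
  have "(\<Sum>i\<in>F. form_term (\<lambda>x. norm (g x)) i) \<le> (\<Sum>i\<in>F. t i)"
    unfolding t_def a_def by (intro sum_mono form_term_le g gint)
  also have "\<dots> = (\<Sum>i\<in>F0. t i)"
  proof (rule sum.mono_neutral_right[OF F(1) F0(2)], rule ballI)
    fix i assume "i \<in> F - F0"
    then have "mass i = 0 \<or> gmass g i = 0" using mass_nonneg[of i] gmass_nonneg[of g i] by (auto simp: F0_def)
    then show "t i = 0" using p0 e01 by (auto simp: t_def)
  qed
  also have "\<dots> = (\<Sum>\<rho>\<in>residue ` F0. \<Sum>i\<in>{i \<in> F0. residue i = \<rho>}. t i)"
    using F0(1) by (intro sum.group[symmetric]) auto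
  also have "\<dots> \<le> (\<Sum>\<rho>\<in>residue ` F0. ?B)" by (intro sum_mono residue_class)
  also have "\<dots> = real (card (residue ` F0)) * ?B" by simp
  also have "\<dots> \<le> real (card residues_set) * ?B"
  proof (rule mult_right_mono[OF _ B0])
    have "residue ` F0 \<subseteq> residues_set" using residue_range by (auto simp: residues_set_def)
    moreover have "finite residues_set" using finite_residues by (simp only: residues_set_def)
    ultimately show "real (card (residue ` F0)) \<le> real (card residues_set)" by (simp add: card_mono)
  qed
  finally show "(\<Sum>i\<in>F. form_term (\<lambda>x. norm (g x)) i) \<le> real (card residues_set) * ?B" .
qed (use gint in auto)

end

section \<open>Degenerate weights and the choice of constants\<close>

lemma epowr_pos:
  assumes "0 < x" "0 < r"
  shows "0 < epowr x r"
proof (cases x)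
  case (real y)
  then have "0 < y" using assms(1) by simp
  then show ?thesis using real assms(2) by (simp add: epowr_ennreal)
next
  case top
  then show ?thesis using assms(2) epowr_top[of r] by simp
qed

lemma wmeas_cube_pos:
  assumes u [measurable]: "u \<in> borel_measurable lebesgue" and pos: "AE x in lebesgue. 0 < u x" and l: "0 < l"
  shows "0 < wmeas u (cube c l)"
proof (rule ccontr)
  assume "\<not> 0 < wmeas u (cube c l)"
  then have "(\<integral>\<^sup>+x. ennreal (u x) * indicator (cube c l) x \<partial>lebesgue) = 0" by (simp add: wmeas_def)
  then have "AE x in lebesgue. ennreal (u x) * indicator (cube c l) x = 0"
    by (subst (asm) nn_integral_0_iff_AE) auto
  then have "AE x in lebesgue. x \<notin> cube c l"
    using pos by eventually_elim (auto simp: indicator_def split: if_splits)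
  then have "emeasure lebesgue (cube c l) = 0" by (subst (asm) AE_iff_null_sets[symmetric]) (auto simp: null_sets_def)
  then show False using l by (simp add: emeasure_cube del: emeasure_completion)
qed

lemma A_const_cube_bound:
  assumes "0 < l"
  shows "epowr (emeasure lebesgue (cube c l)) a * epowr (wmeas u (cube c l)) \<beta> * epowr (wmeas v (cube c l)) \<gamma> \<le> A_const a \<beta> \<gamma> u v"
  unfolding A_const_def by (rule SUP_upper2[of "(c, l)"]) (use assms in auto)

text \<open>Finiteness of the masses of u and v comes from the characteristic: \<beta> and \<gamma>
  are positive and no factor vanishes, so an infinite mass of one cube would make it
  infinite.\<close>

lemma A_const_cubes:
  fixes u v :: "real ^ 'n \<Rightarrow> real"
  assumes fin: "A_const a \<beta> \<gamma> u v = ennreal K" "0 \<le> K" and a: "a < 0" and \<beta>: "0 < \<beta>" "0 < \<gamma>"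
    and pos: "\<And>c l. 0 < l \<Longrightarrow> 0 < wmeas u (cube c l)" "\<And>c l. 0 < l \<Longrightarrow> 0 < wmeas v (cube c l)"
  defines "U \<equiv> \<lambda>A. enn2real (wmeas u A)" and "V \<equiv> \<lambda>A. enn2real (wmeas v A)"
  assumes l: "0 < l"
  shows "wmeas u (cube c l) = ennreal (U (cube c l))" "0 < U (cube c l)"
    "wmeas v (cube c l) = ennreal (V (cube c l))" "0 < V (cube c l)"
    "measure lebesgue (cube c l) powr a * U (cube c l) powr \<beta> * V (cube c l) powr \<gamma> \<le> K" "0 < K"
proof -
  let ?Q = "cube c l"
  define m where "m = l ^ CARD('n)"
  have m: "0 < m" using l by (simp add: m_def)
  have em: "emeasure lebesgue ?Q = ennreal m" using l by (simp add: emeasure_cube m_def del: emeasure_completion)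
  have mm: "measure lebesgue ?Q = m" unfolding measure_def em using m by simp
  have ma: "epowr (emeasure lebesgue ?Q) a = ennreal (m powr a)" unfolding em using m a by (simp add: epowr_def)
  have le: "ennreal (m powr a) * epowr (wmeas u ?Q) \<beta> * epowr (wmeas v ?Q) \<gamma> \<le> ennreal K"
    using A_const_cube_bound[OF l, of c a u \<beta> v \<gamma>] unfolding ma fin .
  have p: "0 < ennreal (m powr a)" "0 < epowr (wmeas u ?Q) \<beta>" "0 < epowr (wmeas v ?Q) \<gamma>"
    using m epowr_pos pos[OF l] \<beta> by auto
  have "wmeas u ?Q \<noteq> \<infinity>"
  proof
    assume "wmeas u ?Q = \<infinity>"
    then have "epowr (wmeas u ?Q) \<beta> = \<infinity>" using epowr_top[OF \<beta>(1)] by simp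
    then have "ennreal (m powr a) * epowr (wmeas u ?Q) \<beta> * epowr (wmeas v ?Q) \<gamma> = \<infinity>"
      using p by (simp add: ennreal_mult_eq_top_iff)
    then show False using le by (simp add: top_unique)
  qed
  then show U: "wmeas u ?Q = ennreal (U ?Q)" unfolding U_def by (simp add: less_top[symmetric])
  have "wmeas v ?Q \<noteq> \<infinity>"
  proof
    assume "wmeas v ?Q = \<infinity>"
    then have "epowr (wmeas v ?Q) \<gamma> = \<infinity>" using epowr_top[OF \<beta>(2)] by simp
    then have "ennreal (m powr a) * epowr (wmeas u ?Q) \<beta> * epowr (wmeas v ?Q) \<gamma> = \<infinity>"
      using p by (simp add: ennreal_mult_eq_top_iff)
    then show False using le by (simp add: top_unique)
  qed
  then show V: "wmeas v ?Q = ennreal (V ?Q)" unfolding V_def by (simp add: less_top[symmetric])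
  show U0: "0 < U ?Q" and V0: "0 < V ?Q" using pos[OF l, of c] unfolding U V by simp_all
  have "ennreal (m powr a * U ?Q powr \<beta> * V ?Q powr \<gamma>) \<le> ennreal K"
    using le \<beta> U0 V0 unfolding U V by (simp add: epowr_ennreal ennreal_mult)
  then show "measure lebesgue ?Q powr a * U ?Q powr \<beta> * V ?Q powr \<gamma> \<le> K"
    unfolding mm using fin(2) by (subst (asm) ennreal_le_iff) auto
  moreover have "0 < measure lebesgue ?Q powr a * U ?Q powr \<beta> * V ?Q powr \<gamma>" using m U0 V0 unfolding mm by simp
  ultimately show "0 < K" by linarith
qed

lemma Linf_c_Lp:
  fixes g :: "real ^ 'n \<Rightarrow> 'b::real_normed_vector"
  assumes g: "g \<in> Linf_c" and s: "0 < s"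
  shows "(\<integral>\<^sup>+x. ennreal (norm (g x) powr s) \<partial>lebesgue) < \<infinity>"
proof -
  obtain C where C: "\<And>x. norm (g x) \<le> C" using g by (auto simp: Linf_c_def bounded_iff)
  obtain b where b: "{x. g x \<noteq> 0} \<subseteq> cbox (- b) b"
    using g bounded_subset_cbox_symmetric unfolding Linf_c_def by blast
  have "(\<integral>\<^sup>+x. ennreal (norm (g x) powr s) \<partial>lebesgue) \<le> (\<integral>\<^sup>+x. ennreal (C powr s) * indicator (cbox (- b) b) x \<partial>lebesgue)"
  proof (rule nn_integral_mono)
    fix x
    show "ennreal (norm (g x) powr s) \<le> ennreal (C powr s) * indicator (cbox (- b) b) x"
    proof (cases "g x = 0")
      case False
      then have "x \<in> cbox (- b) b" using b by auto
      then show ?thesis using C[of x] s by (simp add: ennreal_leI powr_mono2)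
    qed simp
  qed
  also have "\<dots> = ennreal (C powr s) * emeasure lebesgue (cbox (- b) b)" by (rule nn_integral_cmult_indicator) auto
  also have "\<dots> < \<infinity>"
    using emeasure_lborel_cbox_finite[of "- b" b] by (simp add: ennreal_mult_less_top)
  finally show ?thesis .
qed

lemma weighted_norm_AE_zero:
  fixes f :: "real ^ 'n \<Rightarrow> 'b::{real_normed_vector, second_countable_topology}"
  assumes [measurable]: "f \<in> borel_measurable lebesgue" "w \<in> borel_measurable lebesgue"
    and w: "AE x in lebesgue. 0 < w x" and "(\<integral>\<^sup>+x. ennreal (norm (f x) powr p * w x) \<partial>lebesgue) = 0"
  shows "AE x in lebesgue. f x = 0"
proof -
  have "AE x in lebesgue. ennreal (norm (f x) powr p * w x) = 0"
    using assms(4) by (subst (asm) nn_integral_0_iff_AE) auto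
  then show ?thesis
    using w
  proof eventually_elim
    case (elim x)
    then have "norm (f x) powr p * w x \<le> 0" by (simp add: ennreal_eq_0_iff)
    then have "norm (f x) powr p \<le> 0" using elim(2) by (simp add: mult_le_0_iff)
    then show ?case by simp
  qed
qed

text \<open>What remains is to fix the constant before the weights and the functions, to put the
  supports of f and g into one cube of a grid, and to settle the cases in which products of 0 and
  infinity may occur.\<close>

theorem corollary3p4:
  fixes T :: "(real ^ 'n \<Rightarrow> 'b) \<Rightarrow> real ^ 'n \<Rightarrow> 'b::{real_normed_field, euclidean_space}"
    and p0 p q \<alpha> :: real and q0 :: ereal
  assumes "1 \<le> p0" "p0 < p" "p \<le> q" "ereal q < q0"
    and "real CARD('n) * (1 / p - 1 / q) \<le> \<alpha>"
    and "\<alpha> < real CARD('n) * (1 / p0 - real_of_ereal (1 / q0))"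
    and "sublinear_on (Lp_c p0) T"
    and "locally_weak_bounded p0 \<alpha> (\<lambda>f x. ennreal (norm (T f x)))"
    and "locally_weak_bounded p0 \<alpha> (sharp_grand_maximal T q0)"
  shows "\<exists>C::real. 0 \<le> C \<and>
    (\<forall>(\<omega> :: real ^ 'n \<Rightarrow> real) (\<sigma> :: real ^ 'n \<Rightarrow> real).
       weight \<omega> \<longrightarrow> weight \<sigma> \<longrightarrow>
       (let p' = conj_exp (ereal p); q' = conj_exp (ereal q); q0' = conj_exp q0;
            u = (\<lambda>x. \<omega> x powr (p0 / (p0 - p)));
            v = (\<lambda>x. \<sigma> x powr (q0' / (q0' - q')));
            K = A_const (\<alpha> / real CARD('n) - 1 / p0 + real_of_ereal (1 / q0))
                  (1 / p0 - 1 / p) (1 / q - real_of_ereal (1 / q0)) u v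
        in K < \<infinity> \<longrightarrow>
           best_const T p q' \<omega> \<sigma> \<le> ennreal C * K *
             (if p = q \<and> \<alpha> > 0
              then epowr (A_infinity_const u) (1 - 1 / p'\<^sup>2) * epowr (A_infinity_const v) (1 / p'\<^sup>2)
                 + epowr (A_infinity_const u) (1 / p\<^sup>2) * epowr (A_infinity_const v) (1 - 1 / p\<^sup>2)
              else epowr (A_infinity_const u) (1 / q) + epowr (A_infinity_const v) (1 / p'))))"
proof -
  let ?N = "real CARD('n)"
  define e where "e = real_of_ereal (1 / q0)"
  define a where "a = \<alpha> / ?N - 1 / p0 + e"
  define d where "d \<longleftrightarrow> p = q \<and> \<alpha> > 0"
  have p: "1 < p" "1 < q" "p0 < p" "p \<le> q" using assms(1-3) by auto
  have q0: "1 < q0" using assms(4) p(2) by (metis ereal_less(3) less_trans less_ereal.simps(1) one_ereal_def)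
  have e: "0 \<le> e" "e < 1 / q" and conj_q0: "conj_exp q0 = 1 / (1 - e)"
  proof -
    show "e < 1 / q" using assms(4) p unfolding e_def by (cases q0) (auto simp: one_ereal_def frac_less2)
    show "0 \<le> e" unfolding e_def using q0 by (intro real_of_ereal_inverse_nonneg) (auto intro: less_trans[of 0 1])
    show "conj_exp q0 = 1 / (1 - e)"
      using q0 unfolding e_def by (cases q0) (auto simp: conj_exp_def one_ereal_def field_simps)
  qed
  have "1 / q < 1" using p by simp
  then have e1: "e < 1" using e(2) by linarith
  have conj: "conj_exp (ereal p) = p / (p - 1)" "conj_exp (ereal q) = q / (q - 1)" by (simp_all add: conj_exp_def)
  have conj': "1 / (p / (p - 1)) = 1 - 1 / p" "1 / (p / (p - 1))\<^sup>2 = (1 - 1 / p)\<^sup>2" "1 / (q / (q - 1)) = 1 - 1 / q" "1 / p\<^sup>2 = (1 / p)\<^sup>2"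
    using p by (simp_all add: field_simps power2_eq_square)
  have \<alpha>: "0 \<le> \<alpha>"
  proof -
    have "1 / q \<le> 1 / p" using p by (simp add: frac_le)
    then have "0 \<le> ?N * (1 / p - 1 / q)" by simp
    then show ?thesis using assms(5) by linarith
  qed
  have a: "a < 0" using assms(6) unfolding a_def e_def by (simp add: field_simps)
  have exps: "0 < 1 / p0 - 1 / p" "0 < 1 / q - e" using p assms(1) e by (auto simp: frac_less2)
  have d1: "d \<Longrightarrow> p = q" and d2: "\<not> d \<Longrightarrow> p < q \<or> a + (1 / p0 - 1 / p) + (1 / q - e) = 0"
    using \<alpha> p unfolding d_def a_def by auto
  obtain \<phi>T where \<phi>T: "\<And>t. t \<in> {0<..<1} \<Longrightarrow> 0 \<le> \<phi>T t"
    "\<And>t c l g. t \<in> {0<..<1} \<Longrightarrow> 0 < l \<Longrightarrow> set_borel_measurable lebesgue (cube c l) g \<Longrightarrow>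
       (\<integral>\<^sup>+x\<in>cube c l. ennreal (norm (g x) powr p0) \<partial>lebesgue) < \<infinity> \<Longrightarrow>
       emeasure lebesgue {x \<in> cube c l. ennreal (norm (T (restrict_fun (cube c l) g) x))
         > ennreal (\<phi>T t) * avg p0 (cube c l) g * epowr (emeasure lebesgue (cube c l)) (\<alpha> / ?N)}
       \<le> ennreal t * emeasure lebesgue (cube c l)"
    using assms(8) unfolding locally_weak_bounded_def by blast
  obtain \<phi>M where \<phi>M: "\<And>t. t \<in> {0<..<1} \<Longrightarrow> 0 \<le> \<phi>M t"
    "\<And>t c l g. t \<in> {0<..<1} \<Longrightarrow> 0 < l \<Longrightarrow> set_borel_measurable lebesgue (cube c l) g \<Longrightarrow>
       (\<integral>\<^sup>+x\<in>cube c l. ennreal (norm (g x) powr p0) \<partial>lebesgue) < \<infinity> \<Longrightarrow>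
       emeasure lebesgue {x \<in> cube c l. sharp_grand_maximal T q0 (restrict_fun (cube c l) g) x
         > ennreal (\<phi>M t) * avg p0 (cube c l) g * epowr (emeasure lebesgue (cube c l)) (\<alpha> / ?N)}
       \<le> ennreal t * emeasure lebesgue (cube c l)"
    using assms(9) unfolding locally_weak_bounded_def by blast
  \<comment> \<open>The weak bounds are applied on triples; this \<tau> makes their exceptional sets
    at most |Q| / 2^(n+5), small compared with Q itself.\<close>
  define \<tau> where "\<tau> = 1 / (3 ^ CARD('n) * 2 ^ (CARD('n) + 5) :: real)"
  have \<tau>: "0 < \<tau>" "\<tau> * 3 ^ CARD('n) * 2 ^ (CARD('n) + 5) \<le> 1" by (simp_all add: \<tau>_def)
  have \<tau>1: "\<tau> \<in> {0<..<1}"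
  proof -
    have "(1::real) * 1 < 3 ^ CARD('n) * 2 ^ (CARD('n) + 5)"
      by (intro mult_strict_mono one_less_power) auto
    then show ?thesis using \<tau>(1) by (simp add: \<tau>_def divide_less_eq)
  qed
  define cT where "cT = \<phi>T \<tau>"
  define cM where "cM = \<phi>M \<tau>"
  have c0: "0 \<le> cT" "0 \<le> cM" using \<phi>T(1)[OF \<tau>1] \<phi>M(1)[OF \<tau>1] by (simp_all add: cT_def cM_def)
  \<comment> \<open>\<open>nr\<close> and \<open>k0\<close> repeat \<open>residues_set\<close> and
    \<open>step_const\<close> outside the locale: its parameters include f and the grid, while C
    must be chosen before them.\<close>
  define nr where "nr = real (card {v :: int ^ 'n. \<forall>i. v $ i \<in> {0..2}})"
  define k0 where "k0 = 4 * cM + (cT + cT * (nr * 3 ^ CARD('n) * 2 ^ (CARD('n) + 4)))"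
  define tw where "tw = two_weight_const d p q a (1 / p0 - 1 / p) (1 / q - e) (2 * 3 ^ CARD('n))"
  define kX where "kX = embedding_const p0 p"
  define kY where "kY = embedding_const (1 / (1 - e)) (q / (q - 1))"
  \<comment> \<open>Adding 1 makes C positive, so that an infinite bracket yields an infinite
    right-hand side even if the other factors of C vanish.\<close>
  define C where "C = (cT + k0) * (nr * (tw * (kX powr (1 / p) * kY powr (1 - 1 / q)))) + 1"
  have C1: "1 \<le> C"
  proof -
    have "(1::real) \<le> 2 * 3 ^ CARD('n)" using one_le_power[of "3::real" "CARD('n)"] by linarith
    then have "0 \<le> tw" unfolding tw_def using p a d2 by (intro two_weight_const_nonneg) auto
    moreover have "0 \<le> k0" using c0 by (simp add: k0_def nr_def)
    ultimately show ?thesis using c0 by (simp add: C_def nr_def)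
  qed
  show ?thesis
  proof (intro exI[of _ C] conjI allI impI)
    show "0 \<le> C" using C1 by simp
    fix \<omega> \<sigma> :: "real ^ 'n \<Rightarrow> real"
    assume w: "weight \<omega>" "weight \<sigma>"
    define u where "u = (\<lambda>x. \<omega> x powr (p0 / (p0 - p)))"
    define v where "v = (\<lambda>x. \<sigma> x powr ((1 / (1 - e)) / (1 / (1 - e) - q / (q - 1))))"
    define K where "K = A_const a (1 / p0 - 1 / p) (1 / q - e) u v"
    have wm [measurable]: "\<omega> \<in> borel_measurable lebesgue" "\<sigma> \<in> borel_measurable lebesgue"
      and wpos: "AE x in lebesgue. 0 < \<omega> x" "AE x in lebesgue. 0 < \<sigma> x"
      using w by (auto simp: weight_def)
    have um: "u \<in> borel_measurable lebesgue" "v \<in> borel_measurable lebesgue" unfolding u_def v_def by measurable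
    have upos: "AE x in lebesgue. 0 < u x" "AE x in lebesgue. 0 < v x"
      using wpos(1) by (eventually_elim, simp add: u_def) (use wpos(2) in \<open>eventually_elim, simp add: v_def\<close>)
    have bound: "best_const T p (q / (q - 1)) \<omega> \<sigma> \<le> ennreal C * K *
             (if d
              then epowr (A_infinity_const u) (1 - (1 - 1 / p)\<^sup>2) * epowr (A_infinity_const v) ((1 - 1 / p)\<^sup>2)
                 + epowr (A_infinity_const u) ((1 / p)\<^sup>2) * epowr (A_infinity_const v) (1 - (1 / p)\<^sup>2)
              else epowr (A_infinity_const u) (1 / q) + epowr (A_infinity_const v) (1 - 1 / p))"
      (is "_ \<le> ennreal C * K * ?br") if Kfin: "K < \<infinity>"
    proof -
      obtain k where k: "K = ennreal k" "0 \<le> k" using Kfin by (cases K) auto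
      define U where "U = (\<lambda>A. enn2real (wmeas u A))"
      define V where "V = (\<lambda>A. enn2real (wmeas v A))"
      have cubes: "wmeas u (cube c l) = ennreal (U (cube c l))" "0 < U (cube c l)"
        "wmeas v (cube c l) = ennreal (V (cube c l))" "0 < V (cube c l)"
        "measure lebesgue (cube c l) powr a * U (cube c l) powr (1 / p0 - 1 / p) * V (cube c l) powr (1 / q - e) \<le> k"
        "0 < k" if l: "0 < l" for c l
      proof -
        have 1: "0 < wmeas u (cube c l)" "0 < wmeas v (cube c l)" if "0 < l" for c l
          by (rule wmeas_cube_pos[OF um(1) upos(1) that]) (rule wmeas_cube_pos[OF um(2) upos(2) that])
        show "wmeas u (cube c l) = ennreal (U (cube c l))"
          unfolding U_def V_def by (rule A_const_cubes(1)[OF k[unfolded K_def] a exps _ _ l]) (erule 1)+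
        show "0 < U (cube c l)"
          unfolding U_def V_def by (rule A_const_cubes(2)[OF k[unfolded K_def] a exps _ _ l]) (erule 1)+
        show "wmeas v (cube c l) = ennreal (V (cube c l))"
          unfolding U_def V_def by (rule A_const_cubes(3)[OF k[unfolded K_def] a exps _ _ l]) (erule 1)+
        show "0 < V (cube c l)"
          unfolding U_def V_def by (rule A_const_cubes(4)[OF k[unfolded K_def] a exps _ _ l]) (erule 1)+
        show "measure lebesgue (cube c l) powr a * U (cube c l) powr (1 / p0 - 1 / p) * V (cube c l) powr (1 / q - e) \<le> k"
          unfolding U_def V_def by (rule A_const_cubes(5)[OF k[unfolded K_def] a exps _ _ l]) (erule 1)+
        show "0 < k"
          unfolding U_def V_def by (rule A_const_cubes(6)[OF k[unfolded K_def] a exps _ _ l]) (erule 1)+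
      qed
      have k0': "0 < k" using cubes(6)[of 1] by simp
      have fin: "wmeas u (cube c l) < \<infinity>" "wmeas v (cube c l) < \<infinity>" if "0 < l" for c l
        using cubes(1,3)[OF that] by simp_all
      have A1: "1 \<le> A_infinity_const u" "1 \<le> A_infinity_const v"
        by (intro A_infinity_const_ge_1 fin wmeas_cube_pos um upos; simp add: u_def v_def)+
      have sq: "0 < (1 - 1 / p)\<^sup>2" "(1 - 1 / p)\<^sup>2 < 1" "0 < (1 / p)\<^sup>2" "(1 / p)\<^sup>2 < 1" "0 < 1 / q" "0 < 1 - 1 / p"
        using p by (auto simp: power_less_one_iff abs_square_less_1)
      show ?thesis
      proof (cases "A_infinity_const u = \<infinity> \<or> A_infinity_const v = \<infinity>")
        \<comment> \<open>The bracket is infinite: all its exponents are positive and both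
          A_infinity constants are at least 1, so no infinite factor meets a zero. The factor C K is
          positive.\<close>
        case True
        have A0: "0 < A_infinity_const u" "0 < A_infinity_const v" using A1 by (auto intro: less_le_trans[OF zero_less_one])
        have top: "epowr top r = top" if "0 < r" for r using epowr_top[OF that] by simp
        have nz: "epowr (A_infinity_const u) r \<noteq> 0" "epowr (A_infinity_const v) r \<noteq> 0" if "0 < r" for r
          using epowr_pos[OF A0(1) that] epowr_pos[OF A0(2) that] by auto
        have sq': "0 < 1 - (1 - 1 / p)\<^sup>2" "0 < 1 - (1 / p)\<^sup>2" using sq by auto
        have "?br = \<infinity>"
          using True top[OF sq(1)] top[OF sq(3)] top[OF sq(5)] top[OF sq(6)] top[OF sq'(1)] top[OF sq'(2)]
            nz[OF sq(1)] nz[OF sq(3)] nz[OF sq'(1)] nz[OF sq'(2)]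
          by (auto simp: ennreal_mult_eq_top_iff)
        moreover have "ennreal C * K \<noteq> 0" using C1 k k0' by simp
        ultimately show ?thesis by (simp add: ennreal_mult_eq_top_iff)
      next
        case False
        then obtain A B where AB: "A_infinity_const u = ennreal A" "A_infinity_const v = ennreal B" "0 \<le> A" "0 \<le> B"
          by (cases "A_infinity_const u"; cases "A_infinity_const v") auto
        have AB1: "1 \<le> A" "1 \<le> B" using A1 AB by auto
        define br where "br = bracket d p q A B"
        have br: "?br = ennreal br"
          using AB sq by (simp add: br_def bracket_def epowr_ennreal ennreal_mult ennreal_plus)
        have br0: "0 < br" using AB1 by (simp add: br_def bracket_def add_pos_pos)
        have "ennreal C * K * ?br = ennreal (C * k * br)"
          unfolding br k(1) using C1 k br0 by (simp add: ennreal_mult)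
        moreover have "best_const T p (q / (q - 1)) \<omega> \<sigma> \<le> ennreal (C * k * br)"
          unfolding best_const_def
        proof (rule Inf_lower, intro CollectI ballI)
          fix f g :: "real ^ 'n \<Rightarrow> 'b"
          assume f: "f \<in> Linf_c" and g: "g \<in> Linf_c"
          have fm [measurable]: "f \<in> borel_measurable lebesgue" and gm [measurable]: "g \<in> borel_measurable lebesgue"
            using f g by (auto simp: Linf_c_def)
          have f_Lp: "f \<in> Lp_c p0" using f Linf_c_Lp[OF f, of p0] assms(1) by (auto simp: Lp_c_def Linf_c_def)
          have gint: "(\<integral>\<^sup>+x. ennreal (norm (g x) powr (1 / (1 - e))) \<partial>lebesgue) < \<infinity>"
            using e1 by (intro Linf_c_Lp[OF g]) simp
          have "bounded ({x. f x \<noteq> 0} \<union> {x. g x \<noteq> 0})" using f g by (auto simp: Linf_c_def)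
          then obtain R where R: "0 < R" "\<And>x. f x \<noteq> 0 \<or> g x \<noteq> 0 \<Longrightarrow> norm x < R"
            unfolding bounded_pos_less by auto
          \<comment> \<open>With this corner and side 2R, the cube of level 0 and index 0 is the
            product of the intervals [-R, R). It contains the supports of f and g, so
            \<open>D.loc r\<close> is f itself and nothing is lost by integrating over the
            cube.\<close>
          define x0 where "x0 = ((\<chi> i. - R) :: real ^ 'n)"
          interpret D: dyadic_operator x0 "2 * R" T p0 \<alpha> e \<tau> cT cM q0 f
          proof unfold_locales
            show "0 < 2 * R" using R(1) by simp
            show "e = real_of_ereal (1 / q0)" by (rule e_def)
            show "emeasure lebesgue {x \<in> cube c l. ennreal (norm (T (restrict_fun (cube c l) h) x))
                > ennreal cT * avg p0 (cube c l) h * epowr (emeasure lebesgue (cube c l)) (\<alpha> / ?N)}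
              \<le> ennreal \<tau> * emeasure lebesgue (cube c l)"
              if "0 < l" "set_borel_measurable lebesgue (cube c l) h"
                "(\<integral>\<^sup>+x\<in>cube c l. ennreal (norm (h x) powr p0) \<partial>lebesgue) < \<infinity>" for c l h
              unfolding cT_def by (rule \<phi>T(2)[OF \<tau>1 that])
            show "emeasure lebesgue {x \<in> cube c l. sharp_grand_maximal T q0 (restrict_fun (cube c l) h) x
                > ennreal cM * avg p0 (cube c l) h * epowr (emeasure lebesgue (cube c l)) (\<alpha> / ?N)}
              \<le> ennreal \<tau> * emeasure lebesgue (cube c l)"
              if "0 < l" "set_borel_measurable lebesgue (cube c l) h"
                "(\<integral>\<^sup>+x\<in>cube c l. ennreal (norm (h x) powr p0) \<partial>lebesgue) < \<infinity>" for c l h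
              unfolding cM_def by (rule \<phi>M(2)[OF \<tau>1 that])
          qed (fact assms(1) \<alpha> q0 assms(7) \<tau> c0 f_Lp)+
          define r where "r = (0 :: nat, 0 :: int ^ 'n)"
          have in_r: "x \<in> D.dyad r" if "norm x < R" for x
          proof -
            have "\<lfloor>(x $ i + R) / (2 * R)\<rfloor> = 0" for i
            proof -
              have "\<bar>x $ i\<bar> < R" using component_le_norm_cart[of x i] that by linarith
              then have "0 \<le> (x $ i + R) / (2 * R)" "(x $ i + R) / (2 * R) < 1"
                using R(1) by (simp_all add: divide_less_eq)
              then show ?thesis by (simp add: floor_eq_iff)
            qed
            moreover have "x0 $ i = - R" for i by (simp add: x0_def)
            ultimately show ?thesis by (simp add: D.mem_dyad r_def D.idx_def vec_eq_iff D.side_def)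
          qed
          have loc: "D.loc r = f"
          proof
            fix x
            show "D.loc r x = f x"
              using in_r[of x] R(2)[of x] D.dyad_subset_trip[of r] by (auto simp: D.loc_def restrict_fun_def indicator_def)
          qed
          have lhs: "(\<integral>\<^sup>+x. ennreal (norm (T f x) * norm (g x)) \<partial>lebesgue)
             = (\<integral>\<^sup>+x\<in>D.dyad r. ennreal (norm (T (D.loc r) x) * norm (g x)) \<partial>lebesgue)"
            unfolding loc using in_r R(2) by (intro nn_integral_cong) (auto simp: indicator_def)
          define I where "I = (\<integral>\<^sup>+x. ennreal (norm (f x) powr p * \<omega> x) \<partial>lebesgue)"
          define J where "J = (\<integral>\<^sup>+x. ennreal (norm (g x) powr (q / (q - 1)) * \<sigma> x) \<partial>lebesgue)"
          have nf: "weighted_norm p \<omega> f = epowr I (1 / p)" and ng: "weighted_norm (q / (q - 1)) \<sigma> g = epowr J (1 - 1 / q)"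
            unfolding weighted_norm_def I_def J_def conj'(3) by simp_all
          have pe: "0 < 1 / p" "0 < 1 - 1 / q" using p by auto
          show "(\<integral>\<^sup>+x. ennreal (norm (T f x) * norm (g x)) \<partial>lebesgue)
            \<le> ennreal (C * k * br) * weighted_norm p \<omega> f * weighted_norm (q / (q - 1)) \<sigma> g"
          \<comment> \<open>If one norm is 0, the right-hand side is 0 even when the other norm is
            infinite, so the left-hand side must be shown to vanish.\<close>
          proof (cases "I = 0 \<or> J = 0")
            case True
            then show ?thesis
            proof
              assume "I = 0"
              then have "AE x in lebesgue. f x = 0"
                unfolding I_def by (rule weighted_norm_AE_zero[OF fm wm(1) wpos(1)])
              then show ?thesis unfolding lhs by (subst D.zero_bound[OF _ gm gint]) auto
            next
              assume "J = 0"
              then have "AE x in lebesgue. g x = 0"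
                unfolding J_def by (rule weighted_norm_AE_zero[OF gm wm(2) wpos(2)])
              then have "(\<integral>\<^sup>+x. ennreal (norm (T f x) * norm (g x)) \<partial>lebesgue) = (\<integral>\<^sup>+x. 0 \<partial>(lebesgue :: (real ^ 'n) measure))"
                by (intro nn_integral_cong_AE) (auto elim!: eventually_mono)
              then show ?thesis by simp
            qed
          next
            case IJ: False
            then have pos: "0 < epowr I (1 / p)" "0 < epowr J (1 - 1 / q)"
              using epowr_pos[of I] epowr_pos[of J] pe by (simp_all add: zero_less_iff_neq_zero)
            have N0: "0 < C * k * br" using C1 k0' br0 by simp
            show ?thesis
            proof (cases "I = \<infinity> \<or> J = \<infinity>")
              case True
              then have "epowr I (1 / p) = \<infinity> \<or> epowr J (1 - 1 / q) = \<infinity>" using pe epowr_top by auto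
              then have "ennreal (C * k * br) * epowr I (1 / p) * epowr J (1 - 1 / q) = \<infinity>"
                using pos N0 by (auto simp: ennreal_mult_eq_top_iff)
              then show ?thesis unfolding nf ng by simp
            next
              case False
              then obtain X Y where XY: "I = ennreal X" "J = ennreal Y" "0 \<le> X" "0 \<le> Y"
                by (cases I; cases J) auto
              have K0: "D.step_const = k0" "real (card D.residues_set) = nr" "D.carleson_const = 2 * 3 ^ CARD('n)"
                by (simp_all add: D.step_const_def D.avg_ratio_def D.residues_set_def k0_def nr_def D.carleson_const_def)
              have E: "0 \<le> kX" "0 \<le> kY"
              proof -
                show "0 \<le> kX" unfolding kX_def using embedding_const_pos[OF p(3)] by simp
                have "1 / (1 - e) < q / (q - 1)" using e p e1 by (simp add: field_simps)
                from embedding_const_pos[OF this] show "0 \<le> kY" unfolding kY_def by simp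
              qed
              have "(\<integral>\<^sup>+x\<in>D.dyad r. ennreal (norm (T (D.loc r) x) * norm (g x)) \<partial>lebesgue)
                \<le> ennreal ((cT + k0) * (nr * (tw * k * br * ((kX * X) powr (1 / p) * (kY * Y) powr (1 - 1 / q)))))"
                unfolding tw_def br_def kX_def kY_def K0[symmetric]
                by (rule D.weighted_bound[OF p(3,4) e(2) a_def a d1 d2 gm gint wm(1) wpos(1) wm(2) wpos(2) u_def v_def
                      cubes(1-4) AB(1) _ AB(2) _ cubes(5) k(2) XY(1)[unfolded I_def] XY(3) XY(2)[unfolded J_def] XY(4)])
                  (use AB1 in auto)
              also have "\<dots> \<le> ennreal (C * k * br * X powr (1 / p) * Y powr (1 - 1 / q))"
              proof (rule ennreal_leI)
                have "(cT + k0) * (nr * (tw * k * br * ((kX * X) powr (1 / p) * (kY * Y) powr (1 - 1 / q))))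
                  = (C - 1) * (k * br * (X powr (1 / p) * Y powr (1 - 1 / q)))"
                  by (simp add: powr_mult C_def)
                also have "\<dots> \<le> C * (k * br * (X powr (1 / p) * Y powr (1 - 1 / q)))"
                  using k0' br0 by (intro mult_right_mono) auto
                finally show "(cT + k0) * (nr * (tw * k * br * ((kX * X) powr (1 / p) * (kY * Y) powr (1 - 1 / q))))
                  \<le> C * k * br * X powr (1 / p) * Y powr (1 - 1 / q)" by (simp add: mult_ac)
              qed
              also have "\<dots> = ennreal (C * k * br) * epowr I (1 / p) * epowr J (1 - 1 / q)"
                unfolding XY using XY(3,4) pe N0 by (simp add: epowr_ennreal ennreal_mult)
              finally show ?thesis unfolding lhs nf ng .
            qed
          qed
        qed
        ultimately show ?thesis by simp
      qed
    qed
    show "let p' = conj_exp (ereal p); q' = conj_exp (ereal q); q0' = conj_exp q0;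
            u = (\<lambda>x. \<omega> x powr (p0 / (p0 - p)));
            v = (\<lambda>x. \<sigma> x powr (q0' / (q0' - q')));
            K = A_const (\<alpha> / real CARD('n) - 1 / p0 + real_of_ereal (1 / q0))
                  (1 / p0 - 1 / p) (1 / q - real_of_ereal (1 / q0)) u v
        in K < \<infinity> \<longrightarrow>
           best_const T p q' \<omega> \<sigma> \<le> ennreal C * K *
             (if p = q \<and> \<alpha> > 0
              then epowr (A_infinity_const u) (1 - 1 / p'\<^sup>2) * epowr (A_infinity_const v) (1 / p'\<^sup>2)
                 + epowr (A_infinity_const u) (1 / p\<^sup>2) * epowr (A_infinity_const v) (1 - 1 / p\<^sup>2)
              else epowr (A_infinity_const u) (1 / q) + epowr (A_infinity_const v) (1 / p'))"
      unfolding Let_def conj conj_q0 conj' e_def[symmetric] a_def[symmetric] d_def[symmetric] u_def[symmetric] v_def[symmetric] K_def[symmetric]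
      using bound by blast
  qed
qed

end
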